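(* Let $\ell\geq 5$ be an integer and let $G$ be a finite simple graph with girth exactly $2\ell$ that has no even hole of length at least $2\ell+2$. Then $G$ has a vertex of degree $2$, or $G$ has a $K_1$-cut or a $K_2$-cut.
   Context: The girth of a graph is the minimum length of a cycle in it. A hole is an induced cycle of length at least four; it is even if its length is even. A $K_1$-cut (resp. $K_2$-cut) of $G$ is a set $X$ consisting of a single vertex (resp. of the two ends of an edge) such that $G-X$ is disconnected. *)

theory Defs
  imports "Graph_Theory.Graph_Theory" "HOL-Library.Extended_Nat"
begin

text \<open>
  A finite simple graph is a digraph satisfying the locale \<^locale>\<open>graph\<close> (finite, loopfree, no
  multi-arcs, symmetric): an edge uv is represented by the two arcs (u, v) and (v, u), so the
  degree of a vertex v is \<^term>\<open>out_degree G v\<close>.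
\<close>

text \<open>
  In a symmetric digraph the closed walk u, v, u satisfies \<^const>\<open>pre_digraph.cycle\<close>; the length
  bound excludes it.
\<close>
definition graph_cycle :: "('a, 'b) pre_digraph \<Rightarrow> 'b awalk \<Rightarrow> bool" where
  "graph_cycle G p \<longleftrightarrow> pre_digraph.cycle G p \<and> 3 \<le> length p"

text \<open>The girth of a graph without cycles is \<open>\<infinity>\<close>.\<close>
definition girth :: "('a, 'b) pre_digraph \<Rightarrow> enat" where
  "girth G = (INF p \<in> {p. graph_cycle G p}. enat (length p))"

definition cycle_verts :: "('a, 'b) pre_digraph \<Rightarrow> 'b awalk \<Rightarrow> 'a set" where
  "cycle_verts G p = tail G ` set p"

text \<open>
  The arc list of a cycle contains only one of the two arcs of each of its edges, hence the
  converse.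
\<close>
definition cycle_ends :: "('a, 'b) pre_digraph \<Rightarrow> 'b awalk \<Rightarrow> ('a \<times> 'a) set" where
  "cycle_ends G p = arc_to_ends G ` set p \<union> (arc_to_ends G ` set p)\<inverse>"

definition hole :: "('a, 'b) pre_digraph \<Rightarrow> 'b awalk \<Rightarrow> bool" where
  "hole G p \<longleftrightarrow> graph_cycle G p \<and> 4 \<le> length p
     \<and> arcs_ends (G \<restriction> cycle_verts G p) = cycle_ends G p"

text \<open>
  \<^const>\<open>Digraph_Component.connected\<close> is false for the null graph, which we do not regard as
  disconnected either.
\<close>
definition disconnected :: "('a, 'b) pre_digraph \<Rightarrow> bool" where
  "disconnected G \<longleftrightarrow> verts G \<noteq> {} \<and> \<not> Digraph_Component.connected G"

definition K1_cut :: "('a, 'b) pre_digraph \<Rightarrow> 'a set \<Rightarrow> bool" where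
  "K1_cut G X \<longleftrightarrow> (\<exists>v \<in> verts G. X = {v}) \<and> disconnected (G \<restriction> (verts G - X))"

definition K2_cut :: "('a, 'b) pre_digraph \<Rightarrow> 'a set \<Rightarrow> bool" where
  "K2_cut G X \<longleftrightarrow> (\<exists>u v. u \<rightarrow>\<^bsub>G\<^esub> v \<and> X = {u, v}) \<and> disconnected (G \<restriction> (verts G - X))"

end

theory Submission
  imports Defs
begin

text \<open>
  Suppose that all degrees are at least 3 and that there is no cut vertex. Among all pairs of a path
  \<open>T\<close> on three vertices and a proper component \<open>D\<close> of \<open>G - N[T]\<close> take one with \<open>D\<close> minimal (if
  there is none, let \<open>D = G\<close>). Then \<open>G - N[T']\<close> is connected for every such path \<open>T'\<close> in \<open>D\<close>.

  Suppose first that \<open>D\<close> contains an induced cycle \<open>C\<close> of length \<open>2l\<close>. A jump is an induced path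
  between two vertices of \<open>C\<close> with no other contacts to \<open>C\<close>. Either it makes odd cycles with both
  arcs of \<open>C\<close>, or its ends are antipodal and it has length \<open>l\<close>. Connectivity of \<open>G - N[T']\<close> for the
  subpaths \<open>T'\<close> of \<open>C\<close> makes jumps start everywhere on \<open>C\<close>, and parity keeps suitable ones
  disjoint and nonadjacent. Two such jumps together with two arcs of \<open>C\<close> form an even hole that is
  too long.

  Otherwise all holes in \<open>D\<close> are odd. Take a shortest one among those without neighbours on
  the boundary of \<open>D\<close>. It has three disjoint legs to that boundary, ending at \<open>T\<close>, and the three
  jumps formed by pairs of legs have incompatible parities.
\<close>

text \<open>The girth enters mainly in one form: a vertex outside a connected set of at most
  \<open>2 * l - 2\<close> vertices has at most one neighbour in that set
  (\<open>small_conn\<close>). The largest set of fixed size to which this is applied has eight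
  vertices, and this is what \<open>5 \<le> l\<close> pays for. Whole paths on three vertices are
  removed with their neighbourhoods because a path that leaves \<open>C\<close> at a vertex has to
  return far from it: past its first vertex it then avoids the neighbours of that vertex and of the
  two vertices next to it on \<open>C\<close>. On a cycle of even length the parity of an index is a
  proper 2-colouring, so the parity of a non-antipodal jump is determined by its ends; three routes
  between three vertices of \<open>C\<close> then clash. On an odd cycle the two arcs between two
  vertices differ in parity, and the girth decides that the even cycle is the one through the
  shorter arc. Three shorter arcs that go once around an odd cycle have an odd sum, which the three
  jumps formed by the legs cannot match.\<close>

section \<open>Induced paths and induced cycles\<close>

locale simple_graph =
  fixes E :: "'a \<Rightarrow> 'a \<Rightarrow> bool"
  assumes E_sym: "E u v \<Longrightarrow> E v u"
    and E_irrefl: "\<not> E u u"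
begin

lemma E_commute: "E u v \<longleftrightarrow> E v u"
  using E_sym by blast

text \<open>The empty list counts as a path. The condition is vacuous if \<open>xs\<close> is empty,
  so the unspecified \<open>hd []\<close> never matters.\<close>

fun ipath :: "'a list \<Rightarrow> bool" where
  "ipath [] \<longleftrightarrow> True"
| "ipath (x # xs) \<longleftrightarrow> x \<notin> set xs \<and> (\<forall>y\<in>set xs. E x y \<longleftrightarrow> y = hd xs) \<and> ipath xs"

definition cyc :: "'a list \<Rightarrow> bool" where
  "cyc xs \<longleftrightarrow> 3 \<le> length xs \<and> distinct xs \<and> successively E xs \<and> E (last xs) (hd xs)"

definition icyc :: "'a list \<Rightarrow> bool" where
  "icyc xs \<longleftrightarrow> 3 \<le> length xs \<and> hd xs \<notin> set (tl xs) \<and> ipath (tl xs)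
     \<and> (\<forall>y\<in>set (tl xs). E (hd xs) y \<longleftrightarrow> y = hd (tl xs) \<or> y = last (tl xs))"

lemma ipath_append:
  assumes "xs \<noteq> []" "ys \<noteq> []"
  shows "ipath (xs @ ys) \<longleftrightarrow> ipath xs \<and> ipath ys \<and> set xs \<inter> set ys = {}
    \<and> (\<forall>x\<in>set xs. \<forall>y\<in>set ys. E x y \<longleftrightarrow> x = last xs \<and> y = hd ys)"
  using assms
proof (induction xs)
  case (Cons x xs)
  show ?case
  proof (cases "xs = []")
    case True
    with Cons.prems show ?thesis by auto
  next
    case False
    then have "hd (xs @ ys) = hd xs" "last (x # xs) = last xs" by auto
    moreover have "hd xs \<in> set xs" "hd ys \<in> set ys" "last xs \<in> set xs"
      using False Cons.prems by auto
    ultimately show ?thesis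
      using Cons.IH[OF False Cons.prems(2)] by (simp only: append_Cons ipath.simps set_append) auto
  qed
qed simp

lemma ipath_distinct: "ipath xs \<Longrightarrow> distinct xs"
  by (induction xs) auto

lemma ipath_successively: "ipath xs \<Longrightarrow> successively E xs"
proof (induction xs)
  case (Cons x xs)
  then show ?case using hd_in_set[of xs] by (cases "xs = []") (auto simp: successively_Cons)
qed simp

lemma ipath_rev [simp]: "ipath (rev xs) \<longleftrightarrow> ipath xs"
proof (induction xs)
  case (Cons x xs)
  show ?case
  proof (cases "xs = []")
    case False
    have "ipath (rev xs @ [x]) \<longleftrightarrow> ipath (rev xs) \<and> x \<notin> set xs \<and> (\<forall>y\<in>set xs. E y x \<longleftrightarrow> y = hd xs)"
      using False by (subst ipath_append) (auto simp: last_rev)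
    then show ?thesis using Cons by (auto simp: E_commute)
  qed simp
qed simp

lemma ipath_prefix: "ipath (xs @ ys) \<Longrightarrow> ipath xs"
  by (cases "xs = []"; cases "ys = []") (auto simp: ipath_append)

lemma ipath_suffix: "ipath (xs @ ys) \<Longrightarrow> ipath ys"
  by (cases "xs = []"; cases "ys = []") (auto simp: ipath_append)

lemma ipath_nth:
  assumes "ipath xs" "i < length xs" "j < length xs"
  shows "E (xs ! i) (xs ! j) \<longleftrightarrow> j = Suc i \<or> i = Suc j"
  using assms
proof (induction xs arbitrary: i j)
  case (Cons x xs)
  have *: "E x (xs ! k) \<longleftrightarrow> k = 0" if "k < length xs" for k
  proof -
    have "xs ! k = hd xs \<longleftrightarrow> k = 0"
      using that Cons.prems(1) ipath_distinct[of xs]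
      by (metis hd_conv_nth length_greater_0_conv length_pos_if_in_set nth_eq_iff_index_eq nth_mem ipath.simps(2))
    with that Cons.prems(1) show ?thesis by auto
  qed
  show ?case
    using Cons * E_irrefl by (cases i; cases j) (auto simp: E_commute[of _ x])
qed simp

text \<open>The holes made of paths and arcs below are assembled this way, from two disjoint induced
  paths read one after the other and exactly two edges between them. The second path has to run back
  to the start of the first, hence the reversals in later uses.\<close>

lemma icycI:
  assumes "xs \<noteq> []" "ys \<noteq> []" "3 \<le> length xs + length ys" "ipath xs" "ipath ys"
    and dis: "set xs \<inter> set ys = {}"
    and cross: "\<And>x y. x \<in> set xs \<Longrightarrow> y \<in> set ys \<Longrightarrow>
      E x y \<longleftrightarrow> x = last xs \<and> y = hd ys \<or> x = hd xs \<and> y = last ys"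
  shows "icyc (xs @ ys)"
proof -
  obtain x zs where xs: "xs = x # zs" using assms(1) by (cases xs) auto
  show ?thesis
  proof (cases "zs = []")
    case True
    with assms xs show ?thesis by (auto simp: icyc_def)
  next
    case False
    have x: "x \<notin> set zs" "ipath zs" and xz: "\<forall>y\<in>set zs. E x y \<longleftrightarrow> y = hd zs"
      using assms(4) xs by auto
    have "ipath (zs @ ys)"
      using False assms(2,5) dis x xs cross by (subst ipath_append) auto
    moreover have "\<forall>y\<in>set (zs @ ys). E x y \<longleftrightarrow> y = hd (zs @ ys) \<or> y = last (zs @ ys)"
    proof
      fix y assume y: "y \<in> set (zs @ ys)"
      have "hd zs \<in> set zs" "last ys \<in> set ys" "last zs \<in> set zs" using False assms(2) by auto
      then show "E x y \<longleftrightarrow> y = hd (zs @ ys) \<or> y = last (zs @ ys)"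
        using y xz cross[of x y] xs False assms(2) dis x by auto
    qed
    ultimately show ?thesis
      using xs x dis assms(3) by (auto simp: icyc_def)
  qed
qed

lemma icyc_cyc:
  assumes "icyc xs" shows "cyc xs"
proof -
  obtain x ys where xs: "xs = x # ys" using assms by (cases xs) (auto simp: icyc_def)
  with assms have "ys \<noteq> []" by (auto simp: icyc_def)
  with assms xs have "ys \<noteq> []" "x \<notin> set ys" "ipath ys" "E x (hd ys)" "E x (last ys)" "3 \<le> length xs"
    using hd_in_set[of ys] last_in_set[of ys] by (auto simp: icyc_def)
  then show ?thesis
    using xs ipath_distinct ipath_successively by (auto simp: cyc_def successively_Cons E_commute)
qed

lemma icyc_nth:
  assumes "icyc xs" "i < length xs" "j < length xs"
  shows "E (xs ! i) (xs ! j) \<longleftrightarrow>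
    j = Suc i \<or> i = Suc j \<or> i = 0 \<and> j = length xs - 1 \<or> j = 0 \<and> i = length xs - 1"
proof -
  obtain x ys where xs: "xs = x # ys" using assms by (cases xs) (auto simp: icyc_def)
  with assms have ys: "2 \<le> length ys" "ys \<noteq> []" "ipath ys"
    and x: "\<forall>y\<in>set ys. E x y \<longleftrightarrow> y = hd ys \<or> y = last ys"
    by (auto simp: icyc_def)
  have *: "E x (ys ! k) \<longleftrightarrow> k = 0 \<or> k = length ys - 1" if "k < length ys" for k
  proof -
    have "ys ! k = hd ys \<longleftrightarrow> k = 0" "ys ! k = last ys \<longleftrightarrow> k = length ys - 1"
      using that ys ipath_distinct[of ys]
      by (auto simp: hd_conv_nth last_conv_nth nth_eq_iff_index_eq)
    then show ?thesis using that x by auto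
  qed
  show ?thesis
    using assms(2,3) ys ipath_nth[OF ys(3)] * E_irrefl xs
    by (cases i; cases j) (auto simp: E_commute[of _ x])
qed

lemma icyc_distinct: "icyc xs \<Longrightarrow> distinct xs"
  using icyc_cyc cyc_def by blast

subsection \<open>Shortest paths and cycles\<close>

lemma ipathI:
  assumes "distinct xs" "successively E xs"
    and nc: "\<And>as u bs w cs. xs = as @ u # bs @ w # cs \<Longrightarrow> bs \<noteq> [] \<Longrightarrow> \<not> E u w"
  shows "ipath xs"
proof -
  have "ipath zs" if "xs = as @ zs" for as zs
    using that
  proof (induction zs arbitrary: as)
    case (Cons z zs)
    have "ipath zs" using Cons.IH[of "as @ [z]"] Cons.prems by simp
    moreover have "z \<notin> set zs" using assms(1) Cons.prems by auto
    moreover have "E z w \<longleftrightarrow> w = hd zs" if "w \<in> set zs" for w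
    proof
      assume "E z w"
      from that obtain bs cs where "zs = bs @ w # cs" by (auto simp: in_set_conv_decomp)
      with nc[of as z bs w cs] \<open>E z w\<close> Cons.prems show "w = hd zs" by (cases bs) auto
    next
      assume "w = hd zs"
      then show "E z w" using assms(2) Cons.prems that
        by (cases zs) (auto simp: successively_append_iff successively_Cons)
    qed
    ultimately show ?case by auto
  qed simp
  from this[of "[]" xs] show ?thesis by simp
qed

definition joined :: "'a set \<Rightarrow> 'a \<Rightarrow> 'a \<Rightarrow> bool" where
  "joined S x y \<longleftrightarrow> (\<exists>xs. xs \<noteq> [] \<and> hd xs = x \<and> last xs = y \<and> set xs \<subseteq> S \<and> successively E xs)"

definition conn :: "'a set \<Rightarrow> bool" where
  "conn S \<longleftrightarrow> (\<forall>x\<in>S. \<forall>y\<in>S. joined S x y)"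

text \<open>In a walk of minimal length a repeated vertex or a chord would allow a shortcut, and an
  earlier vertex satisfying \<open>Tg\<close> would be an earlier end. The last conclusion is what
  later confines the contacts of the path to its end.\<close>

lemma shortest_ipath:
  assumes "joined S x y" "Tg y"
  obtains xs where "xs \<noteq> []" "hd xs = x" "Tg (last xs)" "set xs \<subseteq> S" "ipath xs"
    "\<forall>u\<in>set xs. u \<noteq> last xs \<longrightarrow> \<not> Tg u"
proof -
  let ?W = "\<lambda>xs. xs \<noteq> [] \<and> hd xs = x \<and> Tg (last xs) \<and> set xs \<subseteq> S \<and> successively E xs"
  obtain ws where ws: "?W ws" using assms by (auto simp: joined_def)
  define xs where "xs = arg_min length ?W"
  have xs: "?W xs" unfolding xs_def by (rule arg_min_natI[of ?W, OF ws])
  have min: "length xs \<le> length ys" if "?W ys" for ys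
    unfolding xs_def by (rule arg_min_nat_le[of ?W, OF that])
  have nTg: "\<not> Tg u" if "xs = as @ u # bs" "bs \<noteq> []" for as u bs
  proof
    assume "Tg u"
    then have "?W (as @ [u])"
      using xs that by (cases as) (auto simp: successively_append_iff successively_Cons hd_append split: if_splits)
    from min[OF this] that show False by simp
  qed
  have short: "\<not> E u w" if "xs = as @ u # bs @ w # cs" "bs \<noteq> []" for as u bs w cs
  proof
    assume "E u w"
    then have "?W (as @ u # w # cs)"
      using xs that by (cases as; cases cs)
        (auto simp: successively_append_iff successively_Cons hd_append split: if_splits)
    from min[OF this] that show False by simp
  qed
  have neq: "u \<noteq> w" if "xs = as @ u # bs @ w # cs" for as u bs w cs
  proof
    assume "u = w"
    then have "?W (as @ u # cs)"
      using xs that by (cases as; cases cs)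
        (auto simp: successively_append_iff successively_Cons hd_append split: if_splits)
    from min[OF this] that show False by simp
  qed
  have "distinct xs" using neq not_distinct_decomp[of xs] by (metis append_Cons append_Nil append_assoc)
  then have "ipath xs" using xs short by (intro ipathI) blast+
  moreover have "\<forall>u\<in>set xs. u \<noteq> last xs \<longrightarrow> \<not> Tg u"
  proof (intro ballI impI)
    fix u assume that: "u \<in> set xs" "u \<noteq> last xs"
    from that obtain as bs where "xs = as @ u # bs" by (auto simp: in_set_conv_decomp)
    with that nTg show "\<not> Tg u" by (metis last_snoc)
  qed
  ultimately show ?thesis using that xs by blast
qed

text \<open>A chord splits off a shorter cycle on some of the same vertices.\<close>

lemma shortest_cycle:
  assumes xs: "cyc xs" and min: "\<And>ys. cyc ys \<Longrightarrow> set ys \<subseteq> set xs \<Longrightarrow> length xs \<le> length ys"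
  shows "icyc xs"
proof -
  obtain x ys where x: "xs = x # ys" using xs by (cases xs) (auto simp: cyc_def)
  have ys: "distinct ys" "successively E ys" "x \<notin> set ys" "2 \<le> length ys" "E x (hd ys)" "E (last ys) x" "ys \<noteq> []"
    using xs x by (cases ys; auto simp: cyc_def successively_Cons)+
  have "ipath ys"
  proof (rule ipathI[OF ys(1,2)])
    fix as u bs w cs assume d: "ys = as @ u # bs @ w # cs" "bs \<noteq> []"
    show "\<not> E u w"
    proof
      assume "E u w"
      then have "cyc (u # bs @ [w])"
        using d ys(1,2) E_sym by (auto simp: cyc_def successively_append_iff successively_Cons Suc_le_eq)
      from min[OF this] d x show False by auto
    qed
  qed
  moreover have "E x y \<longleftrightarrow> y = hd ys \<or> y = last ys" if "y \<in> set ys" for y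
  proof
    assume e: "E x y"
    from that obtain as bs where d: "ys = as @ y # bs" by (auto simp: in_set_conv_decomp)
    show "y = hd ys \<or> y = last ys"
    proof (rule ccontr)
      assume "\<not> ?thesis"
      then have ne: "as \<noteq> []" "bs \<noteq> []" using d by auto
      then have "cyc (x # as @ [y])"
        using d ys e E_sym by (auto simp: cyc_def successively_append_iff successively_Cons hd_append Suc_le_eq)
      from min[OF this] d x ne show False by auto
    qed
  qed (use ys E_sym in auto)
  ultimately show ?thesis using x ys by (auto simp: icyc_def)
qed

text \<open>The first vertex of a longest path in \<open>D\<close> has a neighbour other than the
  second vertex. By maximality it lies on the path and closes a cycle.\<close>

lemma cycle_exists:
  assumes "finite D" "D \<noteq> {}" and deg: "\<And>u a. u \<in> D \<Longrightarrow> \<exists>w\<in>D. E u w \<and> w \<noteq> a"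
  obtains xs where "cyc xs" "set xs \<subseteq> D"
proof -
  let ?W = "\<lambda>xs. xs \<noteq> [] \<and> distinct xs \<and> set xs \<subseteq> D \<and> successively E xs"
  obtain u where "u \<in> D" using assms(2) by blast
  then have w0: "?W [u]" by simp
  have bd: "\<forall>xs. ?W xs \<longrightarrow> length xs < Suc (card D)"
    using assms(1) by (metis card_mono distinct_card less_Suc_eq_le)
  from ex_has_greatest_nat[of ?W "[u]" length "Suc (card D)", OF w0 bd]
  obtain xs where m: "?W xs \<and> (\<forall>ys. ?W ys \<longrightarrow> length ys \<le> length xs)"
    by (elim exE) (rule that)
  have xs: "?W xs" using m by (rule conjunct1)
  have max': "\<forall>ys. ?W ys \<longrightarrow> length ys \<le> length xs" using m by (rule conjunct2)
  have max: "length ys \<le> length xs" if "?W ys" for ys using max' that by blast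
  obtain x ys where x: "xs = x # ys" using xs by (cases xs) auto
  \<comment> \<open>For a path with a single vertex there is no second vertex to avoid, and
    \<open>x\<close> serves as a dummy.\<close>
  obtain w where w: "w \<in> D" "E x w" "w \<noteq> (if ys = [] then x else hd ys)"
    using deg[of x "if ys = [] then x else hd ys"] xs x by auto
  have "w \<in> set xs"
  proof (rule ccontr)
    assume "w \<notin> set xs"
    then have "?W (w # xs)" using xs w x E_sym by (auto simp: successively_Cons)
    from max[OF this] show False by simp
  qed
  moreover have "w \<noteq> x" using w E_irrefl by auto
  ultimately obtain as bs where d: "ys = as @ w # bs" using x by (auto simp: in_set_conv_decomp)
  then have "as \<noteq> []" using w by auto
  then have "cyc (x # as @ [w])"
    using d x xs w E_sym by (auto simp: cyc_def successively_append_iff successively_Cons hd_append Suc_le_eq)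
  moreover have "set (x # as @ [w]) \<subseteq> D" using xs x d by auto
  ultimately show ?thesis using that by blast
qed

section \<open>Connected vertex sets\<close>

lemma joined_refl: "x \<in> S \<Longrightarrow> joined S x x"
  unfolding joined_def by (intro exI[of _ "[x]"]) auto

lemma joined_mono: "joined S x y \<Longrightarrow> S \<subseteq> S' \<Longrightarrow> joined S' x y"
  unfolding joined_def by blast

lemma joined_in: "joined S x y \<Longrightarrow> x \<in> S \<and> y \<in> S"
  unfolding joined_def by (metis hd_in_set last_in_set subsetD)

lemma joined_step: "E x y \<Longrightarrow> joined S y z \<Longrightarrow> x \<in> S \<Longrightarrow> joined S x z"
  unfolding joined_def
  by (elim exE, rule_tac x="x # xs" in exI) (auto simp: successively_Cons)

lemma joined_edge: "E x y \<Longrightarrow> x \<in> S \<Longrightarrow> y \<in> S \<Longrightarrow> joined S x y"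
  using joined_step joined_refl by blast

lemma joined_sym: "joined S x y \<Longrightarrow> joined S y x"
  unfolding joined_def
  by (elim exE, rule_tac x="rev xs" in exI)
    (auto simp: hd_rev last_rev E_commute conversep_iff successively_rev)

lemma joined_trans:
  assumes "joined S x y" "joined S y z" shows "joined S x z"
proof -
  obtain xs where xs: "xs \<noteq> []" "hd xs = x" "last xs = y" "set xs \<subseteq> S" "successively E xs"
    using assms(1) by (auto simp: joined_def)
  obtain ys where ys: "ys \<noteq> []" "hd ys = y" "last ys = z" "set ys \<subseteq> S" "successively E ys"
    using assms(2) by (auto simp: joined_def)
  obtain ys' where y: "ys = y # ys'" using ys by (cases ys) auto
  have "successively E (xs @ ys')" "hd (xs @ ys') = x" "last (xs @ ys') = z"
    using xs ys y by (auto simp: successively_append_iff successively_Cons last_append hd_append split: if_splits)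
  then show ?thesis unfolding joined_def using xs ys y by (intro exI[of _ "xs @ ys'"]) auto
qed

lemma joined_closed:
  assumes "joined S x u" "x \<in> D" and cl: "\<And>a b. a \<in> D \<Longrightarrow> b \<in> S \<Longrightarrow> E a b \<Longrightarrow> b \<in> D"
  shows "u \<in> D"
proof -
  have "xs \<noteq> [] \<Longrightarrow> hd xs \<in> D \<Longrightarrow> set xs \<subseteq> S \<Longrightarrow> successively E xs \<Longrightarrow> last xs \<in> D" for xs
  proof (induction xs)
    case (Cons a xs)
    show ?case
    proof (cases "xs = []")
      case False
      then have "hd xs \<in> S" using Cons.prems(3) hd_in_set[OF False] by (metis list.set_intros(2) subsetD)
      then show ?thesis using False Cons cl[of a "hd xs"] by (auto simp: successively_Cons)
    qed (use Cons in simp)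
  qed simp
  then show ?thesis using assms(1,2) unfolding joined_def by blast
qed

definition component :: "'a set \<Rightarrow> 'a \<Rightarrow> 'a set" where
  "component S x = {u. joined S x u}"

lemma component_closed: "u \<in> component S x \<Longrightarrow> w \<in> S \<Longrightarrow> E u w \<Longrightarrow> w \<in> component S x"
  unfolding component_def using joined_trans joined_edge joined_in by blast

lemma component_sub: "component S x \<subseteq> S"
  unfolding component_def using joined_in by blast

lemma component_joined:
  assumes "u \<in> component S x" shows "joined (component S x) x u"
proof -
  obtain xs where xs: "xs \<noteq> []" "hd xs = x" "last xs = u" "set xs \<subseteq> S" "successively E xs"
    using assms by (auto simp: component_def joined_def)
  have "joined S x v" if v: "v \<in> set xs" for v
  proof -
    obtain as bs where d: "xs = as @ v # bs" using split_list[OF v] by blast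
    have d': "xs = (as @ [v]) @ bs" using d by simp
    have "hd (as @ [v]) = x" using xs(2) d by (cases as) simp_all
    moreover have "set (as @ [v]) \<subseteq> S" using xs(4) d' by auto
    moreover have "successively E (as @ [v])" using xs(5) unfolding d' successively_append_iff[of E "as @ [v]"] by blast
    ultimately show ?thesis unfolding joined_def by (intro exI[of _ "as @ [v]"]) auto
  qed
  then show ?thesis using xs unfolding joined_def component_def by (intro exI[of _ xs]) auto
qed

lemma conn_path: "successively E xs \<Longrightarrow> conn (set xs)"
proof (induction xs)
  case (Cons x xs)
  show ?case
  proof (cases "xs = []")
    case True then show ?thesis by (auto simp: conn_def joined_refl)
  next
    case False
    with Cons have c: "conn (set xs)" and e: "E x (hd xs)" by (auto simp: successively_Cons)
    have "joined (set (x # xs)) x y" if "y \<in> set (x # xs)" for y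
      using that c e False joined_step[OF e, of "set (x # xs)" y] joined_mono[of "set xs" "hd xs" y "set (x # xs)"]
      by (cases "y = x") (auto simp: conn_def joined_refl)
    then show ?thesis unfolding conn_def using joined_sym joined_trans by (metis list.set_intros(1))
  qed
qed (simp add: conn_def)

lemma conn_Un:
  assumes "conn S" "conn S'" "u \<in> S" "w \<in> S'" "E u w \<or> u = w"
  shows "conn (S \<union> S')"
proof -
  have uw: "joined (S \<union> S') u w" using assms joined_edge[of u w "S \<union> S'"] joined_refl by auto
  have 1: "joined (S \<union> S') x u" if "x \<in> S" for x
    using that assms(1,3) by (intro joined_mono[of S x u "S \<union> S'"]) (auto simp: conn_def)
  have 2: "joined (S \<union> S') x w" if "x \<in> S'" for x
    using that assms(2,4) by (intro joined_mono[of S' x w "S \<union> S'"]) (auto simp: conn_def)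
  have "joined (S \<union> S') x u" if "x \<in> S \<union> S'" for x
    using that 1 2 uw joined_sym joined_trans by blast
  then show ?thesis unfolding conn_def using joined_sym joined_trans by blast
qed

lemma conn_insert: "conn S \<Longrightarrow> u \<in> S \<Longrightarrow> E u w \<Longrightarrow> conn (insert w S)"
  using conn_Un[of S "{w}" u w] by (auto simp: conn_def joined_refl)

lemma conn_single: "conn {x}"
  by (auto simp: conn_def joined_refl)

lemma triple_conn:
  assumes "E a b" "E b c" shows "conn {a, b, c}"
proof -
  have "conn (insert a (insert c {b}))"
    using assms by (intro conn_insert[of _ b] conn_single) (auto intro: E_sym)
  then show ?thesis by (simp add: insert_commute)
qed

end

section \<open>Holes as periodic maps\<close>

text \<open>Compared indices differ by less than one period, so the numbers tested for divisibility
  stay below two periods. This reduces adjacency on a hole to linear arithmetic.\<close>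

lemma dvd_small:
  fixes n k :: int
  assumes "\<bar>k\<bar> < 2 * n"
  shows "n dvd k \<longleftrightarrow> k = 0 \<or> k = n \<or> k = - n"
proof
  assume "n dvd k"
  then obtain c where c: "k = n * c" by auto
  have n: "0 < n" using assms by linarith
  have "\<bar>c\<bar> < 2"
  proof (rule ccontr)
    assume "\<not> \<bar>c\<bar> < 2"
    then have "n * 2 \<le> n * \<bar>c\<bar>" using n by (intro mult_left_mono) auto
    with assms c n show False by (simp add: abs_mult)
  qed
  then have "c = 0 \<or> c = 1 \<or> c = -1" by linarith
  with c show "k = 0 \<or> k = n \<or> k = - n" by auto
qed auto

context simple_graph
begin

text \<open>
  An induced cycle of length \<open>n\<close> as an \<open>n\<close>-periodic map on the integers; the arc from
  \<open>f a\<close> to \<open>f b\<close> with \<open>a < b < a + n\<close> is then \<^term>\<open>map f [a..b]\<close>, without index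
  arithmetic modulo \<open>n\<close>.
\<close>
definition hole_fn :: "int \<Rightarrow> (int \<Rightarrow> 'a) \<Rightarrow> bool" where
  "hole_fn n f \<longleftrightarrow> 4 \<le> n \<and> (\<forall>i j. f i = f j \<longleftrightarrow> n dvd i - j)
     \<and> (\<forall>i j. E (f i) (f j) \<longleftrightarrow> n dvd i - j - 1 \<or> n dvd j - i - 1)"

lemma hole_eq: "hole_fn n f \<Longrightarrow> \<bar>i - j\<bar> < n \<Longrightarrow> f i = f j \<longleftrightarrow> i = j"
  unfolding hole_fn_def using dvd_small[of "i - j" n] by auto

lemma hole_adj:
  assumes "hole_fn n f" "\<bar>i - j\<bar> < n"
  shows "E (f i) (f j) \<longleftrightarrow> \<bar>i - j\<bar> = 1 \<or> \<bar>i - j\<bar> = n - 1"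
  using assms dvd_small[of "i - j - 1" n] dvd_small[of "j - i - 1" n]
  unfolding hole_fn_def by auto

lemma hole_adj_Suc: "hole_fn n f \<Longrightarrow> E (f i) (f (i + 1))"
  by (simp add: hole_fn_def)

lemma hole_period: "hole_fn n f \<Longrightarrow> f (i + n) = f i"
  by (simp add: hole_fn_def)

text \<open>The window may start anywhere. Choosing it at an end of a jump replaces arguments about
  the cyclic order.\<close>

lemma hole_index:
  assumes "hole_fn n f"
  obtains j where "f i = f j" "a \<le> j" "j < a + n"
proof -
  have n: "0 < n" using assms by (simp add: hole_fn_def)
  let ?j = "a + (i - a) mod n"
  have "i - ?j = n * ((i - a) div n)" using minus_mod_eq_mult_div[of "i - a" n] by simp
  then have "f i = f ?j" using assms by (simp add: hole_fn_def)
  moreover have "a \<le> ?j" "?j < a + n" using n by auto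
  ultimately show ?thesis using that by blast
qed

lemma icyc_hole_fn:
  assumes xs: "icyc xs" and len: "4 \<le> length xs"
  obtains f where "hole_fn (int (length xs)) f" "range f = set xs"
proof -
  define n where "n = int (length xs)"
  define f where "f i = xs ! nat (i mod n)" for i
  have n: "4 \<le> n" using len by (simp add: n_def)
  have lt: "nat (i mod n) < length xs" for i
    using n pos_mod_bound[of n i] pos_mod_sign[of n i] unfolding n_def by linarith
  have eq: "f i = f j \<longleftrightarrow> n dvd i - j" for i j
  proof -
    have "f i = f j \<longleftrightarrow> i mod n = j mod n"
      unfolding f_def using icyc_distinct[OF xs] lt n by (simp add: nth_eq_iff_index_eq eq_nat_nat_iff)
    then show ?thesis by (simp add: mod_eq_dvd_iff)
  qed
  have suc: "n dvd i - j - 1 \<longleftrightarrow> nat (i mod n) = Suc (nat (j mod n)) \<or> nat (i mod n) = 0 \<and> nat (j mod n) = length xs - 1" for i j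
  proof -
    have b: "0 \<le> i mod n" "i mod n < n" "0 \<le> j mod n" "j mod n < n" using n by auto
    have "n dvd i - j - 1 \<longleftrightarrow> n dvd i mod n - j mod n - 1"
    proof -
      have "i - j - 1 = (i mod n - j mod n - 1) + n * (i div n - j div n)"
        using mult_div_mod_eq[of n i] mult_div_mod_eq[of n j] unfolding right_diff_distrib by linarith
      then show ?thesis using dvd_add_left_iff[of n "n * (i div n - j div n)" "i mod n - j mod n - 1"] by (simp only: dvd_triv_left)
    qed
    also have "\<dots> \<longleftrightarrow> i mod n - j mod n - 1 = 0 \<or> i mod n - j mod n - 1 = - n"
      using b by (subst dvd_small) linarith+
    also have "\<dots> \<longleftrightarrow> nat (i mod n) = Suc (nat (j mod n)) \<or> nat (i mod n) = 0 \<and> nat (j mod n) = length xs - 1"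
      using b n unfolding n_def by linarith
    finally show ?thesis .
  qed
  have adj: "E (f i) (f j) \<longleftrightarrow> n dvd i - j - 1 \<or> n dvd j - i - 1" for i j
    unfolding f_def using icyc_nth[OF xs lt lt, of i j] suc[of i j] suc[of j i] by auto
  have "xs ! k \<in> range f" if "k < length xs" for k
    by (rule range_eqI[of _ _ "int k"]) (use that in \<open>simp add: f_def n_def\<close>)
  then have "range f = set xs"
    using lt nth_mem unfolding f_def by (fastforce simp: in_set_conv_nth)
  moreover have "hole_fn (int (length xs)) f"
    using n eq adj unfolding n_def hole_fn_def by blast
  ultimately show ?thesis using that by blast
qed

text \<open>The bound \<open>n - 2\<close> says that at least one vertex of the hole is left out, so
  the ends of the arc are not adjacent around the back.\<close>

lemma arc_ipath:
  assumes f: "hole_fn n f" and "b - a \<le> n - 2"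
  shows "ipath (map f [a..b])"
  using assms(2)
proof (induction "nat (b - a + 1)" arbitrary: a)
  case (Suc k)
  then have ab: "a \<le> b" by linarith
  have IH: "ipath (map f [a + 1..b])" using Suc by (intro Suc.hyps) auto
  have "f a \<noteq> f i" if "a + 1 \<le> i" "i \<le> b" for i
    using that Suc.prems hole_eq[OF f, of a i] by auto
  then have ne: "f a \<notin> set (map f [a + 1..b])" by fastforce
  have adj: "E (f a) (f i) \<longleftrightarrow> f i = hd (map f [a + 1..b])" if "a + 1 \<le> i" "i \<le> b" for i
  proof -
    have "hd (map f [a + 1..b]) = f (a + 1)" using that by (simp add: upto_rec1)
    then show ?thesis
      using that Suc.prems hole_adj[OF f, of a i] hole_eq[OF f, of i "a + 1"] by auto
  qed
  have "\<forall>y\<in>set (map f [a + 1..b]). E (f a) y \<longleftrightarrow> y = hd (map f [a + 1..b])"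
    using adj by auto
  moreover note ne
  moreover have "map f [a..b] = f a # map f [a + 1..b]" using ab by (simp add: upto_rec1)
  ultimately show ?case using IH by (metis ipath.simps(2))
qed simp

lemma hd_arc: "a \<le> b \<Longrightarrow> hd (map f [a..b]) = f a"
  by (simp add: upto_rec1)

lemma last_arc: "a \<le> b \<Longrightarrow> last (map f [a..b]) = f b"
  by (simp add: upto_rec2)

subsection \<open>Jumps\<close>

text \<open>
  \<open>P\<close> is the interior of the path from \<open>x\<close> to \<open>y\<close>, hence the \<open>+ 1\<close> in the lengths below.
\<close>
definition jump :: "'a set \<Rightarrow> 'a list \<Rightarrow> 'a \<Rightarrow> 'a \<Rightarrow> bool" where
  "jump C P x y \<longleftrightarrow> P \<noteq> [] \<and> ipath P \<and> set P \<inter> C = {} \<and> x \<in> C \<and> y \<in> C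
     \<and> (\<forall>p\<in>set P. \<forall>c\<in>C. E p c \<longleftrightarrow> p = hd P \<and> c = x \<or> p = last P \<and> c = y)"

lemma jump_rev: "jump C P x y \<Longrightarrow> jump C (rev P) y x"
  by (auto simp: jump_def hd_rev last_rev)

text \<open>The contacts of \<open>P\<close> are prescribed on the arc only. Thus \<open>P\<close>
  may have further neighbours on the rest of the hole, which matters for paths with more than two
  contacts.\<close>

lemma path_arc_hole:
  assumes f: "hole_fn n f" and ab: "a < b" "b - a \<le> n - 2"
    and P: "P \<noteq> []" "ipath P" "set P \<inter> range f = {}"
    and att: "\<And>p i. p \<in> set P \<Longrightarrow> a \<le> i \<Longrightarrow> i \<le> b \<Longrightarrow>
      E p (f i) \<longleftrightarrow> p = hd P \<and> i = a \<or> p = last P \<and> i = b"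
  shows "icyc (map f [a..b] @ rev P)"
proof (rule icycI)
  show "map f [a..b] \<noteq> []" "rev P \<noteq> []" using ab P by auto
  show "3 \<le> length (map f [a..b]) + length (rev P)"
    using ab P(1) by (cases P) auto
  show "ipath (map f [a..b])" using arc_ipath[OF f] ab by simp
  show "ipath (rev P)" using P by simp
  show "set (map f [a..b]) \<inter> set (rev P) = {}" using P by auto
  fix x y assume "x \<in> set (map f [a..b])" "y \<in> set (rev P)"
  then obtain i where i: "x = f i" "y \<in> set P" "a \<le> i" "i \<le> b" by auto
  have "x = f a \<longleftrightarrow> i = a" "x = f b \<longleftrightarrow> i = b"
    using i ab hole_eq[OF f, of i a] hole_eq[OF f, of i b] by auto
  then show "E x y \<longleftrightarrow> x = last (map f [a..b]) \<and> y = hd (rev P) \<or> x = hd (map f [a..b]) \<and> y = last (rev P)"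
    using att[OF i(2-)] ab P(1) E_commute[of x y] i(1) by (auto simp: hd_arc last_arc hd_rev last_rev)
qed

lemma jump_hole:
  assumes f: "hole_fn n f" and P: "jump (range f) P (f a) (f b)" and ab: "a < b" "b - a \<le> n - 2"
  shows "icyc (map f [a..b] @ rev P)"
proof (rule path_arc_hole[OF f ab])
  show "P \<noteq> []" "ipath P" "set P \<inter> range f = {}" using P by (auto simp: jump_def)
  fix p i assume "p \<in> set P" "a \<le> i" "i \<le> b"
  then show "E p (f i) \<longleftrightarrow> p = hd P \<and> i = a \<or> p = last P \<and> i = b"
    using P ab hole_eq[OF f, of i a] hole_eq[OF f, of i b] by (auto simp: jump_def)
qed

lemma jump_other_arc:
  assumes f: "hole_fn n f" and J: "jump (range f) J (f a) (f b)" and ab: "a + 2 \<le> b" "b \<le> a + n - 2"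
  shows "icyc (map f [b..a + n] @ J)"
proof -
  have "jump (range f) (rev J) (f b) (f (a + n))" using jump_rev[OF J] hole_period[OF f] by simp
  from jump_hole[OF f this] ab show ?thesis by simp
qed

text \<open>The ends interleave, and the cycle uses two opposite arcs, from \<open>a\<close> to
  \<open>c\<close> and from \<open>b\<close> to \<open>d\<close>. The omitted arcs have length at
  least 2, so no edge of the hole joins the two used ones.\<close>

lemma two_jumps_crossing:
  assumes f: "hole_fn n f"
    and P: "jump (range f) P (f a) (f b)" and Q: "jump (range f) Q (f c) (f d)"
    and PQ: "set P \<inter> set Q = {}" "\<And>p q. p \<in> set P \<Longrightarrow> q \<in> set Q \<Longrightarrow> \<not> E p q"
    and ord: "a < c" "c + 2 \<le> b" "b < d" "d + 2 \<le> a + n"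
  shows "icyc ((map f [a..c] @ Q) @ rev (P @ map f [b..d]))"
proof (rule icycI)
  have P': "P \<noteq> []" "ipath P" "set P \<inter> range f = {}"
    and pf: "\<And>p i. p \<in> set P \<Longrightarrow> E p (f i) \<longleftrightarrow> p = hd P \<and> f i = f a \<or> p = last P \<and> f i = f b"
    using P by (auto simp: jump_def)
  have Q': "Q \<noteq> []" "ipath Q" "set Q \<inter> range f = {}"
    and qf: "\<And>p i. p \<in> set Q \<Longrightarrow> E p (f i) \<longleftrightarrow> p = hd Q \<and> f i = f c \<or> p = last Q \<and> f i = f d"
    using Q by (auto simp: jump_def)
  have eq: "f i = f j \<longleftrightarrow> i = j" if "a \<le> i" "i \<le> d" "a \<le> j" "j \<le> d" for i j
    using hole_eq[OF f, of i j] that ord by auto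
  have arcs: "\<not> E (f i) (f j)" if "a \<le> i" "i \<le> c" "b \<le> j" "j \<le> d" for i j
    using hole_adj[OF f, of i j] that ord by auto
  show "ipath (map f [a..c] @ Q)"
    using Q' ord arc_ipath[OF f, of c a] qf eq
    by (subst ipath_append) (auto simp: last_arc E_commute[of "f _"])
  have "ipath (P @ map f [b..d])"
    using P' ord arc_ipath[OF f, of d b] pf eq
    by (subst ipath_append) (auto simp: hd_arc)
  then show "ipath (rev (P @ map f [b..d]))" by (simp only: ipath_rev)
  show "set (map f [a..c] @ Q) \<inter> set (rev (P @ map f [b..d])) = {}"
    using P' Q' PQ ord eq by auto
  show "3 \<le> length (map f [a..c] @ Q) + length (rev (P @ map f [b..d]))"
    using ord by simp
  show "map f [a..c] @ Q \<noteq> []" "rev (P @ map f [b..d]) \<noteq> []" using P' Q' by auto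
  fix x y assume x: "x \<in> set (map f [a..c] @ Q)" and y: "y \<in> set (rev (P @ map f [b..d]))"
  have ends: "last (map f [a..c] @ Q) = last Q" "hd (map f [a..c] @ Q) = f a"
    "hd (rev (P @ map f [b..d])) = f d" "last (rev (P @ map f [b..d])) = hd P"
    using P' Q' ord by (auto simp: hd_arc hd_append hd_rev last_rev last_arc)
  have neq: "last Q \<notin> range f" "hd P \<notin> range f" "hd P \<in> set P" "last Q \<in> set Q"
    using P'(1,3) Q'(1,3) hd_in_set[of P] last_in_set[of P] last_in_set[of Q] by blast+
  consider (1) i j where "x = f i" "a \<le> i" "i \<le> c" "y = f j" "b \<le> j" "j \<le> d"
    | (2) i where "x = f i" "a \<le> i" "i \<le> c" "y \<in> set P"
    | (3) j where "x \<in> set Q" "y = f j" "b \<le> j" "j \<le> d"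
    | (4) "x \<in> set Q" "y \<in> set P"
    using x y by auto
  then show "E x y \<longleftrightarrow> x = last (map f [a..c] @ Q) \<and> y = hd (rev (P @ map f [b..d]))
    \<or> x = hd (map f [a..c] @ Q) \<and> y = last (rev (P @ map f [b..d]))"
  proof cases
    case 1
    then have "x \<noteq> last Q" "y \<noteq> hd P" using neq by (metis rangeI)+
    with 1 ends show ?thesis using arcs by auto
  next
    case 2
    then have "x \<noteq> last Q" "y \<noteq> f d" using neq P'(3) by (metis rangeI, blast)
    with 2 show ?thesis using pf[of y i] eq[of i a] eq[of i b] ord ends E_commute[of x y] by auto
  next
    case 3
    then have "x \<noteq> f a" "y \<noteq> hd P" using neq Q'(3) by (blast, metis rangeI)
    with 3 show ?thesis using qf[of x j] eq[of j c] eq[of j d] ord ends by auto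
  next
    case 4
    then have "y \<noteq> f d" "x \<noteq> f a" using P' Q' by auto
    with 4 show ?thesis using PQ ends E_commute[of x y] by auto
  qed
qed

text \<open>The ends do not interleave. The arcs spanned by the two jumps are omitted, and the arcs
  between the jumps are used; one of these may be a single vertex, a common end.\<close>

lemma two_jumps_parallel:
  assumes f: "hole_fn n f"
    and P: "jump (range f) P (f a) (f b)" and Q: "jump (range f) Q (f c) (f d)"
    and PQ: "set P \<inter> set Q = {}" "\<And>p q. p \<in> set P \<Longrightarrow> q \<in> set Q \<Longrightarrow> \<not> E p q"
    and ord: "a + 2 \<le> b" "b \<le> c" "c + 2 \<le> d" "d \<le> a + n"
  shows "icyc ((map f [b..c] @ Q) @ (map f [d..a + n] @ P))"
proof (rule icycI)
  have per: "f (a + n) = f a" using hole_period[OF f] .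
  have P': "P \<noteq> []" "ipath P" "set P \<inter> range f = {}"
    and pf: "\<And>p i. p \<in> set P \<Longrightarrow> E p (f i) \<longleftrightarrow> p = hd P \<and> f i = f (a + n) \<or> p = last P \<and> f i = f b"
    using P per by (auto simp: jump_def)
  have Q': "Q \<noteq> []" "ipath Q" "set Q \<inter> range f = {}"
    and qf: "\<And>p i. p \<in> set Q \<Longrightarrow> E p (f i) \<longleftrightarrow> p = hd Q \<and> f i = f c \<or> p = last Q \<and> f i = f d"
    using Q by (auto simp: jump_def)
  have eq: "f i = f j \<longleftrightarrow> i = j" if "b \<le> i" "i \<le> a + n" "b \<le> j" "j \<le> a + n" for i j
    using hole_eq[OF f, of i j] that ord by auto
  have arcs: "\<not> E (f i) (f j)" if "b \<le> i" "i \<le> c" "d \<le> j" "j \<le> a + n" for i j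
    using hole_adj[OF f, of i j] that ord by auto
  show "ipath (map f [b..c] @ Q)"
    using Q' ord arc_ipath[OF f, of c b] qf eq
    by (subst ipath_append) (auto simp: last_arc E_commute[of "f _"])
  show "ipath (map f [d..a + n] @ P)"
    using P' ord arc_ipath[OF f, of "a + n" d] pf eq
    by (subst ipath_append) (auto simp: last_arc E_commute[of "f _"])
  show "set (map f [b..c] @ Q) \<inter> set (map f [d..a + n] @ P) = {}"
    using P' Q' PQ ord eq by auto
  have "length P \<ge> 1" "length Q \<ge> 1" using P' Q' by (auto simp: Suc_le_eq)
  then show "3 \<le> length (map f [b..c] @ Q) + length (map f [d..a + n] @ P)"
    using ord by simp
  show "map f [b..c] @ Q \<noteq> []" "map f [d..a + n] @ P \<noteq> []" using P' Q' by auto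
  fix x y assume x: "x \<in> set (map f [b..c] @ Q)" and y: "y \<in> set (map f [d..a + n] @ P)"
  have ends: "last (map f [b..c] @ Q) = last Q" "hd (map f [b..c] @ Q) = f b"
    "hd (map f [d..a + n] @ P) = f d" "last (map f [d..a + n] @ P) = last P"
    using P' Q' ord by (auto simp: hd_arc hd_append)
  have neq: "last Q \<notin> range f" "last P \<notin> range f" "last P \<in> set P" "last Q \<in> set Q"
    using P'(1,3) Q'(1,3) hd_in_set[of P] last_in_set[of P] last_in_set[of Q] by blast+
  consider (1) i j where "x = f i" "b \<le> i" "i \<le> c" "y = f j" "d \<le> j" "j \<le> a + n"
    | (2) i where "x = f i" "b \<le> i" "i \<le> c" "y \<in> set P"
    | (3) j where "x \<in> set Q" "y = f j" "d \<le> j" "j \<le> a + n"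
    | (4) "x \<in> set Q" "y \<in> set P"
    using x y by auto
  then show "E x y \<longleftrightarrow> x = last (map f [b..c] @ Q) \<and> y = hd (map f [d..a + n] @ P)
    \<or> x = hd (map f [b..c] @ Q) \<and> y = last (map f [d..a + n] @ P)"
  proof cases
    case 1
    then have "x \<noteq> last Q" "y \<noteq> last P" using neq by (metis rangeI)+
    with 1 ends show ?thesis using arcs by auto
  next
    case 2
    then have "x \<noteq> last Q" "y \<noteq> f d" using neq P'(3) by (metis rangeI, blast)
    with 2 show ?thesis using pf[of y i] eq[of i "a + n"] eq[of i b] ord ends E_commute[of x y] by auto
  next
    case 3
    then have "x \<noteq> f b" "y \<noteq> last P" using neq Q'(3) by (blast, metis rangeI)
    with 3 show ?thesis using qf[of x j] eq[of j c] eq[of j d] ord ends by auto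
  next
    case 4
    then have "y \<noteq> f d" "x \<noteq> f b" using P' Q' by auto
    with 4 show ?thesis using PQ ends E_commute[of x y] by auto
  qed
qed

section \<open>Jumps obtained from connected sets and from branching paths\<close>

text \<open>If a connecting set touches \<open>C\<close> in two edges only, every induced path in it
  between the two contact vertices is a jump. Hence jumps can be produced without describing their
  course.\<close>

lemma jump_joined:
  assumes X: "joined X xa xb" "X \<inter> C = {}" "a \<in> C" "b \<in> C"
    and att: "\<And>p c. p \<in> X \<Longrightarrow> c \<in> C \<Longrightarrow> E p c \<longleftrightarrow> p = xa \<and> c = a \<or> p = xb \<and> c = b"
  shows "\<exists>P. jump C P a b \<and> set P \<subseteq> X"
proof -
  obtain P where P: "P \<noteq> []" "hd P = xa" "last P = xb" "set P \<subseteq> X" "ipath P"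
    using shortest_ipath[OF X(1), of "\<lambda>u. u = xb"] by metis
  then have "jump C P a b" using X att unfolding jump_def by blast
  with P show ?thesis by blast
qed

lemma branch_ipath:
  assumes P: "ipath (P1 @ p # P2)" and p: "E (last R) p" "\<forall>x\<in>set P1. \<not> E (last R) x"
    and R: "R \<noteq> []" "ipath R" "set R \<inter> set (P1 @ p # P2) = {}"
    and nadj: "\<And>r x. r \<in> set R \<Longrightarrow> r \<noteq> last R \<Longrightarrow> x \<in> set (P1 @ p # P2) \<Longrightarrow> \<not> E r x"
  shows "ipath (R @ p # rev P1)"
proof -
  have "ipath ((P1 @ [p]) @ P2)" using P by simp
  then have "ipath (rev (P1 @ [p]))" by (metis ipath_prefix ipath_rev)
  then have "ipath (p # rev P1)" by simp
  then show ?thesis using R p nadj by (subst ipath_append) auto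
qed

text \<open>\<open>R\<close> enters the jump at its first neighbour \<open>p\<close> and follows it
  back to \<open>a\<close>. Since \<open>P2\<close> is nonempty, \<open>p\<close> is not the last
  vertex of the jump, so the contact with \<open>b\<close> disappears.\<close>

lemma branch:
  assumes P: "jump C (P1 @ p # P2) a b" and p: "E (last R) p" "\<forall>x\<in>set P1. \<not> E (last R) x"
    and P2: "P2 \<noteq> []"
    and R: "R \<noteq> []" "ipath R" "set R \<inter> C = {}" "set R \<inter> set (P1 @ p # P2) = {}" "c \<in> C"
    and att: "\<And>r u. r \<in> set R \<Longrightarrow> u \<in> C \<Longrightarrow> E r u \<longleftrightarrow> r = hd R \<and> u = c"
    and nadj: "\<And>r x. r \<in> set R \<Longrightarrow> r \<noteq> last R \<Longrightarrow> x \<in> set (P1 @ p # P2) \<Longrightarrow> \<not> E r x"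
  shows "jump C (R @ p # rev P1) c a"
proof -
  have ip: "ipath ((P1 @ [p]) @ P2)" using P by (simp add: jump_def)
  then have lp: "last P2 \<noteq> p \<and> last P2 \<notin> set P1"
    using ipath_append[of "P1 @ [p]" P2] P2 last_in_set[of P2]
    by (simp del: append_assoc last_in_set) blast
  have hdP: "hd (P1 @ p # P2) = last (p # rev P1)" by (cases P1) auto
  have lastP: "last (P1 @ p # P2) = last P2" using P2 by simp
  have "ipath (R @ p # rev P1)"
    by (rule branch_ipath[of P1 p P2 R]) (use ip p R nadj in simp_all)
  moreover have "E q u \<longleftrightarrow> q = hd (R @ p # rev P1) \<and> u = c \<or> q = last (R @ p # rev P1) \<and> u = a"
    if q: "q \<in> set (R @ p # rev P1)" and u: "u \<in> C" for q u
  proof (cases "q \<in> set R")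
    case True
    moreover have "last (p # rev P1) \<notin> set R" using R(4) last_in_set[of "p # rev P1"] by auto
    ultimately show ?thesis using att[OF True u] R(1) by auto
  next
    case False
    then have q': "q \<in> set (P1 @ [p])" using q by auto
    then have "E q u \<longleftrightarrow> q = last (p # rev P1) \<and> u = a"
      using P u lp hdP lastP unfolding jump_def by auto
    moreover have "q \<noteq> hd R" using False R(1) by auto
    ultimately show ?thesis using R(1) by auto
  qed
  ultimately show ?thesis using P R unfolding jump_def by auto
qed

text \<open>Deleting \<open>last P\<close> removes the contact with \<open>y\<close>. What remains
  of \<open>P\<close>, together with \<open>X\<close>, is connected through the edge from
  \<open>q\<close> to \<open>b\<close> and touches \<open>C\<close> only at \<open>c\<close> and
  \<open>x\<close>.\<close>

lemma hit_jump:
  assumes P: "jump C P x y" and X: "conn X" "X \<inter> C = {}" "X \<inter> set P = {}" "xa \<in> X" "c \<in> C"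
    and att: "\<And>p u. p \<in> X \<Longrightarrow> u \<in> C \<Longrightarrow> E p u \<longleftrightarrow> p = xa \<and> u = c"
    and b: "b \<in> set P" "b \<noteq> last P" "q \<in> X" "E q b"
  shows "\<exists>J. jump C J c x \<and> set J \<subseteq> X \<union> set P"
proof -
  have P': "P \<noteq> []" "ipath P" "set P \<inter> C = {}" "x \<in> C"
    and Patt: "\<And>z u. z \<in> set P \<Longrightarrow> u \<in> C \<Longrightarrow> E z u \<longleftrightarrow> z = hd P \<and> u = x \<or> z = last P \<and> u = y"
    using P unfolding jump_def by blast+
  obtain P1 where P1: "P = P1 @ [last P]" using P'(1) append_butlast_last_id by metis
  have b1: "b \<in> set P1" using b(1,2) P1 by (metis UnE empty_iff empty_set insert_iff list.simps(15) set_append)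
  then have P10: "P1 \<noteq> []" by auto
  then have hd1: "hd P1 = hd P" "hd P1 \<in> set P1" using P1 by (metis hd_append2, simp)
  have ip1: "ipath P1" using P'(2) P1 ipath_prefix by metis
  have l1: "last P \<notin> set P1" using ipath_distinct[OF P'(2)] P1 by (metis distinct_append disjoint_iff list.set_intros(1))
  have s1: "set P1 \<subseteq> set P" using P1 by (metis Un_upper1 set_append)
  have "conn (X \<union> set P1)" using conn_Un[OF X(1) conn_path[OF ipath_successively[OF ip1]] b(3) b1] b(4) by blast
  then have jo: "joined (X \<union> set P1) xa (hd P1)" using X(4) hd1(2) by (simp add: conn_def)
  have XC: "(X \<union> set P1) \<inter> C = {}" using X(2) P'(3) s1 by blast
  have "E p u \<longleftrightarrow> p = xa \<and> u = c \<or> p = hd P1 \<and> u = x" if p: "p \<in> X \<union> set P1" and u: "u \<in> C" for p u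
  proof (cases "p \<in> X")
    case True
    then have "p \<noteq> hd P1" using X(3) hd1(2) s1 by blast
    with att[OF True u] show ?thesis by blast
  next
    case False
    then have p1: "p \<in> set P1" "p \<noteq> xa" using p X(4) by auto
    then have "p \<in> set P" "p \<noteq> last P" using s1 l1 by auto
    with Patt[OF _ u] p1 hd1(1) show ?thesis by auto
  qed
  from jump_joined[OF jo XC X(5) P'(4) this] show ?thesis using s1 by blast
qed

end

section \<open>Large girth and no long even holes\<close>

text \<open>Minimum degree 3 is assumed in the form in which it is used: some neighbour avoids two
  given vertices, which may coincide.\<close>

locale long_even_hole_free = simple_graph +
  fixes V :: "'a set" and l :: nat
  assumes fin: "finite V"
    and E_V: "E u v \<Longrightarrow> u \<in> V"
    and l5: "5 \<le> l"
    and girth: "cyc xs \<Longrightarrow> 2 * l \<le> length xs"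
    and even_icyc: "icyc xs \<Longrightarrow> even (length xs) \<Longrightarrow> length xs = 2 * l"
    and deg3: "v \<in> V \<Longrightarrow> \<exists>c. E v c \<and> c \<noteq> a \<and> c \<noteq> b"
begin

definition N :: "'a set \<Rightarrow> 'a set" where
  "N T = T \<union> {u. \<exists>t\<in>T. E u t}"

lemma icyc_ge: "icyc xs \<Longrightarrow> 2 * l \<le> length xs"
  using icyc_cyc girth by blast

lemma no_triangle: "E a b \<Longrightarrow> E b c \<Longrightarrow> \<not> E a c"
proof
  assume "E a b" "E b c" "E a c"
  then have "cyc [a, b, c]"
    using E_irrefl E_sym by (auto simp: cyc_def)
  from girth[OF this] l5 show False by simp
qed

text \<open>Two neighbours of \<open>w\<close> in \<open>S\<close> would lie on a cycle shorter than the girth.\<close>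
lemma small_conn:
  assumes S: "conn S" "finite S" "card S \<le> 2 * l - 2" and w: "w \<notin> S"
    and st: "s \<in> S" "t \<in> S" "E w s" "E w t"
  shows "s = t"
proof (rule ccontr)
  assume "s \<noteq> t"
  obtain ps where ps: "ps \<noteq> []" "hd ps = s" "last ps = t" "set ps \<subseteq> S" "ipath ps"
    using shortest_ipath[of S s t "\<lambda>u. u = t"] S(1) st by (metis conn_def)
  have len: "length ps \<le> card S"
    using card_mono[OF S(2) ps(4)] distinct_card[OF ipath_distinct[OF ps(5)]] by simp
  have "2 \<le> length ps" using ps \<open>s \<noteq> t\<close> by (cases ps; cases "tl ps") auto
  then have "cyc (w # ps)"
    using ps w st ipath_distinct ipath_successively E_sym by (auto simp: cyc_def successively_Cons)
  from girth[OF this] len S(3) l5 show False by simp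
qed

definition T3 :: "(int \<Rightarrow> 'a) \<Rightarrow> int \<Rightarrow> 'a set" where
  "T3 g v = {g (v - 1), g v, g (v + 1)}"

text \<open>The path goes from \<open>x\<close> to a further neighbour and on through the complement
  of \<open>N (T3 g v)\<close>, which is connected by \<open>star\<close>. It is a shortest path to
  a vertex that touches \<open>B\<close> or touches the hole off \<open>T3 g v\<close>. This one
  construction provides the jumps for the even cycle and, with the boundary as \<open>B\<close>, the
  legs for the odd one.\<close>

lemma approach:
  assumes g: "hole_fn n g" "7 \<le> n" "range g \<subseteq> V" and star: "conn (V - N (T3 g v))"
    and x: "x \<notin> range g" "E x (g v)" "\<And>i. E x (g i) \<Longrightarrow> g i = g v"
    and B: "B \<inter> range g = {}" "\<And>b. b \<in> B \<Longrightarrow> \<not> E b (g v)"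
  obtains R where "R \<noteq> []" "ipath R" "hd R = x" "set R \<inter> range g = {}" "set R \<inter> B = {}" "set R \<subseteq> V"
    "\<And>r i. r \<in> set R \<Longrightarrow> E r (g i) \<Longrightarrow> r = x \<and> g i = g v \<or> r = last R \<and> g i \<notin> T3 g v"
    "\<And>r. r \<in> set R \<Longrightarrow> r \<noteq> x \<Longrightarrow> r \<notin> N (T3 g v)"
    "\<And>r b. r \<in> set R \<Longrightarrow> r \<noteq> last R \<Longrightarrow> b \<in> B \<Longrightarrow> \<not> E r b"
    "(\<exists>b\<in>B. E (last R) b) \<or> (\<exists>i. g i \<notin> T3 g v \<and> E (last R) (g i))"
proof -
  let ?T = "T3 g v"
  have Tsub: "?T \<subseteq> range g" by (auto simp: T3_def)
  have cT: "conn ?T"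
    unfolding T3_def using hole_adj_Suc[OF g(1), of "v - 1"] hole_adj_Suc[OF g(1), of v]
    by (intro triple_conn) auto
  have card: "card ?T \<le> 3" unfolding T3_def by (simp add: card_insert_if)
  obtain y where y: "E x y" "y \<noteq> g v" using deg3[OF E_V[OF x(2)]] by blast
  have yC: "y \<notin> range g" using x(3) y by blast
  \<comment> \<open>A neighbour of \<open>y\<close> in \<open>T3 g v\<close> would close a cycle too
    short for the girth with \<open>x\<close> and that path.\<close>
  have yN: "y \<in> V - N ?T"
  proof -
    have "\<not> E y t" if "t \<in> ?T" for t
    proof
      assume "E y t"
      have "x = t"
      proof (rule small_conn)
        show "conn (insert x ?T)" using cT x(2) by (intro conn_insert[of _ "g v"]) (auto simp: T3_def E_commute)
        show "card (insert x ?T) \<le> 2 * l - 2" using card l5 by (auto simp: card_insert_if T3_def)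
        show "y \<notin> insert x ?T" using yC Tsub y(1) E_irrefl by auto
      qed (use that y \<open>E y t\<close> E_sym in \<open>auto simp: T3_def\<close>)
      with x(1) that Tsub show False by auto
    qed
    then show ?thesis using yC Tsub E_V[OF E_sym[OF y(1)]] by (auto simp: N_def)
  qed
  \<comment> \<open>A target exists on the hole itself: \<open>g (v + 3)\<close> lies outside
    \<open>N (T3 g v)\<close>, and its neighbour \<open>g (v + 4)\<close> lies off
    \<open>T3 g v\<close>.\<close>
  have zN: "g (v + 3) \<in> V - N ?T"
    using g hole_eq[OF g(1), of "v + 3"] hole_adj[OF g(1), of "v + 3"] by (auto simp: N_def T3_def)
  have z4: "g (v + 4) \<notin> ?T"
    using g hole_eq[OF g(1), of "v + 4"] by (auto simp: T3_def)
  have e4: "E (g (v + 3)) (g (v + 4))" using hole_adj_Suc[OF g(1), of "v + 3"] by (simp add: add.commute)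
  define Tg where "Tg u \<longleftrightarrow> (\<exists>b\<in>B. E u b) \<or> (\<exists>i. g i \<notin> ?T \<and> E u (g i))" for u
  have tg: "Tg (g (v + 3))" unfolding Tg_def using z4 e4 by blast
  have j: "joined (insert x (V - N ?T)) x (g (v + 3))"
    using star yN zN y(1) joined_mono[of "V - N ?T" y "g (v + 3)" "insert x (V - N ?T)"]
    by (intro joined_step[of x y]) (auto simp: conn_def)
  obtain R where R: "R \<noteq> []" "hd R = x" "Tg (last R)" "set R \<subseteq> insert x (V - N ?T)" "ipath R"
    and nTg': "\<forall>u\<in>set R. u \<noteq> last R \<longrightarrow> \<not> Tg u"
    by (rule shortest_ipath[OF j, of Tg, OF tg]) (rule that)
  have nTg: "\<not> Tg u" if "u \<in> set R" "u \<noteq> last R" for u using nTg' that by blast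
  have dR: "distinct R" using ipath_distinct[OF R(5)] .
  have R0: "R ! 0 = x" using R(1,2) by (simp add: hd_conv_nth)
  \<comment> \<open>If the path entered the hole or \<open>B\<close> at some vertex, the vertex
    before it would already have been a target.\<close>
  have out: "R ! k \<notin> range g \<union> B" if k: "k < length R" for k
  proof (cases k)
    case 0
    have "x \<notin> B" using B(2) x(2) by blast
    then show ?thesis using R0 0 x(1) by simp
  next
    case (Suc j)
    have j: "R ! j \<in> set R" "R ! j \<noteq> last R"
      using k Suc R(1) dR by (simp_all add: last_conv_nth nth_eq_iff_index_eq)
    have e: "E (R ! j) (R ! k)" using ipath_nth[OF R(5), of j k] k Suc by auto
    have "R ! k \<noteq> R ! 0" using k Suc dR R(1) by (subst nth_eq_iff_index_eq) auto
    then have "R ! k \<notin> N ?T" using R(4) R0 nth_mem[OF k] by blast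
    then have "R ! k \<notin> ?T" by (simp add: N_def)
    moreover have "R ! k \<notin> B" using nTg[OF j] e unfolding Tg_def by blast
    moreover have "R ! k \<in> range g \<Longrightarrow> R ! k \<in> ?T" using nTg[OF j] e unfolding Tg_def by fastforce
    ultimately show ?thesis by blast
  qed
  have outR: "set R \<inter> range g = {}" "set R \<inter> B = {}" using out by (metis UnI1 UnI2 disjoint_iff in_set_conv_nth)+
  show ?thesis
  proof (rule that[OF R(1,5,2) outR])
    show "set R \<subseteq> V" using R(4) E_V[OF x(2)] by auto
    show RN: "r \<notin> N ?T" if "r \<in> set R" "r \<noteq> x" for r using that R(4) by auto
    show "r = x \<and> g i = g v \<or> r = last R \<and> g i \<notin> ?T" if "r \<in> set R" "E r (g i)" for r i
    proof (cases "r = x")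
      case False
      then have "g i \<notin> ?T" using RN[OF that(1)] that(2) by (auto simp: N_def)
      moreover from this have "r = last R" using nTg[OF that(1)] that(2) unfolding Tg_def by blast
      ultimately show ?thesis by blast
    qed (use that x(3) in blast)
    show "\<not> E r b" if "r \<in> set R" "r \<noteq> last R" "b \<in> B" for r b
      using nTg[OF that(1,2)] that(3) by (auto simp: Tg_def)
    show "(\<exists>b\<in>B. E (last R) b) \<or> (\<exists>i. g i \<notin> ?T \<and> E (last R) (g i))"
      using R(3) by (simp add: Tg_def)
  qed
qed

end

subsection \<open>Jumps over a cycle of length \<open>2l\<close>\<close>

locale even_cycle_case = long_even_hole_free +
  fixes f :: "int \<Rightarrow> 'a"
  assumes f: "hole_fn (2 * int l) f"
    and fV: "range f \<subseteq> V"
    and star: "\<And>v. conn (V - N (T3 f v))"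
begin

abbreviation "C \<equiv> range f"

lemma arc_conn: "a \<le> b \<Longrightarrow> conn (f ` {a..b})"
proof (induction "nat (b - a)" arbitrary: b)
  case 0
  then have "b = a" by simp
  then show ?case by (simp add: conn_single)
next
  case (Suc k)
  have "conn (f ` {a..b - 1})" using Suc by (intro Suc.hyps) auto
  then have "conn (insert (f b) (f ` {a..b - 1}))"
    by (rule conn_insert[of _ "f (b - 1)"]) (use Suc hole_adj_Suc[OF f, of "b - 1"] in auto)
  moreover have "insert (f b) (f ` {a..b - 1}) = f ` {a..b}"
    using Suc by (auto simp: image_iff) (metis atLeastAtMost_iff linorder_not_le order_antisym zle_diff1_eq)
  ultimately show ?case by simp
qed

text \<open>The shorter of the two arcs. With one or two additional vertices it stays below the
  girth, which yields the next two lemmas.\<close>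

lemma short_arc:
  obtains S where "conn S" "finite S" "card S \<le> l + 1" "S \<subseteq> C" "f i \<in> S" "f j \<in> S"
proof -
  obtain k where k: "f j = f k" "i \<le> k" "k < i + 2 * int l" using hole_index[OF f] by blast
  have card: "card (f ` {a..b}) \<le> l + 1" if "b - a \<le> int l" for a b
  proof -
    have "card (f ` {a..b}) \<le> nat (b - a + 1)" using card_image_le[of "{a..b}" f] by simp
    with that show ?thesis by linarith
  qed
  show ?thesis
  proof (cases "k - i \<le> int l")
    case True
    show ?thesis by (rule that[of "f ` {i..k}"]) (use True k card arc_conn in auto)
  next
    case False
    have "f (i + 2 * int l) = f i" using hole_period[OF f] .
    then have "f i \<in> f ` {k..i + 2 * int l}" using k by (metis atLeastAtMost_iff image_eqI less_imp_le order_refl)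
    then show ?thesis
      by (intro that[of "f ` {k..i + 2 * int l}"]) (use False k card arc_conn in auto)
  qed
qed

lemma uniq_attach:
  assumes "p \<notin> C" "E p (f i)" "E p (f j)"
  shows "f i = f j"
proof -
  obtain S where S: "conn S" "finite S" "card S \<le> l + 1" "S \<subseteq> C" "f i \<in> S" "f j \<in> S"
    using short_arc by blast
  show ?thesis
    by (rule small_conn[of S p]) (use S assms l5 in auto)
qed

text \<open>Otherwise \<open>p\<close>, \<open>r\<close> and a shorter arc between their neighbours
  would contain a cycle of length at most \<open>l + 3\<close>.\<close>

lemma adjacent_attach:
  assumes "p \<notin> C" "r \<notin> C" "E r p" "E p (f i)" "E r (f j)"
  shows False
proof -
  obtain S where S: "conn S" "finite S" "card S \<le> l + 1" "S \<subseteq> C" "f i \<in> S" "f j \<in> S"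
    using short_arc by blast
  have "f j = p"
    by (rule small_conn[of "insert p S" r])
      (use S assms l5 conn_insert[OF S(1,5)] E_commute E_irrefl in \<open>auto simp: card_insert_if\<close>)
  with assms show False by auto
qed

lemma hole_length: "icyc xs \<Longrightarrow> even (length xs) \<Longrightarrow> int (length xs) = 2 * int l"
  using even_icyc by fastforce

section \<open>Parities of jumps and of paths that meet a jump\<close>

text \<open>The period is even, so parity statements do not depend on the index chosen for a
  vertex.\<close>

lemma parity_index:
  assumes "f i = f j" shows "even (i - j)"
proof -
  have "2 * int l dvd i - j" using assms f by (simp add: hole_fn_def)
  then show ?thesis by (metis dvd_mult_left)
qed

text \<open>
  A jump closes up with both arcs of the cycle, and the two resulting lengths have the same parity.
  If they are even, both are \<open>2l\<close>.
\<close>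
lemma jump_type:
  assumes P: "jump C P (f a) (f b)" and ab: "a + 2 \<le> b" "b \<le> a + 2 * int l - 2"
  shows "odd (int (length P) + 1 + (b - a)) \<or> b = a + int l \<and> int (length P) + 1 = int l"
    and "int (length P) + 1 + (b - a) \<ge> 2 * int l"
    and "int (length P) + 1 \<ge> (b - a)"
proof -
  let ?n = "2 * int l"
  have h1: "icyc (map f [a..b] @ rev P)" using jump_hole[OF f P] ab by simp
  have h2: "icyc (map f [b..a + ?n] @ P)" using jump_other_arc[OF f P] ab by simp
  have l1: "int (length (map f [a..b] @ rev P)) = b - a + 1 + int (length P)" using ab by simp
  have l2: "int (length (map f [b..a + ?n] @ P)) = a + ?n - b + 1 + int (length P)" using ab by simp
  show "int (length P) + 1 + (b - a) \<ge> 2 * int l" using icyc_ge[OF h1] l1 by linarith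
  show "int (length P) + 1 \<ge> (b - a)" using icyc_ge[OF h2] l2 by linarith
  show "odd (int (length P) + 1 + (b - a)) \<or> b = a + int l \<and> int (length P) + 1 = int l"
  proof (cases "odd (int (length P) + 1 + (b - a))")
    case False
    then have "even (int (length (map f [a..b] @ rev P)))" "even (int (length (map f [b..a + ?n] @ P)))"
      unfolding l1 l2 by presburger+
    then have "int (length (map f [a..b] @ rev P)) = ?n" "int (length (map f [b..a + ?n] @ P)) = ?n"
      using hole_length h1 h2 by (metis even_of_nat)+
    then show ?thesis unfolding l1 l2 by linarith
  qed simp
qed

lemma jump_odd:
  assumes P: "jump C P (f a) (f b)" and "f a \<noteq> f b" "\<not> E (f a) (f b)" "f b \<noteq> f (a + int l)"
  shows "odd (int (length P) + 1 + a - b)"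
proof -
  obtain k where k: "f b = f k" "a \<le> k" "k < a + 2 * int l" using hole_index[OF f] by blast
  have "k \<noteq> a" "k \<noteq> a + 1" "k \<noteq> a + 2 * int l - 1"
    using k assms(2,3) hole_adj[OF f, of a k] l5 by auto
  then have "odd (int (length P) + 1 + (k - a))"
    using jump_type(1)[of P a k] P k assms(4) by auto
  then show ?thesis using parity_index[OF k(1)] by presburger
qed

text \<open>If the parity were wrong, the whole path and the arc that avoids \<open>s\<close> would
  form an even hole, of length \<open>2l\<close>. Then \<open>y - x\<close> is the sum of the
  lengths of \<open>A\<close> and \<open>B\<close> plus 2. The two holes through \<open>m\<close>
  over the arcs from \<open>x\<close> to \<open>s\<close> and from \<open>s\<close> to
  \<open>y\<close> have total length \<open>2 * (y - x) + 2\<close>, which is below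
  \<open>4l\<close> and contradicts the girth.\<close>

lemma skip_ordered:
  assumes ip: "ipath (A @ m # B)" "A \<noteq> []" "B \<noteq> []" "set (A @ m # B) \<inter> C = {}"
    and att: "\<And>p u. p \<in> set (A @ m # B) \<Longrightarrow> u \<in> C \<Longrightarrow>
      E p u \<longleftrightarrow> p = hd A \<and> u = f x \<or> p = m \<and> u = f s \<or> p = last B \<and> u = f y"
    and ord: "x < s" "s < y" "x + 2 \<le> y" "y \<le> x + 2 * int l - 2"
  shows "odd (int (length A) + int (length B) + (y - x))"
proof (rule ccontr)
  let ?n = "2 * int l"
  let ?Q = "A @ m # B"
  assume ev: "\<not> ?thesis"
  have att': "E p (f i) \<longleftrightarrow> p = hd A \<and> f i = f x \<or> p = m \<and> f i = f s \<or> p = last B \<and> f i = f y"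
    if "p \<in> set ?Q" for p i using att[OF that] by auto
  have eq: "f i = f j \<longleftrightarrow> i = j" if "\<bar>i - j\<bar> < ?n" for i j using hole_eq[OF f that] .
  have per: "f (x + ?n) = f x" using hole_period[OF f] .
  have d: "distinct ?Q" using ip ipath_distinct by blast
  have neq: "m \<noteq> hd A" "m \<noteq> last B" "hd A \<noteq> last B" "m \<notin> set A" "m \<notin> set B" "last B \<notin> set A" "hd A \<notin> set B"
    using d hd_in_set[OF ip(2)] last_in_set[OF ip(3)] by (auto simp: disjoint_iff)
  have "ipath (rev ?Q)" unfolding ipath_rev by (rule ip)
  then have iprv: "ipath (rev B @ m # rev A)" by simp
  have h1: "icyc (map f [y..x + ?n] @ rev (rev ?Q))"
  proof (rule path_arc_hole[OF f])
    fix p i assume p: "p \<in> set (rev ?Q)" and i: "y \<le> i" "i \<le> x + ?n"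
    have "f i = f x \<longleftrightarrow> i = x + ?n" using eq[of i "x + ?n"] per i ord by auto
    moreover have "f i \<noteq> f s" "f i = f y \<longleftrightarrow> i = y" using eq[of i s] eq[of i y] i ord by auto
    ultimately show "E p (f i) \<longleftrightarrow> p = hd (rev ?Q) \<and> i = y \<or> p = last (rev ?Q) \<and> i = x + ?n"
      using att'[of p i] p ip(2,3) by (auto simp: hd_rev last_rev)
  qed (use iprv ip(4) ord in auto)
  have len1: "int (length (map f [y..x + ?n] @ rev (rev ?Q))) = x + ?n - y + 2 + int (length A) + int (length B)"
    using ord by simp
  then have "even (int (length (map f [y..x + ?n] @ rev (rev ?Q))))" using ev by presburger
  then have n1: "x + 2 + int (length A) + int (length B) = y"
    using hole_length[OF h1] len1 unfolding even_of_nat by linarith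
  have "ipath (A @ [m])" "ipath (m # B)" using ip(1) ipath_prefix[of "A @ [m]" B] ipath_suffix[of A "m # B"] by simp_all
  have h2: "icyc (map f [x..s] @ rev (A @ [m]))"
  proof (rule path_arc_hole[OF f])
    fix p i assume p: "p \<in> set (A @ [m])" and i: "x \<le> i" "i \<le> s"
    have "f i = f x \<longleftrightarrow> i = x" using eq[of i x] i ord by auto
    moreover have "f i = f s \<longleftrightarrow> i = s" "f i \<noteq> f y" using eq[of i s] eq[of i y] i ord by auto
    ultimately show "E p (f i) \<longleftrightarrow> p = hd (A @ [m]) \<and> i = x \<or> p = last (A @ [m]) \<and> i = s"
      using att'[of p i] p ip(2,3) neq by auto
  qed (use ip ord \<open>ipath (A @ [m])\<close> in auto)
  have h3: "icyc (map f [s..y] @ rev (m # B))"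
  proof (rule path_arc_hole[OF f])
    fix p i assume p: "p \<in> set (m # B)" and i: "s \<le> i" "i \<le> y"
    have "f i \<noteq> f x" using eq[of i x] i ord by auto
    moreover have "f i = f s \<longleftrightarrow> i = s" "f i = f y \<longleftrightarrow> i = y" using eq[of i s] eq[of i y] i ord by auto
    ultimately show "E p (f i) \<longleftrightarrow> p = hd (m # B) \<and> i = s \<or> p = last (m # B) \<and> i = y"
      using att'[of p i] p ip(2,3) neq by auto
  qed (use ip ord \<open>ipath (m # B)\<close> in auto)
  have "int (length (map f [x..s] @ rev (A @ [m]))) = s - x + 2 + int (length A)"
    "int (length (map f [s..y] @ rev (m # B))) = y - s + 2 + int (length B)" using ord by auto
  then show False using n1 icyc_ge[OF h2] icyc_ge[OF h3] ord by linarith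
qed

text \<open>
  A path attached to three vertices of the cycle, the middle one at a single inner vertex \<open>m\<close>: its
  length has the parity that it would have if the attachment at \<open>m\<close> were absent.
\<close>
lemma skip:
  assumes ip: "ipath (A @ m # B)" "A \<noteq> []" "B \<noteq> []" "set (A @ m # B) \<inter> C = {}"
    and att: "\<And>p u. p \<in> set (A @ m # B) \<Longrightarrow> u \<in> C \<Longrightarrow>
      E p u \<longleftrightarrow> p = hd A \<and> u = f x \<or> p = m \<and> u = f s \<or> p = last B \<and> u = f y"
    and neq: "f x \<noteq> f s" "f s \<noteq> f y" "f x \<noteq> f y" "\<not> E (f x) (f y)"
  shows "odd (int (length A) + int (length B) + (x - y))"
proof -
  let ?n = "2 * int l"
  obtain y' where y': "f y = f y'" "x \<le> y'" "y' < x + ?n" using hole_index[OF f] by blast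
  obtain s' where s': "f s = f s'" "x \<le> s'" "s' < x + ?n" using hole_index[OF f] by blast
  have yb: "x + 2 \<le> y'" "y' \<le> x + ?n - 2"
    using neq(3,4) y' hole_adj[OF f, of x y'] by (cases "y' = x"; cases "y' = x + 1"; cases "y' = x + ?n - 1"; auto)+
  have sb: "x < s'" "s' \<noteq> y'" using neq(1,2) s' y' by (auto simp: order_le_less)
  have per: "f (x + ?n) = f x" using hole_period[OF f] .
  show ?thesis
  proof (cases "s' < y'")
    case True
    have "odd (int (length A) + int (length B) + (y' - x))"
      by (rule skip_ordered[OF ip, of x s' y']) (use att s' y' yb sb True in auto)
    then show ?thesis using parity_index[OF y'(1)] by presburger
  next
    case False
    \<comment> \<open>Now \<open>s'\<close> lies on the arc from \<open>y'\<close> to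
      \<open>x + ?n\<close>, so the path is read backwards.\<close>
    have rv: "rev B @ m # rev A = rev (A @ m # B)" by simp
    have iprv: "ipath (rev B @ m # rev A)" unfolding rv ipath_rev by (rule ip)
    have "odd (int (length (rev B)) + int (length (rev A)) + (x + ?n - y'))"
      by (rule skip_ordered[OF iprv, of y' s' "x + ?n"])
        (use ip(2-) att s' y' yb sb False per in \<open>auto simp: hd_rev last_rev\<close>)
    then show ?thesis using parity_index[OF y'(1)] unfolding length_rev by presburger
  qed
qed

lemma antipode_sym: "f a = f (b + int l) \<longleftrightarrow> f b = f (a + int l)"
proof -
  have "2 * int l dvd a - (b + int l) \<longleftrightarrow> 2 * int l dvd b - (a + int l)"
    using dvd_minus_iff[of "2 * int l" "a - (b + int l)"] dvd_add_right_iff[of "2 * int l" "2 * int l" "b - (a + int l)"]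
    by (simp add: algebra_simps)
  then show ?thesis using f by (simp add: hole_fn_def)
qed

lemma jump_ends_neq:
  assumes "jump C P (f a) (f b)" "f a \<noteq> f b"
  shows "hd P \<noteq> last P"
proof
  assume "hd P = last P"
  moreover have "P \<noteq> []" using assms(1) by (simp add: jump_def)
  ultimately have "E (hd P) (f a)" "E (hd P) (f b)" "hd P \<notin> C"
    using assms(1) hd_in_set[of P] unfolding jump_def by blast+
  with uniq_attach assms(2) show False by blast
qed

lemma split_eq:
  assumes "distinct (xs @ x # ys)" "xs @ x # ys = xs' @ x # ys'"
  shows "xs = xs' \<and> ys = ys'"
  using assms by (metis append_Cons_eq_iff distinct_append distinct.simps(2) disjoint_iff list.set_intros(1))

text \<open>Replacing the part of a jump between the first and the last neighbour of \<open>r\<close> by \<open>r\<close>.\<close>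
lemma detour_parity:
  assumes P: "jump C P (f a) (f b)" and ab: "f a \<noteq> f b" "\<not> E (f a) (f b)" "f b \<noteq> f (a + int l)"
    and r: "r \<notin> C" "r \<notin> set P"
    and s1: "P = P1 @ p # P2" "E r p" "\<forall>x\<in>set P1. \<not> E r x"
    and s2: "P = Q1 @ q # Q2" "E r q" "\<forall>x\<in>set Q2. \<not> E r x"
    and att: "(\<forall>u\<in>C. \<not> E r u) \<or> (\<exists>s. f s \<noteq> f a \<and> f s \<noteq> f b \<and> (\<forall>u\<in>C. E r u \<longleftrightarrow> u = f s))"
  shows "odd (int (length P1) + int (length Q2) + (a - b))"
proof -
  have ipP: "ipath P" and P0: "P \<noteq> []" using P by (auto simp: jump_def)
  then have dP: "distinct P" using ipath_distinct by blast
  show ?thesis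
  proof (cases "p = q")
    case True
    then have "P1 = Q1" "P2 = Q2" using split_eq[of P1 p P2 Q1 Q2] s1 s2 dP by auto
    then have "int (length P) = int (length P1) + int (length Q2) + 1" using s1 by simp
    then show ?thesis using jump_odd[OF P ab] by presburger
  next
    case False
    obtain M where M: "Q1 = P1 @ p # M"
    proof -
      have "P1 @ p # P2 = Q1 @ q # Q2" using s1 s2 by simp
      then obtain us where us: "P1 = Q1 @ us \<and> us @ p # P2 = q # Q2 \<or> P1 @ us = Q1 \<and> p # P2 = us @ q # Q2"
        by (auto simp: append_eq_append_conv2)
      show ?thesis using us that s1(2) s2(3) False by (cases us) auto
    qed
    have PM: "P = (P1 @ [p]) @ (M @ q # Q2)" using M s2 by simp
    have M0: "M \<noteq> []"
    proof
      assume "M = []"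
      then have "E p q" using ipath_successively[OF ipP] PM by (auto simp: successively_append_iff successively_Cons)
      with no_triangle[of r p q] s1 s2 show False by blast
    qed
    have ip1: "ipath (P1 @ [p])" using ipP PM ipath_prefix by metis
    have ip2: "ipath (q # Q2)" using ipP s2 ipath_suffix by metis
    have cr: "\<not> E x y" if "x \<in> set (P1 @ [p])" "y \<in> set (q # Q2)" for x y
    proof -
      have "ipath ((P1 @ [p]) @ (M @ q # Q2))" using ipP PM by simp
      then have "E x y \<longleftrightarrow> x = last (P1 @ [p]) \<and> y = hd (M @ q # Q2)"
        using that by (subst (asm) ipath_append) auto
      moreover have "y \<noteq> hd (M @ q # Q2)"
        using M0 that(2) dP PM by (cases M) auto
      ultimately show ?thesis by blast
    qed
    have ip3: "ipath ((P1 @ [p]) @ [r])"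
      using ip1 r PM s1 E_commute[of _ r] by (subst ipath_append) auto
    have disj: "set (P1 @ [p]) \<inter> set (q # Q2) = {}" using dP PM by auto
    have "ipath (((P1 @ [p]) @ [r]) @ (q # Q2))"
      using ip3 ip2 r PM s2 cr disj by (subst ipath_append) auto
    then have ip: "ipath ((P1 @ [p]) @ r # (q # Q2))" by simp
    have hdJ: "hd (P1 @ [p]) = hd P" "last (q # Q2) = last P"
      using PM by (auto simp: hd_append)
    have sub: "set (P1 @ [p]) \<subseteq> set P" "set (q # Q2) \<subseteq> set P" using PM by auto
    have outC: "set ((P1 @ [p]) @ r # (q # Q2)) \<inter> C = {}" using P sub r unfolding jump_def by auto
    have Patt: "E z u \<longleftrightarrow> z = hd P \<and> u = f a \<or> z = last P \<and> u = f b" if "z \<in> set P" "u \<in> C" for z u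
      using P that unfolding jump_def by blast
    have rends: "r \<noteq> hd P" "r \<noteq> last P" using r(2) P0 by auto
    \<comment> \<open>The new path has three vertices more than \<open>P1\<close> and
      \<open>Q2\<close> together. It is a jump if \<open>r\<close> has no neighbour on
      \<open>C\<close>; otherwise \<open>skip\<close> gives it the same parity.\<close>
    from att show ?thesis
    proof
      assume na: "\<forall>u\<in>C. \<not> E r u"
      have "jump C ((P1 @ [p]) @ r # (q # Q2)) (f a) (f b)"
        unfolding jump_def
      proof (intro conjI ballI)
        fix z u assume z: "z \<in> set ((P1 @ [p]) @ r # (q # Q2))" and u: "u \<in> C"
        have "hd ((P1 @ [p]) @ r # (q # Q2)) = hd P" using hdJ(1) by (simp add: hd_append split: if_splits)
        moreover have "last ((P1 @ [p]) @ r # (q # Q2)) = last P" using hdJ(2) by simp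
        moreover have "E z u \<longleftrightarrow> z = hd P \<and> u = f a \<or> z = last P \<and> u = f b"
        proof (cases "z = r")
          case True
          with na u rends show ?thesis by blast
        next
          case False
          with z sub have "z \<in> set P" by auto
          from Patt[OF this u] show ?thesis .
        qed
        ultimately show "E z u \<longleftrightarrow> z = hd ((P1 @ [p]) @ r # (q # Q2)) \<and> u = f a
          \<or> z = last ((P1 @ [p]) @ r # (q # Q2)) \<and> u = f b" by simp
      qed (use ip outC in auto)
      from jump_odd[OF this ab] show ?thesis
        by (simp only: length_append length_Cons list.size of_nat_add of_nat_Suc) presburger
    next
      assume "\<exists>s. f s \<noteq> f a \<and> f s \<noteq> f b \<and> (\<forall>u\<in>C. E r u \<longleftrightarrow> u = f s)"
      then obtain s where s: "f s \<noteq> f a" "f s \<noteq> f b" "\<forall>u\<in>C. E r u \<longleftrightarrow> u = f s" by blast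
      have "odd (int (length (P1 @ [p])) + int (length (q # Q2)) + (a - b))"
      proof (rule skip[OF ip _ _ outC])
        fix z u assume z: "z \<in> set ((P1 @ [p]) @ r # (q # Q2))" and u: "u \<in> C"
        show "E z u \<longleftrightarrow> z = hd (P1 @ [p]) \<and> u = f a \<or> z = r \<and> u = f s \<or> z = last (q # Q2) \<and> u = f b"
        proof (cases "z = r")
          case True
          with s u rends hdJ show ?thesis by auto
        next
          case False
          with z sub have "z \<in> set P" by auto
          from Patt[OF this u] False show ?thesis unfolding hdJ by blast
        qed
      qed (use s ab in auto)
      then show ?thesis by simp
    qed
  qed
qed

text \<open>In general the branch is a jump from \<open>v\<close> to \<open>a\<close>. If
  \<open>p\<close> is the last vertex of the old jump, it keeps its contact with \<open>b\<close>,
  but as an inner vertex of the branch, and \<open>skip\<close> applies.\<close>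

lemma branch_parity:
  assumes P: "jump C (P1 @ p # P2) (f a) (f b)" "f a \<noteq> f b" and p: "E (last R) p" "\<forall>x\<in>set P1. \<not> E (last R) x"
    and va: "f v \<noteq> f a" "f v \<noteq> f b" "\<not> E (f v) (f a)" "f a \<noteq> f (v + int l)"
    and R: "R \<noteq> []" "ipath R" "set R \<inter> C = {}" "set R \<inter> set (P1 @ p # P2) = {}"
    and att: "\<And>r u. r \<in> set R \<Longrightarrow> u \<in> C \<Longrightarrow> E r u \<longleftrightarrow> r = hd R \<and> u = f v"
    and nadj: "\<And>r x. r \<in> set R \<Longrightarrow> r \<noteq> last R \<Longrightarrow> x \<in> set (P1 @ p # P2) \<Longrightarrow> \<not> E r x"
  shows "odd (int (length R) + int (length P1) + (v - a))"
proof (cases "P2 = []")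
  case False
  have "jump C (R @ p # rev P1) (f v) (f a)"
    by (rule branch[OF P(1) p False R]) (use att nadj in auto)
  from jump_odd[OF this va(1,3,4)] show ?thesis
    by (simp only: length_append length_Cons length_rev of_nat_add of_nat_Suc) presburger
next
  case True
  have P10: "P1 \<noteq> []" using jump_ends_neq[OF P] True by auto
  have "ipath (P1 @ p # P2)" using P(1) by (simp add: jump_def)
  then have ip: "ipath (R @ p # rev P1)" by (rule branch_ipath[OF _ p R(1,2,4)]) (use nadj in auto)
  have ends: "hd (P1 @ p # P2) = last (rev P1)" "last (P1 @ p # P2) = p" using True P10 by (auto simp: last_rev)
  have "odd (int (length R) + int (length (rev P1)) + (v - a))"
  proof (rule skip[OF ip])
    fix z u assume z: "z \<in> set (R @ p # rev P1)" and u: "u \<in> C"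
    show "E z u \<longleftrightarrow> z = hd R \<and> u = f v \<or> z = p \<and> u = f b \<or> z = last (rev P1) \<and> u = f a"
    proof (cases "z \<in> set R")
      case True
      moreover have "last (rev P1) \<in> set (P1 @ p # P2)" using P10 by (auto simp: last_rev)
      ultimately have "z \<noteq> p" "z \<noteq> last (rev P1)" using R(4) by auto
      with att[OF True u] show ?thesis by blast
    next
      case False
      with z have z': "z \<in> set (P1 @ p # P2)" by auto
      moreover have "z \<noteq> hd R" using False R(1) by auto
      ultimately show ?thesis using P(1) u unfolding jump_def ends by blast
    qed
  next
    show "set (R @ p # rev P1) \<inter> C = {}" using R(3) P(1) unfolding jump_def by auto
  qed (use R P10 va P(2) in auto)
  then show ?thesis by simp
qed

text \<open>The routes from \<open>v\<close> to \<open>a\<close>, from \<open>v\<close> to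
  \<open>b\<close>, and from \<open>a\<close> to \<open>b\<close> through \<open>last R\<close>
  share their segments in pairs. Each segment is counted twice, so the three odd numbers would have
  an even sum.\<close>

lemma no_unattached_detour:
  assumes P: "jump C P (f a) (f b)" and ab: "f a \<noteq> f b" "\<not> E (f a) (f b)" "f b \<noteq> f (a + int l)"
    and va: "f v \<noteq> f a" "\<not> E (f v) (f a)" "f a \<noteq> f (v + int l)"
    and vb: "f v \<noteq> f b" "\<not> E (f v) (f b)" "f b \<noteq> f (v + int l)"
    and R: "R \<noteq> []" "ipath R" "set R \<inter> C = {}" "set R \<inter> set P = {}"
    and att: "\<And>r u. r \<in> set R \<Longrightarrow> u \<in> C \<Longrightarrow> E r u \<longleftrightarrow> r = hd R \<and> u = f v"
    and nadj: "\<And>r x. r \<in> set R \<Longrightarrow> r \<noteq> last R \<Longrightarrow> x \<in> set P \<Longrightarrow> \<not> E r x"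
    and hit: "\<exists>p\<in>set P. E (last R) p"
  shows False
proof -
  obtain P1 p P2 where s1: "P = P1 @ p # P2" "E (last R) p" "\<forall>x\<in>set P1. \<not> E (last R) x"
    using split_list_first_prop[OF hit] by blast
  obtain Q1 q Q2 where s2: "P = Q1 @ q # Q2" "E (last R) q" "\<forall>x\<in>set Q2. \<not> E (last R) x"
    using split_list_last_prop[OF hit] by blast
  have lR: "last R \<in> set R" "last R \<notin> C" "last R \<notin> set P" using R last_in_set[OF R(1)] by blast+
  have 1: "odd (int (length R) + int (length P1) + (v - a))"
    by (rule branch_parity[of P1 p P2 a b R v]) (use P s1 ab va vb R att nadj in auto)
  have rP: "rev P = rev Q2 @ q # rev Q1" using s2 by simp
  have 2: "odd (int (length R) + int (length (rev Q2)) + (v - b))"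
    by (rule branch_parity[of "rev Q2" q "rev Q1" b a R v])
      (use jump_rev[OF P] rP s2 ab va vb R att nadj in auto)
  have "(\<forall>u\<in>C. \<not> E (last R) u) \<or> (\<exists>s. f s \<noteq> f a \<and> f s \<noteq> f b \<and> (\<forall>u\<in>C. E (last R) u \<longleftrightarrow> u = f s))"
    using att[OF lR(1)] va(1) vb(1) by blast
  from detour_parity[OF P ab lR(2,3) s1 s2 this] 1 2 show False unfolding length_rev by presburger
qed

text \<open>The same count with three routes, where the last vertex \<open>r\<close> of the path
  also has a neighbour \<open>f s\<close> on \<open>C\<close>. The contact at \<open>r\<close> is
  inner on these routes, so \<open>skip\<close> absorbs it, unless \<open>f s\<close> is an end of
  the route.\<close>

lemma no_attached_detour:
  assumes P: "jump C P (f a) (f b)" and ab: "f a \<noteq> f b" "\<not> E (f a) (f b)" "f b \<noteq> f (a + int l)"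
    and va: "f v \<noteq> f a" "\<not> E (f v) (f a)" "f a \<noteq> f (v + int l)"
    and vb: "f v \<noteq> f b" "\<not> E (f v) (f b)" "f b \<noteq> f (v + int l)"
    and R: "ipath (A @ [r])" "A \<noteq> []" "set (A @ [r]) \<inter> C = {}" "set (A @ [r]) \<inter> set P = {}"
    and att: "\<And>z u. z \<in> set (A @ [r]) \<Longrightarrow> u \<in> C \<Longrightarrow> E z u \<longleftrightarrow> z = hd A \<and> u = f v \<or> z = r \<and> u = f s"
    and vs: "f v \<noteq> f s" and sb: "f s \<noteq> f b"
    and nadj: "\<And>z x. z \<in> set A \<Longrightarrow> x \<in> set P \<Longrightarrow> \<not> E z x"
    and hit: "\<exists>p\<in>set P. E r p"
  shows False
proof -
  obtain P1 p P2 where s1: "P = P1 @ p # P2" "E r p" "\<forall>x\<in>set P1. \<not> E r x"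
    using split_list_first_prop[OF hit] by blast
  obtain Q1 q Q2 where s2: "P = Q1 @ q # Q2" "E r q" "\<forall>x\<in>set Q2. \<not> E r x"
    using split_list_last_prop[OF hit] by blast
  have P': "P \<noteq> []" "ipath P" "set P \<inter> C = {}"
    and Patt: "\<And>z u. z \<in> set P \<Longrightarrow> u \<in> C \<Longrightarrow> E z u \<longleftrightarrow> z = hd P \<and> u = f a \<or> z = last P \<and> u = f b"
    using P unfolding jump_def by blast+
  have dP: "distinct P" using P'(2) ipath_distinct by blast
  have r: "r \<notin> C" "r \<notin> set P" "E r (f s)" using R att by auto
  have rA: "r \<notin> set A" using ipath_distinct[OF R(1)] by auto
  \<comment> \<open>The ends of \<open>P\<close> and \<open>r\<close> all have neighbours on
    \<open>C\<close>, and two adjacent vertices off \<open>C\<close> cannot both have one.\<close>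
  have rn: "\<not> E r (hd P)" "\<not> E r (last P)"
    using adjacent_attach[of "hd P" r] adjacent_attach[of "last P" r] r P' Patt[of "hd P"] Patt[of "last P"]
      hd_in_set[OF P'(1)] last_in_set[OF P'(1)] by blast+
  have P1: "P1 \<noteq> []" using s1(1,2) rn(1) by (metis append_Nil list.sel(1))
  have P2: "P2 \<noteq> []" using s1(1,2) rn(2) by (metis last_snoc)
  have Q1: "Q1 \<noteq> []" using s2(1,2) rn(1) by (metis append_Nil list.sel(1))
  have Q2: "Q2 \<noteq> []" using s2(1,2) rn(2) by (metis last_snoc)
  \<comment> \<open>Stated for both directions of \<open>P\<close>: with \<open>W\<close> as
    \<open>P1\<close> it leads to \<open>a\<close>, with \<open>W\<close> as the reverse of
    \<open>Q2\<close> to \<open>b\<close>.\<close>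
  have up: "odd (int (length A) + int (length W) + 1 + (v - d))"
    if W: "P = W @ w # X \<and> W \<noteq> [] \<and> d' = b \<and> d = a \<or> rev P = W @ w # X \<and> W \<noteq> [] \<and> d' = a \<and> d = b"
      and w: "E r w" "\<forall>x\<in>set W. \<not> E r x" and X: "X \<noteq> []" and sd: "f s \<noteq> f d"
    for W w X d d'
  proof -
    have J: "jump C (W @ w # X) (f d) (f d')" and sW: "set (W @ w # X) = set P"
      using W P jump_rev[OF P] by (metis, metis set_rev)
    have "ipath ((A @ [r]) @ w # rev W)"
      by (rule branch_ipath[of W w X "A @ [r]"]) (use J R w nadj sW rA in \<open>auto simp: jump_def\<close>)
    then have ip: "ipath (A @ r # (w # rev W))" by simp
    have "last X \<notin> set (W @ [w])" using J X ipath_distinct[of "W @ w # X"] last_in_set[OF X]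
      by (auto simp: jump_def)
    then have wn: "last (W @ w # X) \<notin> set (w # rev W)" using X by auto
    have hdW: "hd (W @ w # X) = last (w # rev W)" using W by (cases W) auto
    have "odd (int (length A) + int (length (w # rev W)) + (v - d))"
    proof (rule skip[OF ip R(2)])
      have "set (w # rev W) \<subseteq> set P" using sW by auto
      then show "set (A @ r # w # rev W) \<inter> C = {}" using R(3) P'(3) by auto
      fix z u assume z: "z \<in> set (A @ r # w # rev W)" and u: "u \<in> C"
      show "E z u \<longleftrightarrow> z = hd A \<and> u = f v \<or> z = r \<and> u = f s \<or> z = last (w # rev W) \<and> u = f d"
      proof (cases "z \<in> set (A @ [r])")
        case True
        have "last (w # rev W) \<in> set P" unfolding hdW[symmetric] sW[symmetric] by (rule hd_in_set) simp
        then have "z \<noteq> last (w # rev W)" using True R(4) by auto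
        with att[OF True u] show ?thesis by blast
      next
        case False
        then have z': "z \<in> set (w # rev W)" "z \<noteq> r" "z \<noteq> hd A" using z R(2) by auto
        then have "z \<in> set (W @ w # X)" "z \<noteq> last (W @ w # X)" using wn by auto
        then have "E z u \<longleftrightarrow> z = hd (W @ w # X) \<and> u = f d" using J u unfolding jump_def by blast
        with z'(2,3) show ?thesis unfolding hdW by simp
      qed
    qed (use vs sd va vb W in auto)
    then show ?thesis by (simp only: length_Cons length_rev of_nat_Suc) presburger
  qed
  have rP: "rev P = rev Q2 @ q # rev Q1" using s2 by simp
  have 2: "odd (int (length A) + int (length Q2) + 1 + (v - b))"
    using up[of "rev Q2" q "rev Q1" a b] rP s2 Q1 Q2 sb by simp
  show False
  proof (cases "f s = f a")
    case False
    have 1: "odd (int (length A) + int (length P1) + 1 + (v - a))"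
      using up[of P1 p P2 b a] s1 P1 P2 False by simp
    have "\<forall>u\<in>C. E r u \<longleftrightarrow> u = f s" using att[of r] rA R(2) by auto
    with False sb have "(\<forall>u\<in>C. \<not> E r u) \<or> (\<exists>s. f s \<noteq> f a \<and> f s \<noteq> f b \<and> (\<forall>u\<in>C. E r u \<longleftrightarrow> u = f s))"
      by blast
    from detour_parity[OF P ab r(1,2) s1 s2 this] 1 2 show False by presburger
  next
    case True
    \<comment> \<open>The contact of \<open>r\<close> is the end \<open>f a\<close> itself, so the
      routes through \<open>r\<close> to \<open>a\<close> simply stop at \<open>r\<close>.\<close>
    have "jump C (A @ [r]) (f v) (f a)" unfolding jump_def using R att True by auto
    from jump_odd[OF this va] have 1: "odd (int (length A) + 1 + 1 + (v - a))"
      by (simp only: length_append length_Cons list.size of_nat_add of_nat_Suc) presburger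
    have "jump C ([r] @ q # rev (rev Q2)) (f a) (f b)"
      by (rule branch[of C "rev Q2" q "rev Q1" "f b" "f a" "[r]"])
        (use jump_rev[OF P] rP s2 Q1 r rA R att True in auto)
    from jump_odd[OF this ab] have "odd (int (length Q2) + 2 + 1 + (a - b))"
      by (simp only: rev_rev_ident length_append length_Cons list.size of_nat_add of_nat_Suc) presburger
    with 1 2 show False by presburger
  qed
qed

text \<open>A path that leaves the cycle far from both ends of a non-antipodal jump never reaches it.\<close>
lemma no_detour:
  assumes P: "jump C P (f a) (f b)" and ab: "f a \<noteq> f b" "\<not> E (f a) (f b)" "f b \<noteq> f (a + int l)"
    and va: "f v \<noteq> f a" "\<not> E (f v) (f a)" "f a \<noteq> f (v + int l)"
    and vb: "f v \<noteq> f b" "\<not> E (f v) (f b)" "f b \<noteq> f (v + int l)"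
    and R: "R \<noteq> []" "ipath R" "set R \<inter> C = {}" "set R \<inter> set P = {}" "E (hd R) (f v)"
    and att: "\<And>r i. r \<in> set R \<Longrightarrow> E r (f i) \<Longrightarrow> r = hd R \<and> f i = f v \<or> r = last R \<and> f i \<noteq> f v"
    and nadj: "\<And>r x. r \<in> set R \<Longrightarrow> r \<noteq> last R \<Longrightarrow> x \<in> set P \<Longrightarrow> \<not> E r x"
    and hit: "\<exists>p\<in>set P. E (last R) p"
  shows False
proof (cases "\<exists>s. E (last R) (f s) \<and> f s \<noteq> f v")
  case False
  have "E r u \<longleftrightarrow> r = hd R \<and> u = f v" if "r \<in> set R" "u \<in> C" for r u
  proof -
    from that obtain i where "u = f i" by blast
    then show ?thesis using that att[of r i] False R(5) by blast
  qed
  from no_unattached_detour[OF P ab va vb R(1-4) this nadj hit] show False by blast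
next
  case True
  then obtain s where s: "E (last R) (f s)" "f s \<noteq> f v" by blast
  have "last R \<notin> C" using R(3) last_in_set[OF R(1)] by blast
  then have neq: "hd R \<noteq> last R" using uniq_attach[of "last R" s v] s R(5) by metis
  define A where "A = butlast R"
  have RA: "R = A @ [last R]" using R(1) by (simp add: A_def)
  have A0: "A \<noteq> []" using RA neq by (metis append_Nil list.sel(1))
  have hdA: "hd A = hd R" using RA A0 by (metis hd_append2)
  have rA: "last R \<notin> set A" using ipath_distinct[OF R(2)] RA by (metis distinct_append disjoint_iff list.set_intros(1))
  have ipA: "ipath (A @ [last R])" "set (A @ [last R]) \<inter> C = {}" "set (A @ [last R]) \<inter> set P = {}"
    using R RA by metis+
  have attA: "E z u \<longleftrightarrow> z = hd A \<and> u = f v \<or> z = last R \<and> u = f s"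
    if "z \<in> set (A @ [last R])" "u \<in> C" for z u
  proof -
    from that(2) obtain i where i: "u = f i" by blast
    have "z \<in> set R" "z \<notin> C" using that(1) RA R(3) by (metis, metis disjoint_iff)
    then show ?thesis using att[of z i] i R(5) s uniq_attach[of z i s] neq hdA by metis
  qed
  have nadjA: "\<not> E z x" if "z \<in> set A" "x \<in> set P" for z x
    using that nadj[of z x] rA RA by (metis UnCI set_append)
  show False
  proof (cases "f s = f b")
    case False
    show False
      by (rule no_attached_detour[OF P ab va vb ipA(1) A0 ipA(2,3) attA _ False nadjA hit])
        (use s in auto)
  next
    case True
    have ba: "f b \<noteq> f a" "\<not> E (f b) (f a)" "f a \<noteq> f (b + int l)"
      using ab E_commute antipode_sym by metis+
    have P': "jump C (rev P) (f b) (f a)" "set (A @ [last R]) \<inter> set (rev P) = {}" using jump_rev[OF P] ipA by auto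
    show False
      by (rule no_attached_detour[OF P'(1) ba vb va ipA(1) A0 ipA(2) P'(2) attA])
        (use s True ab nadjA hit in auto)
  qed
qed

section \<open>Jumps starting at a given vertex of the cycle\<close>

lemma T3_adj: "f s \<in> T3 f c \<longleftrightarrow> f s = f c \<or> E (f c) (f s)"
proof -
  have "2 * int l dvd s - (c - 1) \<longleftrightarrow> 2 * int l dvd c - s - 1"
    using dvd_minus_iff[of "2 * int l" "c - s - 1"] by (simp add: algebra_simps)
  then show ?thesis using f unfolding hole_fn_def T3_def by (auto simp: algebra_simps)
qed

lemma T3_iff: "\<bar>s - c\<bar> < 2 * int l \<Longrightarrow>
    f s \<in> T3 f c \<longleftrightarrow> s = c \<or> \<bar>s - c\<bar> = 1 \<or> \<bar>s - c\<bar> = 2 * int l - 1"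
  using hole_eq[OF f, of s c] hole_adj[OF f, of c s] by (auto simp: T3_adj abs_minus_commute)

text \<open>A neighbour of \<open>f v\<close> other than its two neighbours on the cycle lies off
  the cycle, because the cycle is induced. It is the start for \<open>approach\<close>.\<close>

lemma leave:
  assumes B: "B \<inter> C = {}" "\<And>b. b \<in> B \<Longrightarrow> \<not> E b (f v)"
  obtains R where "R \<noteq> []" "ipath R" "E (hd R) (f v)" "set R \<inter> C = {}" "set R \<inter> B = {}"
    "\<And>r i. r \<in> set R \<Longrightarrow> E r (f i) \<Longrightarrow> r = hd R \<and> f i = f v \<or> r = last R \<and> f i \<notin> T3 f v"
    "\<And>r b. r \<in> set R \<Longrightarrow> r \<noteq> last R \<Longrightarrow> b \<in> B \<Longrightarrow> \<not> E r b"
    "(\<exists>b\<in>B. E (last R) b) \<or> (\<exists>s. f s \<notin> T3 f v \<and> E (last R) (f s))"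
proof -
  obtain x where x: "E (f v) x" "x \<noteq> f (v - 1)" "x \<noteq> f (v + 1)" using deg3[of "f v"] fV by blast
  have xC: "x \<notin> C"
  proof
    assume "x \<in> C"
    then obtain i where i: "x = f i" by blast
    with x have "f i \<in> T3 f v" by (simp add: T3_adj)
    with i x have "x = f v" by (simp add: T3_def)
    with x E_irrefl show False by blast
  qed
  have xv: "E x (f v)" using x E_sym by blast
  show ?thesis
  proof (rule approach[OF f _ fV star xC xv _ B])
    show "7 \<le> 2 * int l" using l5 by simp
    show "f i = f v" if "E x (f i)" for i using uniq_attach[OF xC that xv] .
    fix R assume R: "R \<noteq> []" "ipath R" "hd R = x" "set R \<inter> C = {}" "set R \<inter> B = {}" "set R \<subseteq> V"
      "\<And>r i. r \<in> set R \<Longrightarrow> E r (f i) \<Longrightarrow> r = x \<and> f i = f v \<or> r = last R \<and> f i \<notin> T3 f v"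
      "\<And>r. r \<in> set R \<Longrightarrow> r \<noteq> x \<Longrightarrow> r \<notin> N (T3 f v)"
      "\<And>r b. r \<in> set R \<Longrightarrow> r \<noteq> last R \<Longrightarrow> b \<in> B \<Longrightarrow> \<not> E r b"
      "(\<exists>b\<in>B. E (last R) b) \<or> (\<exists>i. f i \<notin> T3 f v \<and> E (last R) (f i))"
    show ?thesis
      by (rule that[OF R(1,2) _ R(4,5) _ R(9)]) (use R(3,7,10) xv in blast)+
  qed
qed

lemma land_jump:
  assumes R: "R \<noteq> []" "ipath R" "E (hd R) (f v)" "set R \<inter> C = {}"
    and att: "\<And>r i. r \<in> set R \<Longrightarrow> E r (f i) \<Longrightarrow> r = hd R \<and> f i = f v \<or> r = last R \<and> f i \<notin> T3 f v"
    and s: "E (last R) (f s)"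
  shows "jump C R (f v) (f s)"
  unfolding jump_def
proof (intro conjI ballI)
  fix r u assume r: "r \<in> set R" and u: "u \<in> C"
  then obtain i where i: "u = f i" by blast
  have "last R \<notin> C" using R(1,4) last_in_set[OF R(1)] by blast
  then show "E r u \<longleftrightarrow> r = hd R \<and> u = f v \<or> r = last R \<and> u = f s"
    using att[OF r, of i] i uniq_attach[of "last R" i s] s R(3) by blast
qed (use R in auto)

lemma jump_length:
  assumes "jump C P (f a) (f b)" "a + 2 \<le> b" "b \<le> a + 2 * int l - 2"
  shows "2 \<le> length P"
  using jump_type(2,3)[OF assms] l5 by linarith

text \<open>With ends at distance at least 3 and less than \<open>l\<close>, there are two
  consecutive vertices strictly between the antipodes of the ends. The final argument starts jumps
  at both.\<close>

definition long_jump :: bool where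
  "long_jump \<longleftrightarrow> (\<exists>P a b. jump C P (f a) (f b) \<and> a + 3 \<le> b \<and> b \<le> a + int l - 1)"

text \<open>
  The interior of a jump over a path of length 2 is joined to the rest of the cycle outside the
  neighbourhood of that path, which gives jumps from both ends of it to a third vertex.
\<close>
lemma short_jump_long_jump:
  assumes P: "jump C P (f a) (f (a + 2))"
  shows long_jump
proof -
  let ?T = "T3 f (a + 1)"
  have len: "7 \<le> length P" using jump_type(2)[OF P] l5 by linarith
  have P': "P \<noteq> []" "ipath P" "set P \<inter> C = {}"
    and Patt: "\<And>z u. z \<in> set P \<Longrightarrow> u \<in> C \<Longrightarrow> E z u \<longleftrightarrow> z = hd P \<and> u = f a \<or> z = last P \<and> u = f (a + 2)"
    using P unfolding jump_def by blast+
  have dP: "distinct P" using ipath_distinct[OF P'(2)] .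
  obtain p0 p1 Q p2 where PQ: "P = p0 # p1 # Q @ [p2]"
  proof -
    obtain p0 p1 Q' where "P = p0 # p1 # Q'" using len by (cases P; cases "tl P") auto
    moreover from this len have "Q' = butlast Q' @ [last Q']" by (intro append_butlast_last_id[symmetric]) auto
    ultimately show ?thesis using that by metis
  qed
  have "E p0 p1" using P'(2) PQ by simp
  then have PV: "p1 \<in> V" using E_V E_sym by blast
  have p1: "p1 \<in> V - N ?T"
  proof -
    have "\<not> E p1 u" if "u \<in> C" for u using Patt[of p1 u] that PQ dP by auto
    moreover have "?T \<subseteq> C" by (auto simp: T3_def)
    ultimately show ?thesis using PV PQ P'(3) unfolding N_def by auto
  qed
  \<comment> \<open>The same target as in \<open>approach\<close>, for the middle vertex
    \<open>a + 1\<close>.\<close>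
  have zN: "f (a + 4) \<in> V - N ?T"
    using fV l5 hole_eq[OF f, of "a + 4"] hole_adj[OF f, of "a + 4"] by (auto simp: N_def T3_def)
  have z5: "f (a + 5) \<notin> ?T" using l5 by (subst T3_iff) auto
  define Tg where "Tg u \<longleftrightarrow> (\<exists>i. f i \<notin> ?T \<and> E u (f i))" for u
  have tg: "Tg (f (a + 4))" unfolding Tg_def using z5 hole_adj_Suc[OF f, of "a + 4"] by (auto simp: add.commute)
  have j: "joined (V - N ?T) p1 (f (a + 4))" using star[of "a + 1"] p1 zN by (simp add: conn_def)
  obtain W where W: "W \<noteq> []" "hd W = p1" "Tg (last W)" "set W \<subseteq> V - N ?T" "ipath W"
    and nTg: "\<forall>u\<in>set W. u \<noteq> last W \<longrightarrow> \<not> Tg u"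
    by (rule shortest_ipath[OF j, of Tg, OF tg]) (rule that)
  have dW: "distinct W" using ipath_distinct[OF W(5)] .
  have out: "W ! k \<notin> C" if k: "k < length W" for k
  proof (cases k)
    case 0
    then show ?thesis using W(1,2) PQ P'(3) by (auto simp: hd_conv_nth)
  next
    case (Suc j)
    have "W ! j \<in> set W" "W ! j \<noteq> last W"
      using k Suc W(1) dW by (simp_all add: last_conv_nth nth_eq_iff_index_eq)
    then have "\<not> Tg (W ! j)" using nTg by blast
    moreover have e: "E (W ! j) (W ! k)" using ipath_nth[OF W(5), of j k] k Suc by auto
    moreover have "W ! k \<notin> ?T" using W(4) nth_mem[OF k] unfolding N_def by blast
    ultimately show ?thesis unfolding Tg_def by (metis rangeE)
  qed
  then have WC: "set W \<inter> C = {}" by (metis disjoint_iff in_set_conv_nth)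
  obtain s0 where s0: "f s0 \<notin> ?T" "E (last W) (f s0)" using W(3) unfolding Tg_def by blast
  obtain s where s: "f s0 = f s" "a \<le> s" "s < a + 2 * int l" using hole_index[OF f] by blast
  have sT: "f s \<notin> ?T" "E (last W) (f s)" using s0 s by auto
  have Teq: "?T = {f a, f (a + 1), f (a + 2)}" by (simp add: T3_def add.assoc)
  have "f s \<noteq> f a" "f s \<noteq> f (a + 1)" "f s \<noteq> f (a + 2)" using sT unfolding Teq by auto
  then have sb: "a + 3 \<le> s"
    using s by (cases "s = a"; cases "s = a + 1"; cases "s = a + 2") auto
  have Watt: "E w u \<longleftrightarrow> w = last W \<and> u = f s" if "w \<in> set W" "u \<in> C" for w u
  proof -
    from that(2) obtain i where i: "u = f i" by blast
    have "\<not> E w (f i) \<or> f i \<notin> ?T" using W(4) that(1) unfolding N_def by blast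
    moreover have "w = last W" if "E w (f i)" "f i \<notin> ?T"
      using nTg \<open>w \<in> set W\<close> that unfolding Tg_def by blast
    moreover have "w \<notin> C" using WC that(1) by blast
    ultimately show ?thesis using i sT(2) uniq_attach[of w i s] by blast
  qed
  have lP: "last W \<notin> set P"
    using Patt[of "last W" "f s"] sT unfolding Teq by auto
  have p1W: "p1 \<in> set W" using W(1,2) hd_in_set[OF W(1)] by simp
  have lW: "last W \<in> set W" using W(1) by simp
  have NT: "p \<notin> set W" if "p \<in> set P" "\<exists>u\<in>?T. E p u" for p using W(4) that unfolding N_def by blast
  have hl: "hd P \<notin> set W" "last P \<notin> set W"
    using NT[of "hd P"] NT[of "last P"] Patt[of "hd P" "f a"] Patt[of "last P" "f (a + 2)"] P'(1)
    unfolding Teq by auto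
  have JA: "\<exists>Q. jump C Q (f a) (f s)"
  proof -
    let ?X = "set (p0 # p1 # Q) \<union> set W"
    have su: "successively E (p0 # p1 # Q)"
      using ipath_successively[OF P'(2)] PQ by (metis append_Cons successively_append_iff)
    have "conn ?X"
      using conn_Un[OF conn_path[OF su] conn_path[OF ipath_successively[OF W(5)]], of p1 p1] p1W by simp
    then have jo: "joined ?X p0 (last W)" using lW by (auto simp: conn_def)
    have XC: "?X \<inter> C = {}" using WC P'(3) PQ by auto
    have "E p c \<longleftrightarrow> p = p0 \<and> c = f a \<or> p = last W \<and> c = f s" if p: "p \<in> ?X" and c: "c \<in> C" for p c
    proof (cases "p \<in> set W")
      case True
      have "p0 \<notin> set W" using hl PQ by simp
      with Watt[OF True c] True show ?thesis by blast
    next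
      case False
      with p have "p \<in> set P" "p \<noteq> last P" "p \<noteq> last W" using PQ dP lW by auto
      with Patt[of p c] c PQ show ?thesis by auto
    qed
    from jump_joined[OF jo XC rangeI rangeI this] show ?thesis by blast
  qed
  have JB: "\<exists>Q. jump C Q (f (a + 2)) (f s)"
  proof -
    let ?X = "set (p1 # Q @ [p2]) \<union> set W"
    have su: "successively E (p1 # Q @ [p2])"
      using ipath_successively[OF P'(2)] PQ by (simp add: successively_Cons)
    have "conn ?X"
      using conn_Un[OF conn_path[OF su] conn_path[OF ipath_successively[OF W(5)]], of p1 p1] p1W by simp
    then have jo: "joined ?X p2 (last W)" using lW by (auto simp: conn_def)
    have XC: "?X \<inter> C = {}" using WC P'(3) PQ by auto
    have "E p c \<longleftrightarrow> p = p2 \<and> c = f (a + 2) \<or> p = last W \<and> c = f s" if p: "p \<in> ?X" and c: "c \<in> C" for p c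
    proof (cases "p \<in> set W")
      case True
      have "p2 \<notin> set W" using hl PQ by simp
      with Watt[OF True c] True show ?thesis by blast
    next
      case False
      with p have "p \<in> set P" "p \<noteq> hd P" "p \<noteq> last W" using PQ dP lW by auto
      with Patt[of p c] c PQ show ?thesis by auto
    qed
    from jump_joined[OF jo XC rangeI rangeI this] show ?thesis by blast
  qed
  \<comment> \<open>Wherever \<open>f s\<close> lies, its distance to \<open>f a\<close> or to
    \<open>f (a + 2)\<close> is between 3 and \<open>l - 1\<close>. If it is the antipode of
    \<open>f a\<close>, for instance, it has distance \<open>l - 2\<close> from
    \<open>f (a + 2)\<close>, and \<open>5 \<le> l\<close> makes this at least 3.\<close>
  have per: "f (a + 2 * int l) = f a" "f (a + 2 + 2 * int l) = f (a + 2)" using hole_period[OF f] by auto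
  consider "s \<le> a + int l - 1" | "a + int l \<le> s" "s \<le> a + int l + 1"
    | "a + int l + 2 \<le> s" "s \<le> a + 2 * int l - 3" | "a + 2 * int l - 2 \<le> s" by linarith
  then show ?thesis
  proof cases
    case 1 then show ?thesis using JA sb unfolding long_jump_def by blast
  next
    case 2
    then have "a + 2 + 3 \<le> s" "s \<le> a + 2 + int l - 1" using l5 by auto
    then show ?thesis using JB unfolding long_jump_def by blast
  next
    case 3
    obtain Q where "jump C (rev Q) (f s) (f (a + 2 * int l))" using JA jump_rev per by metis
    moreover have "s + 3 \<le> a + 2 * int l" "a + 2 * int l \<le> s + int l - 1" using 3 by auto
    ultimately show ?thesis unfolding long_jump_def by blast
  next
    case 4
    obtain Q where "jump C (rev Q) (f s) (f (a + 2 + 2 * int l))" using JB jump_rev per by metis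
    moreover have "s + 3 \<le> a + 2 + 2 * int l" "a + 2 + 2 * int l \<le> s + int l - 1" using 4 s l5 by auto
    ultimately show ?thesis unfolding long_jump_def by blast
  qed
qed

section \<open>Pairs of jumps that do not touch\<close>

text \<open>For equal parities the hole through both jumps would be even. Each jump has at least
  \<open>l - 1\<close> inner vertices, and the two arcs contribute at least 4 more, which exceeds
  \<open>2l\<close>.\<close>

lemma antipodal_pair:
  assumes P: "jump C P (f x) (f (x + int l))" and Q: "jump C Q (f y) (f (y + int l))"
    and PQ: "set P \<inter> set Q = {}" "\<And>p q. p \<in> set P \<Longrightarrow> q \<in> set Q \<Longrightarrow> \<not> E p q"
    and xy: "x < y" "y \<le> x + 2"
  shows "odd (length P + length Q)"
proof (rule ccontr)
  assume ev: "\<not> odd (length P + length Q)"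
  let ?H = "(map f [x..y] @ Q) @ rev (P @ map f [x + int l..y + int l])"
  have H: "icyc ?H" by (rule two_jumps_crossing[OF f P Q PQ]) (use xy l5 in auto)
  have len: "int (length ?H) = int (length P) + int (length Q) + 2 * (y - x + 1)" using xy by simp
  then have "even (int (length ?H))" using ev by presburger
  then have e: "even (length ?H)" by (simp only: even_of_nat)
  have "2 * int l = int (length P) + int (length Q) + 2 * (y - x + 1)"
    using trans[OF sym[OF hole_length[OF H e]] len] .
  moreover have "int l \<le> int (length P) + 1" "int l \<le> int (length Q) + 1"
    using jump_type(3)[OF P] jump_type(3)[OF Q] l5 by simp_all
  ultimately show False using xy by presburger
qed

text \<open>
  The first vertex of \<open>S\<close> is ignored by \<open>R\<close>, so that \<open>R\<close> may run past it; it is a neighbour of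
  \<open>f v\<close>, and \<open>f v\<close> is next to the start of \<open>R\<close>.
\<close>
lemma next_path:
  assumes S: "jump C S (f v) (f (v + int l))"
    and R: "R \<noteq> []" "ipath R" "E (hd R) (f (v + 1))" "set R \<inter> C = {}" "set R \<inter> (B \<union> (set S - {hd S})) = {}"
    and att: "\<And>r i. r \<in> set R \<Longrightarrow> E r (f i) \<Longrightarrow>
      r = hd R \<and> f i = f (v + 1) \<or> r = last R \<and> f i \<notin> T3 f (v + 1)"
    and nadj: "\<And>r b. r \<in> set R \<Longrightarrow> r \<noteq> last R \<Longrightarrow> b \<in> B \<union> (set S - {hd S}) \<Longrightarrow> \<not> E r b"
    and dest: "(\<exists>b\<in>B \<union> (set S - {hd S}). E (last R) b) \<or> (\<exists>s. f s \<notin> T3 f (v + 1) \<and> E (last R) (f s))"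
  obtains (base) "\<exists>b\<in>B. E (last R) b"
  | (far) J where "jump C J (f (v + 1)) (f (v + int l))" "set J \<subseteq> set R \<union> set S"
  | (behind) s J where "f s \<notin> T3 f (v + 1)" "jump C R (f (v + 1)) (f s)" "jump C J (f s) (f v)" "set J \<subseteq> set R \<union> set S"
  | (apart) s where "f s \<notin> T3 f (v + 1)" "jump C R (f (v + 1)) (f s)"
      "set S \<inter> set R = {}" "\<And>p q. p \<in> set S \<Longrightarrow> q \<in> set R \<Longrightarrow> \<not> E p q"
proof (cases "\<exists>s. f s \<notin> T3 f (v + 1) \<and> E (last R) (f s)")
  case False
  have S': "S \<noteq> []" "ipath S" "set S \<inter> C = {}"
    and Satt: "\<And>z u. z \<in> set S \<Longrightarrow> u \<in> C \<Longrightarrow> E z u \<longleftrightarrow> z = hd S \<and> u = f v \<or> z = last S \<and> u = f (v + int l)"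
    using S unfolding jump_def by blast+
  from False dest consider "\<exists>b\<in>B. E (last R) b" | b where "b \<in> set S" "b \<noteq> hd S" "E (last R) b" by blast
  then show ?thesis
  proof cases
    case 1 then show ?thesis by (rule base)
  next
    case 2
    \<comment> \<open>Leaving out \<open>hd S\<close> removes the contact with \<open>f v\<close>.
      The rest of \<open>S\<close> and \<open>R\<close> touch the cycle only at \<open>v + 1\<close>
      and at the antipode of \<open>v\<close>.\<close>
    let ?X = "set R \<union> set (tl S)"
    have bt: "b \<in> set (tl S)" using 2 by (cases S) auto
    have dS: "distinct S" using ipath_distinct[OF S'(2)] .
    have "ipath (tl S)" using S'(2) by (cases S) auto
    then have "conn ?X"
      using conn_Un[OF conn_path[OF ipath_successively[OF R(2)]] conn_path[OF ipath_successively], of "tl S" "last R" b]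
        R(1) bt 2 by auto
    moreover have lS: "last S \<in> set (tl S)" using bt by (cases S) auto
    ultimately have jo: "joined ?X (hd R) (last S)" using R(1) by (auto simp: conn_def)
    have XC: "?X \<inter> C = {}" using R(4) S' by (cases S) auto
    have sub: "set (tl S) \<subseteq> set S - {hd S}" using dS S'(1) by (cases S) auto
    have "E p u \<longleftrightarrow> p = hd R \<and> u = f (v + 1) \<or> p = last S \<and> u = f (v + int l)" if p: "p \<in> ?X" and u: "u \<in> C" for p u
    proof (cases "p \<in> set R")
      case True
      from u obtain i where i: "u = f i" by blast
      have "p \<noteq> last S" using True R(5) lS sub by blast
      moreover have "E p u \<Longrightarrow> p = hd R \<and> u = f (v + 1)" using att[OF True, of i] i False by blast
      ultimately show ?thesis using R(3) by blast
    next
      case False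
      then have "p \<in> set S" "p \<noteq> hd S" "p \<noteq> hd R" using p sub R(1) by auto
      with Satt[OF _ u] show ?thesis by blast
    qed
    from jump_joined[OF jo XC rangeI rangeI this] obtain J where "jump C J (f (v + 1)) (f (v + int l))" "set J \<subseteq> ?X" by blast
    moreover from this have "set J \<subseteq> set R \<union> set S" using sub by blast
    ultimately show ?thesis using far by blast
  qed
next
  case True
  then obtain s where s: "f s \<notin> T3 f (v + 1)" "E (last R) (f s)" by blast
  have S': "S \<noteq> []" "ipath S" "set S \<inter> C = {}"
    and Satt: "\<And>z u. z \<in> set S \<Longrightarrow> u \<in> C \<Longrightarrow> E z u \<longleftrightarrow> z = hd S \<and> u = f v \<or> z = last S \<and> u = f (v + int l)"
    using S unfolding jump_def by blast+
  have dS: "distinct S" using ipath_distinct[OF S'(2)] .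
  have hS: "hd S \<in> set S" "last S \<in> set S" "hd S \<notin> C" "last S \<notin> C" using S' hd_in_set[of S] last_in_set[of S] by blast+
  have hR: "hd R \<in> set R" "last R \<in> set R" "hd R \<notin> C" "last R \<notin> C" using R hd_in_set[of R] last_in_set[of R] by blast+
  have JR: "jump C R (f (v + 1)) (f s)" using land_jump[OF R(1-4) att s(2)] .
  have Ratt: "E z u \<longleftrightarrow> z = hd R \<and> u = f (v + 1) \<or> z = last R \<and> u = f s" if "z \<in> set R" "u \<in> C" for z u
    using JR that unfolding jump_def by blast
  have hv: "E (hd S) (f v)" "E (last S) (f (v + int l))" using Satt hS by auto
  have neqR: "hd R \<noteq> last R" using uniq_attach[OF hR(4) s(2), of "v + 1"] R(3) s(1) by (auto simp: T3_def)
  have len: "2 \<le> length S" by (rule jump_length[OF S]) (use l5 in auto)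
  have neqS: "hd S \<noteq> last S" using len dS by (cases S) (auto split: if_splits)
  have hdS_R: "hd S \<notin> set R"
  proof
    assume "hd S \<in> set R"
    from att[OF this hv(1)] have "f v = f (v + 1) \<or> f v \<notin> T3 f (v + 1)" by blast
    then show False using hole_adj_Suc[OF f, of v] E_irrefl by (auto simp: T3_def)
  qed
  have SR: "set S \<inter> set R = {}" using R(5) hdS_R by blast
  \<comment> \<open>Leaving out \<open>hd R\<close> and \<open>last S\<close> keeps exactly the
    contacts \<open>f s\<close> and \<open>f v\<close>.\<close>
  have build: "\<exists>J. jump C J (f s) (f v) \<and> set J \<subseteq> X"
    if X: "conn X" "last R \<in> X" "hd S \<in> X" "X \<subseteq> set R \<union> set S" "hd R \<notin> X" "last S \<notin> X" for X
  proof -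
    have jo: "joined X (last R) (hd S)" using X(1-3) by (simp add: conn_def)
    have XC: "X \<inter> C = {}" using X(4) R(4) S'(3) by blast
    have "E p u \<longleftrightarrow> p = last R \<and> u = f s \<or> p = hd S \<and> u = f v" if p: "p \<in> X" and u: "u \<in> C" for p u
    proof (cases "p \<in> set R")
      case True
      then show ?thesis using Ratt[OF True u] p X(5) hdS_R by blast
    next
      case False
      then have "p \<in> set S" "p \<noteq> last R" using p X(4) hR(2) by auto
      then show ?thesis using Satt[OF _ u] p X(6) by blast
    qed
    from jump_joined[OF jo XC rangeI rangeI this] show ?thesis by blast
  qed
  show ?thesis
  proof (cases "\<exists>p\<in>set S. \<exists>q\<in>set R. E p q")
    case False
    then show ?thesis using apart[OF s(1) JR SR] by blast
  next
    case True
    then obtain p q where pq: "p \<in> set S" "q \<in> set R" "E p q" by blast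
    have "\<exists>J. jump C J (f s) (f v) \<and> set J \<subseteq> set R \<union> set S"
    proof (cases "q = last R")
      case True
      \<comment> \<open>The last vertex of \<open>R\<close> touches \<open>S\<close> before its end,
        so it can be joined to \<open>hd S\<close> inside \<open>S\<close> without
        \<open>last S\<close>.\<close>
      have pl: "p \<noteq> last S" using adjacent_attach[OF hS(4) hR(4) _ hv(2) s(2)] pq(3) True E_sym by blast
      obtain S1 where S1: "S = S1 @ [last S]" using S'(1) append_butlast_last_id by metis
      have S1': "S1 \<noteq> []" "hd S1 = hd S" "ipath S1" "last S \<notin> set S1"
        using S1 neqS S'(2) ipath_prefix dS by (metis append_Nil list.sel(1), metis append_Nil hd_append2 list.sel(1), metis, metis distinct_append disjoint_iff list.set_intros(1))
      have "p \<in> set S1" using pq(1) pl S1 by (metis in_set_conv_decomp_last rotate1.simps(2) set_ConsD set_rotate1)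
      then have c: "conn (insert (last R) (set S1))"
        using conn_insert[OF conn_path[OF ipath_successively[OF S1'(3)]], of p "last R"] pq(3) True by auto
      have "\<exists>J. jump C J (f s) (f v) \<and> set J \<subseteq> insert (last R) (set S1)"
      proof (rule build[OF c])
        show "hd S \<in> insert (last R) (set S1)" using S1' hd_in_set[of S1] by auto
        show sub: "insert (last R) (set S1) \<subseteq> set R \<union> set S" using S1 hR(2) by (metis Un_iff insert_subset set_append subsetI)
        show "hd R \<notin> insert (last R) (set S1)" using neqR SR hR(1) S1 by (metis UnI1 disjoint_iff insertE set_append)
        show "last S \<notin> insert (last R) (set S1)" using S1'(4) SR hR(2) hS(2) by (metis disjoint_iff insertE)
      qed simp
      moreover have "insert (last R) (set S1) \<subseteq> set R \<union> set S" using S1 hR(2) by (metis Un_iff insert_subset set_append subsetI)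
      ultimately show ?thesis by blast
    next
      case False
      then have ph: "p = hd S" using nadj[OF pq(2)] pq E_sym by blast
      have qh: "q \<noteq> hd R" using adjacent_attach[OF hS(3) hR(3) _ hv(1) R(3)] pq(3) ph E_sym by blast
      obtain R1 where R1: "R = hd R # R1" using R(1) by (cases R) auto
      have R1': "ipath R1" "q \<in> set R1" "hd R \<notin> set R1"
        using R(2) R1 pq(2) qh by (metis ipath.simps(2), metis set_ConsD, metis ipath.simps(2))
      have c: "conn (insert (hd S) (set R1))"
        using conn_insert[OF conn_path[OF ipath_successively[OF R1'(1)]] R1'(2), of "hd S"] pq(3) ph E_sym by blast
      have "\<exists>J. jump C J (f s) (f v) \<and> set J \<subseteq> insert (hd S) (set R1)"
      proof (rule build[OF c])
        show "last R \<in> insert (hd S) (set R1)" using R1 neqR hR(2) by (metis insertCI set_ConsD)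
        show "insert (hd S) (set R1) \<subseteq> set R \<union> set S" using R1 hS(1) by (metis Un_iff insert_subset set_subset_Cons subsetD subsetI)
        show "hd R \<notin> insert (hd S) (set R1)" using R1'(3) hdS_R hR(1) by auto
        show "last S \<notin> insert (hd S) (set R1)" using neqS SR hS(2) R1 by (metis disjoint_iff insertE set_subset_Cons subsetD)
      qed simp
      moreover have "insert (hd S) (set R1) \<subseteq> set R \<union> set S" using R1 hS(1) by (metis Un_iff insert_subset set_subset_Cons subsetD subsetI)
      ultimately show ?thesis by blast
    qed
    then show ?thesis using behind[OF s(1) JR] by blast
  qed
qed

text \<open>Here \<open>P\<close> has at least \<open>l\<close> inner vertices and \<open>Q\<close>
  at least \<open>l - 1\<close>. Wherever \<open>Q\<close> ends, two arcs can be chosen so that they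
  form a hole with \<open>P\<close> and \<open>Q\<close>; the two parities make it even, and it is
  longer than \<open>2l\<close>.\<close>

lemma far_odd:
  assumes P: "jump C P (f a) (f b)" "a + 3 \<le> b" "b \<le> a + int l - 1"
    and Q: "jump C Q (f c) (f s)" "a + int l + 1 \<le> c" "c \<le> a + int l + 2" "f s \<notin> T3 f c"
    and PQ: "set P \<inter> set Q = {}" "\<And>p q. p \<in> set P \<Longrightarrow> q \<in> set Q \<Longrightarrow> \<not> E p q"
    and odd: "odd (int (length Q) + 1 + (c - s))"
  shows False
proof -
  let ?n = "2 * int l"
  have per: "f (a + ?n) = f a" using hole_period[OF f] .
  have Podd: "odd (int (length P) + 1 + (b - a))" and Plen: "int l \<le> int (length P)"
    using jump_type(1,2)[OF P(1)] P(2,3) l5 by auto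
  obtain s' where s': "f s = f s'" "a + 1 \<le> s'" "s' < a + 1 + ?n" using hole_index[OF f] by blast
  have Q': "jump C Q (f c) (f s')" "f s' \<notin> T3 f c" using Q s' by auto
  have odd': "odd (int (length Q) + 1 + (c - s'))" using odd parity_index[OF s'(1)] by presburger
  have sc: "s' \<noteq> c" "s' \<noteq> c - 1" "s' \<noteq> c + 1"
    using Q'(2) T3_iff[of s' c] Q(2,3) s'(2,3) l5 by auto
  have Qr: "jump C (rev Q) (f s') (f c)" using jump_rev[OF Q'(1)] .
  have PQr: "set P \<inter> set (rev Q) = {}" "\<And>p q. p \<in> set P \<Longrightarrow> q \<in> set (rev Q) \<Longrightarrow> \<not> E p q"
    using PQ by auto
  have QPr1: "set (rev Q) \<inter> set (rev P) = {}" using PQ(1) by auto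
  have QPr2: "\<not> E q p" if "q \<in> set (rev Q)" "p \<in> set (rev P)" for q p
    using PQ(2)[of p q] that E_sym[of q p] by auto
  have Qlen: "int l \<le> int (length Q) + 1"
  proof (cases "s' < c")
    case True
    then show ?thesis using jump_type(2,3)[OF Qr] sc s' Q(2,3) l5 by simp
  next
    case False
    then show ?thesis using jump_type(2,3)[OF Q'(1)] sc s' Q(2,3) l5 by simp
  qed
  \<comment> \<open>\<open>k\<close> is the number of vertices on the two arcs. The parity condition
    relates it to the distances between the ends of the jumps.\<close>
  have concl: False if "icyc H" "int (length H) = int (length P) + int (length Q) + k" "even (k + (b - a) + (c - s'))" "2 \<le> k" for H k
  proof -
    have "even (int (length H))" unfolding that(2) using that(3) Podd odd' by presburger
    then have e: "even (length H)" by (simp only: even_of_nat)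
    have "int (length P) + int (length Q) + k = 2 * int l"
      using trans[OF sym[OF that(2)] hole_length[OF that(1) e]] .
    with Plen Qlen that(4) show False by presburger
  qed
  consider (low) "s' < b" | (mid) "b \<le> s'" "s' < c" | (high) "c < s'" using sc by linarith
  then show False
  proof cases
    case mid
    let ?H = "(map f [b..s'] @ rev Q) @ (map f [c..a + ?n] @ P)"
    have H: "icyc ?H" by (rule two_jumps_parallel[OF f P(1) Qr PQr]) (use mid sc P Q l5 in auto)
    show False
      by (rule concl[OF H, of "(s' - b + 1) + (a + ?n - c + 1)"]) (use mid Q l5 in auto)
  next
    case high
    let ?H = "(map f [b..c] @ Q) @ (map f [s'..a + ?n] @ P)"
    have H: "icyc ?H" by (rule two_jumps_parallel[OF f P(1) Q'(1) PQ]) (use high sc s' P Q l5 in auto)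
    show False
      by (rule concl[OF H, of "(c - b + 1) + (a + ?n - s' + 1)"]) (use high s' P Q l5 in auto)
  next
    case low
    show False
    proof (cases "s' + 2 \<le> b")
      case True
      let ?H = "(map f [a..s'] @ rev Q) @ rev (P @ map f [b..c])"
      have H: "icyc ?H" by (rule two_jumps_crossing[OF f P(1) Qr PQr]) (use True s' P Q l5 in auto)
      show False
        by (rule concl[OF H, of "(s' - a + 1) + (c - b + 1)"]) (use True s' P Q l5 in auto)
    next
      case False
      \<comment> \<open>Here \<open>s'\<close> is \<open>b - 1\<close>, too close to
        \<open>b\<close> for the previous pair of arcs. The other pair works because
        \<open>b\<close> is at least \<open>a + 3\<close>, so \<open>s'\<close> still has distance
        at least 2 from \<open>a\<close>.\<close>
      have Pr: "jump C (rev P) (f b) (f (a + ?n))" using jump_rev[OF P(1)] per by simp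
      let ?H = "(map f [s'..b] @ rev P) @ rev (rev Q @ map f [c..a + ?n])"
      have H: "icyc ?H" by (rule two_jumps_crossing[OF f Qr Pr QPr1 QPr2]) (use low False s' P Q l5 in auto)
      show False
        by (rule concl[OF H, of "(b - s' + 1) + (a + ?n - c + 1)"]) (use low False s' P Q l5 in auto)
    qed
  qed
qed

text \<open>Up to direction the ends have distance 2, distance 3 to \<open>l - 1\<close>, or
  distance \<open>l\<close>. The first case yields a long jump by
  \<open>short_jump_long_jump\<close>.\<close>

lemma no_long_jump_antipodal:
  assumes nl: "\<not> long_jump" and P: "jump C P (f x) (f y)" and y: "f y \<notin> T3 f x"
  shows "f y = f (x + int l)"
proof -
  let ?n = "2 * int l"
  obtain y' where y': "f y = f y'" "x \<le> y'" "y' < x + ?n" using hole_index[OF f] by blast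
  have per: "f (x + ?n) = f x" using hole_period[OF f] .
  have P': "jump C P (f x) (f y')" "jump C (rev P) (f y') (f (x + ?n))" using P y' jump_rev per by auto
  have yx: "y' \<noteq> x" "y' \<noteq> x + 1" "y' \<noteq> x + ?n - 1"
    using y y' T3_iff[of y' x] by auto
  have "\<not> (x + 3 \<le> y' \<and> y' \<le> x + int l - 1)" using nl P'(1) unfolding long_jump_def by blast
  moreover have "\<not> (y' + 3 \<le> x + ?n \<and> x + ?n \<le> y' + int l - 1)" using nl P'(2) unfolding long_jump_def by blast
  moreover have "y' \<noteq> x + 2" using nl short_jump_long_jump[of P x] P'(1) by auto
  moreover have "x + ?n \<noteq> y' + 2" using nl short_jump_long_jump[of "rev P" y'] P'(2) by metis
  ultimately have "y' = x + int l" using y' yx by linarith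
  with y' show ?thesis by simp
qed

text \<open>
  Otherwise there are antipodal jumps from three consecutive vertices, no two of which touch each
  other. By \<open>antipodal_pair\<close> their lengths would have pairwise different parities.
\<close>
lemma long_jump_exists: long_jump
proof (rule ccontr)
  assume nl: "\<not> long_jump"
  note anti = no_long_jump_antipodal[OF nl]
  have eqs: "f (int l) \<noteq> f (1 + int l)" "f 0 \<noteq> f (1 + int l + int l)" "f 0 \<noteq> f (2 + int l + int l)"
    "f (1 + int l) \<noteq> f (2 + int l)" "f (int l) \<noteq> f (2 + int l)" "f 1 \<noteq> f (2 + int l + int l)"
    "f 0 \<noteq> f (2 + int l)"
    using hole_eq[OF f] hole_period[OF f, of 1] hole_period[OF f, of 2] l5 by (auto simp: add.assoc)
  have T3s: "f (int l) \<notin> T3 f 1" "f 0 \<notin> T3 f (1 + int l)" "f 0 \<notin> T3 f 2" "f 0 \<notin> T3 f (2 + int l)"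
    "f (int l) \<notin> T3 f 2" "f (1 + int l) \<notin> T3 f 2" "f 1 \<notin> T3 f (2 + int l)"
    using l5 by (auto simp: T3_iff)
  obtain P0 s where s: "jump C P0 (f 0) (f s)" "f s \<notin> T3 f 0"
  proof -
    obtain R where R: "R \<noteq> []" "ipath R" "E (hd R) (f 0)" "set R \<inter> C = {}"
      and att: "\<And>r i. r \<in> set R \<Longrightarrow> E r (f i) \<Longrightarrow> r = hd R \<and> f i = f 0 \<or> r = last R \<and> f i \<notin> T3 f 0"
      and dest: "\<exists>s. f s \<notin> T3 f 0 \<and> E (last R) (f s)"
      by (rule leave[of "{}" 0]) auto
    from dest land_jump[OF R att] that show ?thesis by blast
  qed
  have J0: "jump C P0 (f 0) (f (int l))" using s anti[OF s] by simp
  have J0att: "E p u \<longleftrightarrow> p = hd P0 \<and> u = f 0 \<or> p = last P0 \<and> u = f (int l)" if "p \<in> set P0" "u \<in> C" for p u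
    using J0 that unfolding jump_def by blast
  have P0C: "set P0 \<inter> C = {}" "P0 \<noteq> []" "ipath P0" using J0 unfolding jump_def by auto
  \<comment> \<open>Every contact between the new path and \<open>P0\<close> would produce a jump
    between non-antipodal vertices, from \<open>f 1\<close> to \<open>f (int l)\<close> or from
    \<open>f (1 + int l)\<close> to \<open>f 0\<close>. Only the outcome \<open>apart\<close>
    remains.\<close>
  obtain P1 where J1: "jump C P1 (f 1) (f (1 + int l))"
    and P01: "set P0 \<inter> set P1 = {}" "\<And>p q. p \<in> set P0 \<Longrightarrow> q \<in> set P1 \<Longrightarrow> \<not> E p q"
  proof -
    obtain R where R: "R \<noteq> []" "ipath R" "E (hd R) (f 1)" "set R \<inter> C = {}" "set R \<inter> (set P0 - {hd P0}) = {}"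
      and att: "\<And>r i. r \<in> set R \<Longrightarrow> E r (f i) \<Longrightarrow> r = hd R \<and> f i = f 1 \<or> r = last R \<and> f i \<notin> T3 f 1"
      and nadj: "\<And>r b. r \<in> set R \<Longrightarrow> r \<noteq> last R \<Longrightarrow> b \<in> set P0 - {hd P0} \<Longrightarrow> \<not> E r b"
      and dest: "(\<exists>b\<in>set P0 - {hd P0}. E (last R) b) \<or> (\<exists>s. f s \<notin> T3 f 1 \<and> E (last R) (f s))"
    proof (rule leave[of "set P0 - {hd P0}" 1])
      show "(set P0 - {hd P0}) \<inter> C = {}" using P0C by blast
      show "\<not> E b (f 1)" if "b \<in> set P0 - {hd P0}" for b
        using J0att[of b "f 1"] that hole_eq[OF f, of 1 "int l"] l5 by auto
    qed blast
    have J0': "jump C P0 (f 0) (f (0 + int l))" using J0 by simp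
    show ?thesis
    proof (rule next_path[OF J0', of R "{}"])
      show "set R \<inter> ({} \<union> (set P0 - {hd P0})) = {}" using R(5) by simp
      fix J assume "jump C J (f (0 + 1)) (f (0 + int l))"
      then show ?thesis using anti[of J 1 "int l"] T3s eqs by simp
    next
      fix s J assume "f s \<notin> T3 f (0 + 1)" "jump C R (f (0 + 1)) (f s)" "jump C J (f s) (f 0)"
      then have "jump C J (f (1 + int l)) (f 0)" using anti[of R 1 s] by simp
      then show ?thesis using anti[of J "1 + int l" 0] T3s eqs by simp
    next
      fix s assume s: "f s \<notin> T3 f (0 + 1)" "jump C R (f (0 + 1)) (f s)"
        "set P0 \<inter> set R = {}" "\<And>p q. p \<in> set P0 \<Longrightarrow> q \<in> set R \<Longrightarrow> \<not> E p q"
      then have "jump C R (f 1) (f (1 + int l))" using anti[of R 1 s] by simp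
      then show ?thesis using that s(3,4) by blast
    qed (use R att nadj dest in simp_all)
  qed
  have J1att: "E p u \<longleftrightarrow> p = hd P1 \<and> u = f 1 \<or> p = last P1 \<and> u = f (1 + int l)" if "p \<in> set P1" "u \<in> C" for p u
    using J1 that unfolding jump_def by blast
  have P1C: "set P1 \<inter> C = {}" using J1 unfolding jump_def by auto
  have n2: "f 2 \<noteq> f 0" "f 2 \<noteq> f 1" "f 2 \<noteq> f (int l)" "f 2 \<noteq> f (1 + int l)"
    using hole_eq[OF f, of 2] l5 by auto
  let ?B = "set P0 \<union> (set P1 - {hd P1})"
  obtain R where R: "R \<noteq> []" "ipath R" "E (hd R) (f 2)" "set R \<inter> C = {}" "set R \<inter> ?B = {}"
    and att: "\<And>r i. r \<in> set R \<Longrightarrow> E r (f i) \<Longrightarrow> r = hd R \<and> f i = f 2 \<or> r = last R \<and> f i \<notin> T3 f 2"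
    and nadj: "\<And>r b. r \<in> set R \<Longrightarrow> r \<noteq> last R \<Longrightarrow> b \<in> ?B \<Longrightarrow> \<not> E r b"
    and dest: "(\<exists>b\<in>?B. E (last R) b) \<or> (\<exists>s. f s \<notin> T3 f 2 \<and> E (last R) (f s))"
  proof (rule leave[of ?B 2])
    show "?B \<inter> C = {}" using P0C P1C by blast
    show "\<not> E b (f 2)" if "b \<in> ?B" for b
      using J0att[of b "f 2"] J1att[of b "f 2"] that n2 by blast
  qed blast
  \<comment> \<open>Running into \<open>P0\<close> gives a jump to an end of \<open>P0\<close>, from
    \<open>f 2\<close> or from its antipode. No such pair of ends is antipodal.\<close>
  have base: False if hit: "\<exists>b\<in>set P0. E (last R) b"
  proof -
    obtain b where b: "b \<in> set P0" "E (last R) b" using hit by blast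
    have RP0: "set R \<inter> set P0 = {}" using R(5) by blast
    have lR: "last R \<in> set R" "last R \<notin> C" using R(1,4) last_in_set[of R] by blast+
    have rP: "jump C (rev P0) (f (int l)) (f 0)" using jump_rev[OF J0] .
    have len: "2 \<le> length P0" by (rule jump_length[OF J0]) (use l5 in auto)
    have neq0: "hd P0 \<noteq> last P0" using len ipath_distinct[OF P0C(3)] by (cases P0) (auto split: if_splits)
    show False
    proof (cases "\<exists>s. f s \<notin> T3 f 2 \<and> E (last R) (f s)")
      case True
      then obtain s where s: "f s \<notin> T3 f 2" "E (last R) (f s)" by blast
      have fs: "f s = f (2 + int l)" using anti[OF land_jump[OF R(1-4) att s(2)] s(1)] .
      have bl: "b \<noteq> last P0"
      proof
        assume "b = last P0"
        then have "E b (f (int l))" using J0att[OF b(1), of "f (int l)"] by simp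
        moreover have "b \<notin> C" using P0C(1) b(1) by blast
        ultimately show False using adjacent_attach[OF _ lR(2) b(2) _ s(2)] by blast
      qed
      have "\<exists>J. jump C J (f s) (f 0) \<and> set J \<subseteq> {last R} \<union> set P0"
      proof (rule hit_jump[OF J0 conn_single _ _ _ rangeI _ b(1) bl _ b(2)])
        fix p u assume p: "p \<in> {last R}" and "u \<in> C"
        then obtain i where "u = f i" by blast
        then show "E p u \<longleftrightarrow> p = last R \<and> u = f s"
          using p s(2) uniq_attach[OF lR(2) _ s(2), of i] by (metis singletonD)
      qed (use lR RP0 in \<open>simp_all add: disjoint_iff\<close>)
      then obtain J where "jump C J (f (2 + int l)) (f 0)" using fs by auto
      from anti[OF this T3s(4)] eqs(3) show False by blast
    next
      case False
      have ratt: "E p u \<longleftrightarrow> p = hd R \<and> u = f 2" if "p \<in> set R" "u \<in> C" for p u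
      proof -
        from that(2) obtain i where "u = f i" by blast
        then show ?thesis using att[OF that(1), of i] R(3) False by blast
      qed
      have cR: "conn (set R)" using conn_path[OF ipath_successively[OF R(2)]] .
      show False
      proof (cases "b = last P0")
        case False
        have "\<exists>J. jump C J (f 2) (f 0) \<and> set J \<subseteq> set R \<union> set P0"
          by (rule hit_jump[OF J0 cR R(4) RP0 _ rangeI ratt b(1) False lR(1) b(2)]) (use R(1) in auto)
        then obtain J where "jump C J (f 2) (f 0)" by blast
        from anti[OF this T3s(3)] eqs(7) show False by blast
      next
        case True
        then have "b \<noteq> last (rev P0)" using neq0 P0C(2) by (auto simp: last_rev)
        then have "\<exists>J. jump C J (f 2) (f (int l)) \<and> set J \<subseteq> set R \<union> set (rev P0)"
          by (intro hit_jump[OF rP cR R(4) _ _ rangeI ratt _ _ lR(1) b(2)]) (use R(1) RP0 b(1) in auto)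
        then obtain J where "jump C J (f 2) (f (int l))" by blast
        from anti[OF this T3s(5)] eqs(5) show False by blast
      qed
    qed
  qed
  have J1': "jump C P1 (f 1) (f (1 + int l))" by (rule J1)
  show False
  proof (rule next_path[OF J1', of R "set P0"])
    assume "\<exists>b\<in>set P0. E (last R) b"
    then show False by (rule base)
  next
    fix J assume "jump C J (f (1 + 1)) (f (1 + int l))"
    then show False using anti[of J 2 "1 + int l"] T3s eqs by simp
  next
    fix s J assume "f s \<notin> T3 f (1 + 1)" "jump C R (f (1 + 1)) (f s)" "jump C J (f s) (f 1)"
    then have "jump C J (f (2 + int l)) (f 1)" using anti[of R 2 s] by simp
    then show False using anti[of J "2 + int l" 1] T3s eqs by simp
  next
    fix s assume s: "f s \<notin> T3 f (1 + 1)" "jump C R (f (1 + 1)) (f s)"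
      "set P1 \<inter> set R = {}" "\<And>p q. p \<in> set P1 \<Longrightarrow> q \<in> set R \<Longrightarrow> \<not> E p q"
    then have J2: "jump C R (f 2) (f (2 + int l))" using anti[of R 2 s] by simp
    have P02: "set P0 \<inter> set R = {}" "\<And>p q. p \<in> set P0 \<Longrightarrow> q \<in> set R \<Longrightarrow> \<not> E p q"
      using R(5) nadj base E_sym by blast+
    have "odd (length P0 + length P1)" using antipodal_pair[of P0 0 P1 1] J0 J1 P01 by simp
    moreover have "odd (length P1 + length R)" using antipodal_pair[of P1 1 R 2] J2 J1 s(3,4) by simp
    moreover have "odd (length P0 + length R)" using antipodal_pair[of P0 0 R 2] J2 J0 P02 by simp
    ultimately show False by presburger
  qed (use R att nadj dest in simp_all)
qed

text \<open>Jumps from two consecutive vertices \<open>v\<close> and \<open>w\<close> stay clear of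
  the long jump \<open>P\<close> by \<open>no_detour\<close>. Then \<open>far_odd\<close> forces the
  even parity, and with it antipodal ends. So both lengths have the parity of \<open>l - 1\<close>,
  whereas \<open>antipodal_pair\<close> makes them differ in parity.\<close>

lemma absurd: False
proof -
  obtain P a b where P: "jump C P (f a) (f b)" "a + 3 \<le> b" "b \<le> a + int l - 1"
    using long_jump_exists unfolding long_jump_def by blast
  \<comment> \<open>These lie strictly between the antipodes of \<open>a\<close> and
    \<open>b\<close>, so neither is equal, adjacent or antipodal to an end of
    \<open>P\<close>.\<close>
  define v w where "v = a + int l + 1" and "w = a + int l + 2"
  have vw: "w = v + 1" by (simp add: v_def w_def)
  have PC: "set P \<inter> C = {}"
    and Patt: "\<And>z u. z \<in> set P \<Longrightarrow> u \<in> C \<Longrightarrow> E z u \<longleftrightarrow> z = hd P \<and> u = f a \<or> z = last P \<and> u = f b"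
    using P(1) unfolding jump_def by blast+
  have rel: "f c \<noteq> f a" "\<not> E (f c) (f a)" "f a \<noteq> f (c + int l)" "f c \<noteq> f b" "\<not> E (f c) (f b)" "f b \<noteq> f (c + int l)"
    if "c = v \<or> c = w" for c
  proof -
    have c: "a + int l + 1 \<le> c" "c \<le> a + int l + 2" using that by (auto simp: v_def w_def)
    have "f (c + int l) = f (c - int l)" using hole_period[OF f, of "c - int l"] by (simp add: algebra_simps)
    then show "f c \<noteq> f a" "\<not> E (f c) (f a)" "f a \<noteq> f (c + int l)" "f c \<noteq> f b" "\<not> E (f c) (f b)" "f b \<noteq> f (c + int l)"
      using c P l5 hole_eq[OF f, of c a] hole_adj[OF f, of c a] hole_eq[OF f, of c b] hole_adj[OF f, of c b]
        hole_eq[OF f, of a "c - int l"] hole_eq[OF f, of b "c - int l"] by auto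
  qed
  have ab: "f a \<noteq> f b" "\<not> E (f a) (f b)" "f b \<noteq> f (a + int l)"
    using P l5 hole_eq[OF f, of a b] hole_adj[OF f, of a b] hole_eq[OF f, of b "a + int l"] by auto
  have miss: False
    if c: "c = v \<or> c = w" and R: "R \<noteq> []" "ipath R" "E (hd R) (f c)" "set R \<inter> C = {}" "set R \<inter> set P = {}"
      and att: "\<And>r i. r \<in> set R \<Longrightarrow> E r (f i) \<Longrightarrow> r = hd R \<and> f i = f c \<or> r = last R \<and> f i \<notin> T3 f c"
      and nadj: "\<And>r b. r \<in> set R \<Longrightarrow> r \<noteq> last R \<Longrightarrow> b \<in> set P \<Longrightarrow> \<not> E r b"
      and hit: "\<exists>b\<in>set P. E (last R) b" for c R
  proof (rule no_detour[OF P(1) ab rel(1-3)[OF c] rel(4-6)[OF c] R(1,2,4,5,3) _ nadj hit])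
    fix r i assume "r \<in> set R" "E r (f i)"
    from att[OF this] show "r = hd R \<and> f i = f c \<or> r = last R \<and> f i \<noteq> f c" by (auto simp: T3_def)
  qed
  have far: "even (int (length Q) + 1 + (c - s))"
    if "jump C Q (f c) (f s)" "c = v \<or> c = w" "f s \<notin> T3 f c" "set P \<inter> set Q = {}"
      "\<And>p q. p \<in> set P \<Longrightarrow> q \<in> set Q \<Longrightarrow> \<not> E p q" for Q c s
  proof (rule ccontr)
    assume "\<not> ?thesis"
    from far_odd[OF P that(1) _ _ that(3-5) this] that(2) show False by (auto simp: v_def w_def)
  qed
  \<comment> \<open>A non-antipodal jump would have odd parity by \<open>jump_odd\<close>, which
    \<open>far\<close> rules out.\<close>
  have anti: "f s = f (c + int l)"
    if "jump C Q (f c) (f s)" "c = v \<or> c = w" "f s \<notin> T3 f c" "set P \<inter> set Q = {}"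
      "\<And>p q. p \<in> set P \<Longrightarrow> q \<in> set Q \<Longrightarrow> \<not> E p q" for Q c s
  proof (rule ccontr)
    assume "f s \<noteq> f (c + int l)"
    with jump_odd[OF that(1)] that(3) have "odd (int (length Q) + 1 + c - s)" by (auto simp: T3_adj)
    with far[OF that] show False by presburger
  qed
  obtain S where S: "jump C S (f v) (f (v + int l))" "set P \<inter> set S = {}"
    "\<And>p q. p \<in> set P \<Longrightarrow> q \<in> set S \<Longrightarrow> \<not> E p q"
  proof -
    obtain R where R: "R \<noteq> []" "ipath R" "E (hd R) (f v)" "set R \<inter> C = {}" "set R \<inter> set P = {}"
      and att: "\<And>r i. r \<in> set R \<Longrightarrow> E r (f i) \<Longrightarrow> r = hd R \<and> f i = f v \<or> r = last R \<and> f i \<notin> T3 f v"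
      and nadj: "\<And>r b. r \<in> set R \<Longrightarrow> r \<noteq> last R \<Longrightarrow> b \<in> set P \<Longrightarrow> \<not> E r b"
      and dest: "(\<exists>b\<in>set P. E (last R) b) \<or> (\<exists>s. f s \<notin> T3 f v \<and> E (last R) (f s))"
    proof (rule leave[of "set P" v])
      show "set P \<inter> C = {}" by (rule PC)
      show "\<not> E b (f v)" if "b \<in> set P" for b using Patt[OF that, of "f v"] rel[of v] by auto
    qed blast
    have mis: "\<not> (\<exists>b\<in>set P. E (last R) b)" using miss[OF _ R att nadj] by blast
    with dest obtain s where s: "f s \<notin> T3 f v" "E (last R) (f s)" by blast
    have J: "jump C R (f v) (f s)" using land_jump[OF R(1-4) att s(2)] .
    have PR: "set P \<inter> set R = {}" "\<And>p q. p \<in> set P \<Longrightarrow> q \<in> set R \<Longrightarrow> \<not> E p q"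
      using R(5) nadj mis E_sym by blast+
    have "f s = f (v + int l)" using anti[OF J _ s(1) PR] by simp
    with that J PR show ?thesis by metis
  qed
  have SC: "set S \<inter> C = {}"
    and Satt: "\<And>z u. z \<in> set S \<Longrightarrow> u \<in> C \<Longrightarrow> E z u \<longleftrightarrow> z = hd S \<and> u = f v \<or> z = last S \<and> u = f (v + int l)"
    using S(1) unfolding jump_def by blast+
  let ?B = "set P \<union> (set S - {hd S})"
  have neqw: "f w \<noteq> f v" "f w \<noteq> f (v + int l)"
    using hole_eq[OF f, of w v] hole_eq[OF f, of w "v + int l"] l5 vw by auto
  obtain R where R: "R \<noteq> []" "ipath R" "E (hd R) (f w)" "set R \<inter> C = {}" "set R \<inter> ?B = {}"
    and att: "\<And>r i. r \<in> set R \<Longrightarrow> E r (f i) \<Longrightarrow> r = hd R \<and> f i = f w \<or> r = last R \<and> f i \<notin> T3 f w"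
    and nadj: "\<And>r b. r \<in> set R \<Longrightarrow> r \<noteq> last R \<Longrightarrow> b \<in> ?B \<Longrightarrow> \<not> E r b"
    and dest: "(\<exists>b\<in>?B. E (last R) b) \<or> (\<exists>s. f s \<notin> T3 f w \<and> E (last R) (f s))"
  proof (rule leave[of ?B w])
    show "?B \<inter> C = {}" using PC SC by blast
    show "\<not> E b (f w)" if "b \<in> ?B" for b
      using Patt[of b "f w"] Satt[of b "f w"] that rel[of w] neqw by auto
  qed blast
  have RP: "set R \<inter> set P = {}" using R(5) by blast
  have mis: "\<not> (\<exists>b\<in>set P. E (last R) b)" using miss[OF _ R(1-4) RP att] nadj by blast
  have PR: "set P \<inter> set R = {}" "\<And>p q. p \<in> set P \<Longrightarrow> q \<in> set R \<Longrightarrow> \<not> E p q"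
    using RP nadj mis E_sym by blast+
  have sub: "set P \<inter> set J = {}" "\<And>p q. p \<in> set P \<Longrightarrow> q \<in> set J \<Longrightarrow> \<not> E p q"
    if "set J \<subseteq> set R \<union> set S" for J using that S(2,3) PR by blast+
  have T3s: "f (v + int l) \<notin> T3 f w" "f (w + int l) \<notin> T3 f v"
    using l5 vw by (auto simp: T3_iff)
  have neq: "f (v + int l) \<noteq> f (w + int l)" using hole_eq[OF f, of "v + int l" "w + int l"] l5 vw by auto
  show False
  proof (rule next_path[OF S(1), of R "set P"])
    assume "\<exists>b\<in>set P. E (last R) b"
    with mis show False ..
  next
    fix J assume "jump C J (f (v + 1)) (f (v + int l))" and J: "set J \<subseteq> set R \<union> set S"
    then show False using anti[of J w "v + int l", OF _ _ _ sub[OF J]] T3s neq vw by auto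
  next
    fix s J assume s: "f s \<notin> T3 f (v + 1)" "jump C R (f (v + 1)) (f s)"
      and J: "jump C J (f s) (f v)" "set J \<subseteq> set R \<union> set S"
    have "f s = f (w + int l)" using anti[of R w s, OF _ _ _ PR] s vw by simp
    then have "jump C (rev J) (f v) (f (w + int l))" using jump_rev[OF J(1)] by simp
    moreover have J': "set (rev J) \<subseteq> set R \<union> set S" using J(2) by simp
    ultimately show False using anti[of "rev J" v "w + int l", OF _ _ _ sub[OF J']] T3s neq by auto
  next
    fix s assume s: "f s \<notin> T3 f (v + 1)" "jump C R (f (v + 1)) (f s)"
      and SR: "set S \<inter> set R = {}" "\<And>p q. p \<in> set S \<Longrightarrow> q \<in> set R \<Longrightarrow> \<not> E p q"
    have "f s = f (w + int l)" using anti[of R w s, OF _ _ _ PR] s vw by simp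
    then have JR: "jump C R (f w) (f (w + int l))" using s(2) vw by simp
    have "f (w + int l) \<notin> T3 f w" "f (v + int l) \<notin> T3 f v" using l5 by (auto simp: T3_iff)
    then have "even (int (length R) + 1 - int l)" "even (int (length S) + 1 - int l)"
      using far[OF JR _ _ PR] far[OF S(1) _ _ S(2,3)] by auto
    moreover have "odd (length S + length R)" using antipodal_pair[OF S(1) JR SR] vw by simp
    ultimately show False by presburger
  qed (use R att nadj dest vw in simp_all)
qed

end

subsection \<open>Parts without even induced cycles\<close>

lemma card_insert_Suc: "finite A \<Longrightarrow> card A \<le> k \<Longrightarrow> card (insert x A) \<le> Suc k"
  by (simp add: card_insert_if)

locale even_free_part = long_even_hole_free +
  fixes t1 t2 t3 :: 'a and D :: "'a set"
  assumes T: "E t1 t2" "E t2 t3"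
    and D: "D \<subseteq> V - N {t1, t2, t3}" "D \<noteq> {}"
    and D_closed: "u \<in> D \<Longrightarrow> E u w \<Longrightarrow> w \<in> D \<or> w \<in> N {t1, t2, t3}"
    and D_star: "a \<in> D \<Longrightarrow> b \<in> D \<Longrightarrow> c \<in> D \<Longrightarrow> E a b \<Longrightarrow> E b c \<Longrightarrow> a \<noteq> c \<Longrightarrow> conn (V - N {a, b, c})"
    and D_odd: "icyc xs \<Longrightarrow> set xs \<subseteq> D \<Longrightarrow> odd (length xs)"
begin

section \<open>The boundary of the part and its interior\<close>

definition "TT = {t1, t2, t3}"
text \<open>Every edge leaving \<open>D\<close> ends in \<open>Z\<close>. Thus \<open>Y\<close> is
  the layer of \<open>D\<close> next to the boundary, and a cycle in \<open>D'\<close> has no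
  neighbours in \<open>Z\<close>.\<close>

definition "Z = N TT - TT"
definition "Y = {y \<in> D. \<exists>z\<in>Z. E y z}"
definition "D' = D - Y"

lemma T_conn: "conn TT"
  unfolding TT_def by (rule triple_conn[OF T])

lemma T_card: "finite TT" "card TT \<le> 3"
  by (auto simp: TT_def card_insert_if)

lemma D_T: "u \<in> D \<Longrightarrow> u \<notin> TT" "u \<in> D \<Longrightarrow> u \<notin> Z" "u \<in> D \<Longrightarrow> t \<in> TT \<Longrightarrow> \<not> E u t" "u \<in> D \<Longrightarrow> u \<in> V"
  using D(1) by (auto simp: TT_def[symmetric] N_def Z_def)

lemma D_nbr: "u \<in> D \<Longrightarrow> E u w \<Longrightarrow> w \<in> D \<or> w \<in> Z"
  using D_closed[of u w] D_T(3)[of u w] by (auto simp: TT_def[symmetric] Z_def)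

lemma Z_T: "z \<in> Z \<Longrightarrow> \<exists>t\<in>TT. E t z"
  by (auto simp: Z_def N_def E_commute)

lemma insert_Z:
  assumes "conn S" "TT \<subseteq> S" "z \<in> Z" shows "conn (insert z S)"
proof -
  obtain t where "t \<in> TT" "E t z" using Z_T[OF assms(3)] by blast
  with assms show ?thesis using conn_insert[of S t z] by blast
qed

text \<open>\<open>TT\<close> and a few vertices of \<open>Z\<close> and \<open>Y\<close> attached
  to it form a connected set with at most \<open>2 * l - 2\<close> vertices. This and the next two
  lemmas exclude the short cycles that a second connection would create.\<close>

lemma unique_Z:
  assumes "u \<in> D" "z \<in> Z" "z' \<in> Z" "E u z" "E u z'" shows "z = z'"
proof (rule small_conn)
  show "conn (insert z (insert z' TT))" using insert_Z T_conn assms by auto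
  show "card (insert z (insert z' TT)) \<le> 2 * l - 2"
    using T_card l5 by (auto simp: card_insert_if)
  show "u \<notin> insert z (insert z' TT)" using assms D_T[of u] by blast
qed (use assms T_card in auto)

lemma unique_Y:
  assumes "u \<in> D'" "y \<in> Y" "y' \<in> Y" "E u y" "E u y'" shows "y = y'"
proof -
  obtain z z' where z: "z \<in> Z" "z' \<in> Z" "E y z" "E y' z'" using assms by (auto simp: Y_def)
  show ?thesis
  proof (rule small_conn)
    have "conn (insert z (insert z' TT))" using insert_Z T_conn z by auto
    then show "conn (insert y (insert y' (insert z (insert z' TT))))"
      using z by (intro conn_insert[of _ z y] conn_insert[of _ z' y']) (auto intro: E_sym)
    show "card (insert y (insert y' (insert z (insert z' TT)))) \<le> 2 * l - 2"
      using T_card l5 by (auto simp: card_insert_if)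
    show "u \<notin> insert y (insert y' (insert z (insert z' TT)))" using assms z D_T[of u] by (auto simp: D'_def)
  qed (use assms T_card in auto)
qed

lemma Y_indep:
  assumes "y \<in> Y" "y' \<in> Y" shows "\<not> E y y'"
proof
  assume e: "E y y'"
  obtain z z' where z: "z \<in> Z" "z' \<in> Z" "E y z" "E y' z'" using assms by (auto simp: Y_def)
  have yD: "y \<in> D" "y' \<in> D" using assms by (auto simp: Y_def)
  have "y = z'"
  proof (rule small_conn)
    have "conn (insert z (insert z' TT))" using insert_Z T_conn z by auto
    then show "conn (insert y (insert z (insert z' TT)))"
      using z by (intro conn_insert[of _ z y]) (auto intro: E_sym)
    show "card (insert y (insert z (insert z' TT))) \<le> 2 * l - 2"
      using T_card l5 by (auto simp: card_insert_if)
    show "y' \<notin> insert y (insert z (insert z' TT))" using e E_irrefl z yD(2) D_T[of y'] by auto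
    show "E y' y" using e E_sym by blast
  qed (use z T_card in auto)
  then show False using z yD D_T by blast
qed

lemma D'_nbr: "u \<in> D' \<Longrightarrow> E u w \<Longrightarrow> w \<in> D"
  using D_nbr[of u w] by (auto simp: D'_def Y_def)

text \<open>A vertex of \<open>D'\<close> has no neighbour in \<open>Z\<close> and at most one in
  \<open>Y\<close>, so at least two of its three neighbours lie in \<open>D'\<close>.\<close>

lemma D'_deg:
  assumes u: "u \<in> D'" shows "\<exists>w\<in>D'. E u w \<and> w \<noteq> a"
proof (cases "\<exists>y\<in>Y. E u y")
  case True
  then obtain y where y: "y \<in> Y" "E u y" by blast
  obtain c where c: "E u c" "c \<noteq> a" "c \<noteq> y" using deg3[of u a y] u D_T by (auto simp: D'_def)
  then have "c \<in> D'" using D'_nbr[OF u] unique_Y[OF u _ y(1) _ y(2)] by (auto simp: D'_def)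
  with c show ?thesis by blast
next
  case False
  obtain c where c: "E u c" "c \<noteq> a" using deg3[of u a a] u D_T by (auto simp: D'_def)
  then have "c \<in> D'" using D'_nbr[OF u] False by (auto simp: D'_def)
  with c show ?thesis by blast
qed

text \<open>A vertex of \<open>Y\<close> has just one neighbour in \<open>Z\<close> and none in
  \<open>Y\<close>; its other neighbours lie in \<open>D'\<close>.\<close>

lemma D'_nonempty: "D' \<noteq> {}"
proof -
  obtain u where u: "u \<in> D" using D by blast
  show ?thesis
  proof (cases "u \<in> Y")
    case True
    then obtain z where z: "z \<in> Z" "E u z" by (auto simp: Y_def)
    obtain c where c: "E u c" "c \<noteq> z" using deg3[of u z z] u D_T by auto
    then have "c \<in> D" using D_nbr[OF u c(1)] unique_Z[OF u _ z(1) c(1) z(2)] by blast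
    moreover have "c \<notin> Y" using Y_indep[OF True] c by blast
    ultimately show ?thesis by (auto simp: D'_def)
  qed (use u in \<open>auto simp: D'_def\<close>)
qed

lemma shortest_hole:
  obtains xs where "icyc xs" "set xs \<subseteq> D'" "\<forall>ys. cyc ys \<and> set ys \<subseteq> D' \<longrightarrow> length xs \<le> length ys"
proof -
  have fD: "finite D'" using fin D(1) by (auto simp: D'_def intro: finite_subset)
  obtain zs where "cyc zs" "set zs \<subseteq> D'"
    by (rule cycle_exists[OF fD D'_nonempty D'_deg]) (assumption | rule that)+
  then have zs: "cyc zs \<and> set zs \<subseteq> D'" ..
  define xs where "xs = arg_min length (\<lambda>xs. cyc xs \<and> set xs \<subseteq> D')"
  have xs: "cyc xs \<and> set xs \<subseteq> D'" unfolding xs_def by (rule arg_min_natI[of "\<lambda>xs. cyc xs \<and> set xs \<subseteq> D'", OF zs])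
  have min: "length xs \<le> length ys" if "cyc ys" "set ys \<subseteq> D'" for ys
    unfolding xs_def by (rule arg_min_nat_le[of "\<lambda>xs. cyc xs \<and> set xs \<subseteq> D'"]) (use that in blast)
  have "icyc xs" by (rule shortest_cycle) (use xs min in auto)
  then show ?thesis by (rule that) (use xs min in auto)
qed

end

section \<open>A shortest odd hole in the interior and its legs\<close>

locale shortest_odd_hole = even_free_part +
  fixes g :: int and f :: "int \<Rightarrow> 'a"
  assumes f: "hole_fn g f" and g: "2 * int l + 1 \<le> g" "odd g"
    and fD: "range f \<subseteq> D'"
    and short: "cyc ys \<Longrightarrow> set ys \<subseteq> D' \<Longrightarrow> g \<le> int (length ys)"
begin

abbreviation "C \<equiv> range f"

lemma CD: "f i \<in> D" "f i \<notin> Y" "f i \<in> D'"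
  using fD by (auto simp: D'_def)

lemma C_Z: "z \<in> Z \<Longrightarrow> \<not> E z (f i)" "t \<in> TT \<Longrightarrow> \<not> E t (f i)" "z \<in> Z \<Longrightarrow> z \<notin> C" "t \<in> TT \<Longrightarrow> t \<notin> C"
  using CD D_T[of "f _"] E_sym by (fastforce simp: Y_def)+

text \<open>Each of the two arcs between the neighbours closes a cycle with \<open>u\<close> inside
  \<open>D'\<close>. By minimality of \<open>g\<close> each arc then leaves out fewer than two inner
  vertices, so \<open>g\<close> would be at most 4. Adjacent neighbours would give a
  triangle.\<close>

lemma uniq_attach:
  assumes u: "u \<in> D'" "u \<notin> C" and e: "E u (f i)" "E u (f j)"
  shows "f i = f j"
proof (rule ccontr)
  assume neq: "f i \<noteq> f j"
  obtain k where k: "f j = f k" "i \<le> k" "k < i + g" using hole_index[OF f] by blast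
  have ik: "i < k" using neq k by (cases "i = k") auto
  have per: "f (i + g) = f i" using hole_period[OF f] .
  have arc: "g \<le> b - a + 2" if "a < b" "b - a \<le> g - 2" "E u (f a)" "E u (f b)" for a b
  proof -
    have ip: "ipath (map f [a..b])" using arc_ipath[OF f] that by simp
    have "map f [a..b] \<noteq> []" using that by simp
    then have "cyc (u # map f [a..b])"
      unfolding cyc_def using that u ipath_distinct[OF ip] ipath_successively[OF ip] E_sym
      by (auto simp: successively_Cons hd_arc last_arc)
    moreover have "set (u # map f [a..b]) \<subseteq> D'" using u fD by auto
    ultimately have "g \<le> int (length (u # map f [a..b]))" by (rule short)
    then show ?thesis using that by simp
  qed
  have "k - i \<noteq> 1" "k - i \<noteq> g - 1"
    using no_triangle[of u "f i" "f k"] hole_adj[OF f, of i k] e k ik by auto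
  then have "g \<le> k - i + 2" "g \<le> i + g - k + 2"
    using arc[of i k] arc[of k "i + g"] e k ik per by auto
  then show False using g l5 by linarith
qed

text \<open>Since \<open>g\<close> is odd, exactly one of the two cycles through \<open>J\<close> is
  even, hence of length \<open>2l\<close>. If it used the longer arc, the other cycle would be
  shorter than the girth.\<close>

lemma jump_even:
  assumes J: "jump C J (f a) (f b)" and ab: "a + 2 \<le> b" "2 * (b - a) < g"
  shows "even (int (length J) + 1 + (b - a))"
proof (rule ccontr)
  assume odd: "\<not> ?thesis"
  have h1: "icyc (map f [a..b] @ rev J)" using jump_hole[OF f J] ab by simp
  have h2: "icyc (map f [b..a + g] @ J)" using jump_other_arc[OF f J] ab by simp
  have l1: "int (length (map f [a..b] @ rev J)) = b - a + 1 + int (length J)" using ab by simp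
  have l2: "int (length (map f [b..a + g] @ J)) = a + g - b + 1 + int (length J)" using ab by simp
  have "even (int (length (map f [b..a + g] @ J)))" unfolding l2 using odd g by presburger
  then have "length (map f [b..a + g] @ J) = 2 * l" using even_icyc[OF h2] by (simp only: even_of_nat)
  then have "a + g - b + 1 + int (length J) = 2 * int l" using l2 by linarith
  moreover have "int (2 * l) \<le> int (length (map f [a..b] @ rev J))"
    using icyc_ge[OF h1] by (simp only: of_nat_le_iff)
  then have "2 * int l \<le> b - a + 1 + int (length J)" unfolding l1 by simp
  ultimately show False using ab by presburger
qed

text \<open>Both cycles through \<open>J\<close> would lie in \<open>D\<close> and be odd, but their
  lengths differ in parity because \<open>g\<close> is odd.\<close>

lemma no_jump_in_D:
  assumes J: "jump C J (f a) (f b)" "set J \<subseteq> D" and ab: "f a \<noteq> f b" "\<not> E (f a) (f b)"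
  shows False
proof -
  obtain k where k: "f b = f k" "a \<le> k" "k < a + g" using hole_index[OF f] by blast
  have ak: "a + 2 \<le> k" "k \<le> a + g - 2"
    using ab k hole_adj[OF f, of a k] by (cases "k = a"; cases "k = a + 1"; cases "k = a + g - 1"; auto)+
  have J': "jump C J (f a) (f k)" using J k by simp
  have h1: "icyc (map f [a..k] @ rev J)" using jump_hole[OF f J'] ak by simp
  have h2: "icyc (map f [k..a + g] @ J)" using jump_other_arc[OF f J'] ak by simp
  have l1: "int (length (map f [a..k] @ rev J)) = k - a + 1 + int (length J)" using ak by simp
  have l2: "int (length (map f [k..a + g] @ J)) = a + g - k + 1 + int (length J)" using ak by simp
  have "odd (length (map f [a..k] @ rev J))" "odd (length (map f [k..a + g] @ J))"
    using D_odd[OF h1] D_odd[OF h2] J CD by auto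
  then have "odd (int (length (map f [a..k] @ rev J)))" "odd (int (length (map f [k..a + g] @ J)))"
    by (simp_all only: even_of_nat not_False_eq_True)
  then show False unfolding l1 l2 using g by presburger
qed

text \<open>A leg has to start in \<open>D'\<close>, since the uniqueness of the neighbour on
  \<open>C\<close> is known only there.\<close>

definition good :: "int \<Rightarrow> bool" where
  "good v \<longleftrightarrow> (\<exists>x. x \<in> D' \<and> x \<notin> C \<and> E (f v) x)"

text \<open>Otherwise both vertices have a neighbour in \<open>Y\<close>. Two routes through
  \<open>Z\<close> meet in \<open>TT\<close> and close a short cycle. The set used here has eight
  vertices, exactly \<open>2 * l - 2\<close> for \<open>l = 5\<close>.\<close>

lemma good_or_next: "good v \<or> good (v + 1)"
proof (rule ccontr)
  assume bad: "\<not> ?thesis"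
  have nb: "\<exists>x. x \<in> Y \<and> E (f u) x" if "\<not> good u" for u
  proof -
    obtain x where x: "E (f u) x" "x \<noteq> f (u - 1)" "x \<noteq> f (u + 1)" using deg3[of "f u"] CD D_T by blast
    have "x \<notin> C"
    proof
      assume "x \<in> C"
      then obtain i where i: "x = f i" by blast
      have "g dvd u - i - 1 \<or> g dvd i - u - 1" using x(1) i f by (simp add: hole_fn_def)
      then have "f i = f (u - 1) \<or> f i = f (u + 1)"
        using f dvd_minus_iff[of g "u - i - 1"] unfolding hole_fn_def by (auto simp: algebra_simps)
      with x i show False by blast
    qed
    moreover have "x \<in> D" using D'_nbr[OF CD(3) x(1)] .
    ultimately show ?thesis using that x(1) unfolding good_def D'_def by blast
  qed
  obtain x x' where x: "x \<in> Y" "E (f v) x" "x' \<in> Y" "E (f (v + 1)) x'" using nb bad by blast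
  obtain z z' where z: "z \<in> Z" "z' \<in> Z" "E x z" "E x' z'" using x by (auto simp: Y_def)
  have xD: "x \<in> D" "x' \<in> D" using x by (auto simp: Y_def)
  have neq: "f (v + 1) \<noteq> f v" using hole_adj_Suc[OF f, of v] E_irrefl by metis
  have "f v = x'"
  proof (rule small_conn)
    let ?S = "insert (f v) (insert x (insert x' (insert z (insert z' TT))))"
    have "conn (insert z (insert z' TT))" using insert_Z T_conn z by auto
    then have "conn (insert x (insert x' (insert z (insert z' TT))))"
      using z by (intro conn_insert[of _ z x] conn_insert[of _ z' x']) (auto intro: E_sym)
    then show "conn ?S" using x(2) E_sym by (intro conn_insert[of _ x "f v"]) auto
    have "card ?S \<le> Suc (Suc (Suc (Suc (Suc 3))))" by (intro card_insert_Suc) (use T_card in simp_all)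
    then show "card ?S \<le> 2 * l - 2" using l5 by linarith
    show "f (v + 1) \<notin> ?S" using neq x z CD(1,2)[of "v + 1"] D_T[of "f (v + 1)"] by auto
    show "E (f (v + 1)) (f v)" using hole_adj_Suc[OF f, of v] E_sym by blast
  qed (use x T_card in auto)
  then show False using x CD by auto
qed

text \<open>The boundary vertex \<open>z\<close> is not part of \<open>R\<close>. Legs may thus
  share their \<open>z\<close>.\<close>

definition leg :: "int \<Rightarrow> 'a list \<Rightarrow> 'a \<Rightarrow> bool" where
  "leg v R z \<longleftrightarrow> R \<noteq> [] \<and> ipath R \<and> set R \<subseteq> D \<and> set R \<inter> C = {} \<and> z \<in> Z
    \<and> (\<forall>r\<in>set R. \<forall>u\<in>C. E r u \<longleftrightarrow> r = hd R \<and> u = f v)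
    \<and> (\<forall>r\<in>set R. \<forall>y\<in>Z. E r y \<longleftrightarrow> r = last R \<and> y = z)"

lemma legD:
  assumes "leg v R z"
  shows "R \<noteq> []" "ipath R" "set R \<subseteq> D" "set R \<inter> C = {}" "z \<in> Z"
    and "r \<in> set R \<Longrightarrow> u \<in> C \<Longrightarrow> E r u \<longleftrightarrow> r = hd R \<and> u = f v"
    and "r \<in> set R \<Longrightarrow> y \<in> Z \<Longrightarrow> E r y \<longleftrightarrow> r = last R \<and> y = z"
proof -
  have 1: "\<forall>r\<in>set R. \<forall>u\<in>C. E r u \<longleftrightarrow> r = hd R \<and> u = f v"
    using assms unfolding leg_def by (elim conjE)
  have 2: "\<forall>r\<in>set R. \<forall>y\<in>Z. E r y \<longleftrightarrow> r = last R \<and> y = z"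
    using assms unfolding leg_def by (elim conjE)
  show "r \<in> set R \<Longrightarrow> u \<in> C \<Longrightarrow> E r u \<longleftrightarrow> r = hd R \<and> u = f v" by (rule 1[rule_format])
  show "r \<in> set R \<Longrightarrow> y \<in> Z \<Longrightarrow> E r y \<longleftrightarrow> r = last R \<and> y = z" by (rule 2[rule_format])
qed (use assms in \<open>simp_all add: leg_def\<close>)

lemma path_in_D: "successively E R \<Longrightarrow> hd R \<in> D \<Longrightarrow> set R \<inter> Z = {} \<Longrightarrow> set R \<subseteq> D"
proof (induction R)
  case (Cons r R)
  show ?case
  proof (cases "R = []")
    case False
    then have "hd R \<in> D" using Cons.prems D_nbr[of r "hd R"] hd_in_set[OF False] by (auto simp: successively_Cons disjoint_iff)
    with Cons False show ?thesis by (auto simp: successively_Cons)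
  qed (use Cons in auto)
qed simp

text \<open>\<open>approach\<close> with \<open>B\<close> as \<open>Z\<close> gives a path that
  reaches the boundary or returns to \<open>C\<close>. A return is refuted inside \<open>D\<close>,
  where all induced cycles are odd.\<close>

lemma good_leg:
  assumes "good v"
  obtains R z where "leg v R z"
proof -
  obtain x where x: "x \<in> D'" "x \<notin> C" "E x (f v)" using assms E_sym unfolding good_def by blast
  have T3D: "conn (V - N (T3 f v))"
    unfolding T3_def using hole_adj_Suc[OF f, of "v - 1"] hole_adj_Suc[OF f, of v] hole_eq[OF f, of "v - 1" "v + 1"] g l5 CD
    by (intro D_star) auto
  obtain R where R: "R \<noteq> []" "ipath R" "hd R = x" "set R \<inter> C = {}" "set R \<inter> Z = {}"
    and att: "\<And>r i. r \<in> set R \<Longrightarrow> E r (f i) \<Longrightarrow> r = x \<and> f i = f v \<or> r = last R \<and> f i \<notin> T3 f v"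
    and nadj: "\<And>r b. r \<in> set R \<Longrightarrow> r \<noteq> last R \<Longrightarrow> b \<in> Z \<Longrightarrow> \<not> E r b"
    and dest: "(\<exists>b\<in>Z. E (last R) b) \<or> (\<exists>i. f i \<notin> T3 f v \<and> E (last R) (f i))"
  proof (rule approach[OF f _ _ T3D x(2,3), of Z])
    show "7 \<le> g" using g l5 by simp
    show "C \<subseteq> V" using CD D_T by blast
    show "f i = f v" if "E x (f i)" for i using uniq_attach[OF x(1,2) that x(3)] .
    show "Z \<inter> C = {}" using C_Z by blast
    show "\<not> E b (f v)" if "b \<in> Z" for b using C_Z that by blast
  qed blast
  have RD: "set R \<subseteq> D" using path_in_D[OF ipath_successively[OF R(2)]] R x by (auto simp: D'_def)
  have none: "\<not> E (last R) (f i)" if i: "f i \<notin> T3 f v" for i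
  proof
    assume e: "E (last R) (f i)"
    have lR: "last R \<in> set R" "last R \<notin> C" using R(1,4) last_in_set[of R] by blast+
    have vT: "f v \<in> T3 f v" by (simp add: T3_def)
    have lx: "last R \<noteq> x" using uniq_attach[OF x(1,2) _ x(3), of i] e i vT by metis
    have lv: "\<not> E (last R) (f u)" if "f u \<in> T3 f v" for u using att[OF lR(1), of u] lx that by blast
    let ?A = "\<lambda>j. E (last R) (f j)"
    obtain k where k: "f i = f k" "v \<le> k" "k < v + g" using hole_index[OF f] by blast
    \<comment> \<open>The last vertex of \<open>R\<close> may lie in \<open>Y\<close>, so it may
      have several neighbours on \<open>C\<close>. Only the first and the last one after
      \<open>v\<close> matter.\<close>
    define K where "K = {j. v \<le> j \<and> j \<le> v + g \<and> ?A j}"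
    have K: "finite K" "k \<in> K" using k e by (auto simp: K_def intro: finite_subset[of _ "{v..v + g}"])
    define a b where "a = Min K" and "b = Max K"
    have aK: "a \<in> K" "b \<in> K" and ab: "a \<le> b" and amin: "\<And>j. j \<in> K \<Longrightarrow> a \<le> j" and bmax: "\<And>j. j \<in> K \<Longrightarrow> j \<le> b"
      using K by (auto simp: a_def b_def intro: Min_in Max_in) (meson K Max_ge Min_le order_trans)
    have notK: "v \<notin> K" "v + 1 \<notin> K" "v + g - 1 \<notin> K" "v + g \<notin> K"
      using lv[of v] lv[of "v + 1"] lv[of "v - 1"] hole_period[OF f, of v] hole_period[OF f, of "v - 1"]
      by (auto simp: K_def T3_def algebra_simps)
    have neq: "a \<noteq> v" "a \<noteq> v + 1" "b \<noteq> v + g" "b \<noteq> v + g - 1" using notK aK by blast+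
    have bd: "v + 2 \<le> a" "b \<le> v + g - 2" using neq aK unfolding K_def by auto
    have Aiff: "?A j \<longleftrightarrow> j \<in> K" if "v \<le> j" "j \<le> v + g" for j using that by (simp add: K_def)
    have ratt: "E r (f j) \<longleftrightarrow> r = x \<and> f j = f v \<or> r = last R \<and> ?A j" if "r \<in> set R" for r j
      using att[OF that, of j] x(3) by metis
    have h1: "icyc (map f [v..a] @ rev R)"
    proof (rule path_arc_hole[OF f])
      fix r j assume r: "r \<in> set R" and j: "v \<le> j" "j \<le> a"
      have "f j = f v \<longleftrightarrow> j = v" using hole_eq[OF f, of j v] j bd ab by auto
      moreover have "?A j \<longleftrightarrow> j = a" using Aiff[of j] amin[of j] aK j bd ab by auto
      ultimately show "E r (f j) \<longleftrightarrow> r = hd R \<and> j = v \<or> r = last R \<and> j = a" using ratt[OF r] R(3) by auto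
    qed (use R bd ab in auto)
    have h2: "icyc (map f [b..v + g] @ rev (rev R))"
    proof (rule path_arc_hole[OF f])
      fix r j assume r: "r \<in> set (rev R)" and j: "b \<le> j" "j \<le> v + g"
      have "f j = f v \<longleftrightarrow> j = v + g" using hole_eq[OF f, of j "v + g"] hole_period[OF f, of v] j bd ab by auto
      moreover have "?A j \<longleftrightarrow> j = b" using Aiff[of j] bmax[of j] aK j bd ab by auto
      ultimately show "E r (f j) \<longleftrightarrow> r = hd (rev R) \<and> j = b \<or> r = last (rev R) \<and> j = v + g"
        using ratt[of r] r R(1,3) by (auto simp: hd_rev last_rev)
    qed (use R bd ab in auto)
    have "odd (length (map f [v..a] @ rev R))" "odd (length (map f [b..v + g] @ rev (rev R)))"
      using D_odd[OF h1] D_odd[OF h2] RD CD by auto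
    then have "odd (int (length (map f [v..a] @ rev R)))" "odd (int (length (map f [b..v + g] @ rev (rev R))))"
      by (simp_all only: even_of_nat not_False_eq_True)
    moreover have "int (length (map f [v..a] @ rev R)) = a - v + 1 + int (length R)"
      "int (length (map f [b..v + g] @ rev (rev R))) = v + g - b + 1 + int (length R)" using bd ab by auto
    \<comment> \<open>The holes through \<open>R\<close> on the two sides of \<open>v\<close> are
      both odd, so the arc from \<open>b\<close> over \<open>v\<close> to \<open>a\<close> has even
      length.\<close>
    ultimately have par: "even (a + g - b)" by presburger
    then have "a \<noteq> b" using g(2) by auto
    then have "a < b" using ab by simp
    moreover have "b \<noteq> a + 1" using no_triangle[of "last R" "f a" "f b"] aK hole_adj_Suc[OF f, of a] by (auto simp: K_def)
    ultimately have ab2: "a + 2 \<le> b" by simp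
    \<comment> \<open>That arc and the single vertex \<open>last R\<close> form an even hole in
      \<open>D\<close>.\<close>
    have h3: "icyc (map f [b..a + g] @ rev [last R])"
    proof (rule path_arc_hole[OF f])
      fix r j assume r: "r \<in> set [last R]" and j: "b \<le> j" "j \<le> a + g"
      have "?A j \<longleftrightarrow> j = b \<or> j = a + g"
      proof (cases "j \<le> v + g")
        case True
        then show ?thesis using Aiff[of j] bmax[of j] aK j bd ab by auto
      next
        case False
        have "f j = f (j - g)" using hole_period[OF f, of "j - g"] by simp
        then show ?thesis using Aiff[of "j - g"] amin[of "j - g"] aK j bd ab False by auto
      qed
      then show "E r (f j) \<longleftrightarrow> r = hd [last R] \<and> j = b \<or> r = last [last R] \<and> j = a + g" using r by auto
    qed (use lR bd ab2 in auto)
    have "odd (length (map f [b..a + g] @ rev [last R]))" using D_odd[OF h3] RD CD lR by auto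
    then have "odd (int (length (map f [b..a + g] @ rev [last R])))" by (simp only: even_of_nat not_False_eq_True)
    moreover have "int (length (map f [b..a + g] @ rev [last R])) = a + g - b + 2" using bd ab by simp
    ultimately show False using par by presburger
  qed
  with dest obtain z where z: "z \<in> Z" "E (last R) z" by blast
  have "leg v R z"
    unfolding leg_def
  proof (intro conjI ballI)
    fix r u assume r: "r \<in> set R" and "u \<in> C"
    then obtain i where "u = f i" by blast
    then show "E r u \<longleftrightarrow> r = hd R \<and> u = f v" using att[OF r, of i] none x R(3) by blast
  next
    fix r y assume r: "r \<in> set R" and y: "y \<in> Z"
    show "E r y \<longleftrightarrow> r = last R \<and> y = z" using nadj[OF r _ y] unique_Z[of "last R" y z] z y r RD by blast
  qed (use R RD z in auto)
  then show ?thesis using that by blast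
qed

end

context shortest_odd_hole
begin

section \<open>Three legs and three jumps\<close>

text \<open>If the legs touched, their union would be connected with contacts to \<open>C\<close> at
  \<open>v\<close> and \<open>w\<close> only, and would contain a jump inside
  \<open>D\<close>.\<close>

lemma legs_apart:
  assumes R: "leg v R z" and R': "leg w R' z'" and vw: "f v \<noteq> f w" "\<not> E (f v) (f w)"
  shows "set R \<inter> set R' = {} \<and> (\<forall>p\<in>set R. \<forall>q\<in>set R'. \<not> E p q)"
proof (rule ccontr)
  assume "\<not> ?thesis"
  then obtain p q where pq: "p \<in> set R" "q \<in> set R'" "E p q \<or> p = q" by blast
  have 1: "R \<noteq> []" "ipath R" "set R \<subseteq> D" "set R \<inter> C = {}"
    and att1: "\<And>r u. r \<in> set R \<Longrightarrow> u \<in> C \<Longrightarrow> E r u \<longleftrightarrow> r = hd R \<and> u = f v"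
    by (fact legD[OF R])+
  have 2: "R' \<noteq> []" "ipath R'" "set R' \<subseteq> D" "set R' \<inter> C = {}"
    and att2: "\<And>r u. r \<in> set R' \<Longrightarrow> u \<in> C \<Longrightarrow> E r u \<longleftrightarrow> r = hd R' \<and> u = f w"
    by (fact legD[OF R'])+
  have h: "hd R \<in> set R" "hd R' \<in> set R'" using 1(1) 2(1) by auto
  have "conn (set R \<union> set R')"
    using conn_Un[OF conn_path[OF ipath_successively[OF 1(2)]] conn_path[OF ipath_successively[OF 2(2)]] pq] .
  then have jo: "joined (set R \<union> set R') (hd R) (hd R')" using h by (simp add: conn_def)
  have XC: "(set R \<union> set R') \<inter> C = {}" using 1(4) 2(4) by blast
  have hn: "hd R \<notin> set R'" "hd R' \<notin> set R"
    using att1[OF h(1), of "f v"] att2[of "hd R" "f v"] att2[OF h(2), of "f w"] att1[of "hd R'" "f w"] vw(1) by auto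
  have "E p u \<longleftrightarrow> p = hd R \<and> u = f v \<or> p = hd R' \<and> u = f w" if p: "p \<in> set R \<union> set R'" and u: "u \<in> C" for p u
  proof (cases "p \<in> set R")
    case True
    then have "p \<noteq> hd R'" using hn by blast
    with att1[OF True u] show ?thesis by blast
  next
    case False
    then have "p \<in> set R'" "p \<noteq> hd R" using p h by auto
    with att2[OF _ u] show ?thesis by blast
  qed
  from jump_joined[OF jo XC rangeI rangeI this] obtain J where "jump C J (f v) (f w)" "set J \<subseteq> set R \<union> set R'" by blast
  then show False using no_jump_in_D[of J v w] vw 1(3) 2(3) by blast
qed

lemma root_path:
  assumes z: "z1 \<in> Z" "z2 \<in> Z"
  obtains W where "W \<noteq> []" "ipath W" "hd W = z1" "last W = z2" "set W \<subseteq> {z1, z2} \<union> TT"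
proof -
  have "conn (insert z1 (insert z2 TT))" using insert_Z T_conn z by auto
  then have j: "joined ({z1, z2} \<union> TT) z1 z2" by (auto simp: conn_def)
  obtain W where "W \<noteq> []" "hd W = z1" "last W = z2" "set W \<subseteq> {z1, z2} \<union> TT" "ipath W"
    by (rule shortest_ipath[OF j, of "\<lambda>u. u = z2", OF refl]) (rule that)
  then show ?thesis by (intro that)
qed

text \<open>Three legs are joined through \<open>TT\<close> to a tripod with centre
  \<open>p\<close>. Its three pairs of legs are jumps, each with the parity of the shorter arc
  between its ends. In the sum every leg occurs twice, while the arcs add up to the odd number
  \<open>g\<close>.\<close>

lemma absurd: False
proof -
  define h where "h = (g - 1) div 2"
  have h: "g = 2 * h + 1" "5 \<le> h" using g l5 by (auto simp: h_def elim!: oddE)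
  \<comment> \<open>With one unit of slack at each vertex, the first two gaps lie between
    \<open>h - 2\<close> and \<open>h\<close>, and the third between 2 and 4. All are at least 2 and
    less than half of \<open>g\<close>.\<close>
  obtain v1 where v1: "v1 = 0 \<or> v1 = 1" "good v1" using good_or_next[of 0] by auto
  obtain v2 where v2: "v2 = h - 1 \<or> v2 = h" "good v2" using good_or_next[of "h - 1"] by auto
  obtain v3 where v3: "v3 = 2 * h - 2 \<or> v3 = 2 * h - 1" "good v3" using good_or_next[of "2 * h - 2"] by auto
  have gaps: "v1 + 2 \<le> v2" "2 * (v2 - v1) < g" "v2 + 2 \<le> v3" "2 * (v3 - v2) < g"
    "v3 + 2 \<le> v1 + g" "2 * (v1 + g - v3) < g" using v1(1) v2(1) v3(1) h by auto
  have far: "f v1 \<noteq> f v2" "\<not> E (f v1) (f v2)" "f v1 \<noteq> f v3" "\<not> E (f v1) (f v3)" "f v2 \<noteq> f v3" "\<not> E (f v2) (f v3)"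
    using gaps h hole_eq[OF f, of v1 v2] hole_adj[OF f, of v1 v2] hole_eq[OF f, of v1 v3] hole_adj[OF f, of v1 v3]
      hole_eq[OF f, of v2 v3] hole_adj[OF f, of v2 v3] by auto
  obtain R1 z1 where L1: "leg v1 R1 z1" using good_leg[OF v1(2)] .
  obtain R2 z2 where L2: "leg v2 R2 z2" using good_leg[OF v2(2)] .
  obtain R3 z3 where L3: "leg v3 R3 z3" using good_leg[OF v3(2)] .
  have ap12: "set R1 \<inter> set R2 = {}" "\<And>p q. p \<in> set R1 \<Longrightarrow> q \<in> set R2 \<Longrightarrow> \<not> E p q"
    using legs_apart[OF L1 L2 far(1,2)] by blast+
  have ap13: "set R1 \<inter> set R3 = {}" "\<And>p q. p \<in> set R1 \<Longrightarrow> q \<in> set R3 \<Longrightarrow> \<not> E p q"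
    using legs_apart[OF L1 L3 far(3,4)] by blast+
  have ap23: "set R2 \<inter> set R3 = {}" "\<And>p q. p \<in> set R2 \<Longrightarrow> q \<in> set R3 \<Longrightarrow> \<not> E p q"
    using legs_apart[OF L2 L3 far(5,6)] by blast+
  have R1: "R1 \<noteq> []" "ipath R1" "set R1 \<subseteq> D" "set R1 \<inter> C = {}" "z1 \<in> Z"
    and att1: "\<And>r u. r \<in> set R1 \<Longrightarrow> u \<in> C \<Longrightarrow> E r u \<longleftrightarrow> r = hd R1 \<and> u = f v1"
    and z1: "\<And>r y. r \<in> set R1 \<Longrightarrow> y \<in> Z \<Longrightarrow> E r y \<longleftrightarrow> r = last R1 \<and> y = z1"
    by (fact legD[OF L1])+
  have R2: "R2 \<noteq> []" "ipath R2" "set R2 \<subseteq> D" "set R2 \<inter> C = {}" "z2 \<in> Z"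
    and att2: "\<And>r u. r \<in> set R2 \<Longrightarrow> u \<in> C \<Longrightarrow> E r u \<longleftrightarrow> r = hd R2 \<and> u = f v2"
    and z2: "\<And>r y. r \<in> set R2 \<Longrightarrow> y \<in> Z \<Longrightarrow> E r y \<longleftrightarrow> r = last R2 \<and> y = z2"
    by (fact legD[OF L2])+
  have R3: "R3 \<noteq> []" "ipath R3" "set R3 \<subseteq> D" "set R3 \<inter> C = {}" "z3 \<in> Z"
    and att3: "\<And>r u. r \<in> set R3 \<Longrightarrow> u \<in> C \<Longrightarrow> E r u \<longleftrightarrow> r = hd R3 \<and> u = f v3"
    and z3: "\<And>r y. r \<in> set R3 \<Longrightarrow> y \<in> Z \<Longrightarrow> E r y \<longleftrightarrow> r = last R3 \<and> y = z3"
    by (fact legD[OF L3])+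
  have ZT_C: "\<not> E y u" if "y \<in> Z \<union> TT" "u \<in> C" for y u
    using that C_Z by blast
  have ZT_nC: "y \<notin> C" if "y \<in> Z \<union> TT" for y using that C_Z(3,4) by blast
  have ZT_D: "y \<notin> D" if "y \<in> Z \<union> TT" for y using that D_T by blast
  obtain W where W: "W \<noteq> []" "ipath W" "hd W = z1" "last W = z2" "set W \<subseteq> {z1, z2} \<union> TT"
    using root_path[OF R1(5) R2(5)] .
  have WZT: "set W \<subseteq> Z \<union> TT" using W(5) R1(5) R2(5) by blast
  have RW: "E r w \<longleftrightarrow> r = last R1 \<and> w = z1" if "r \<in> set R1" "w \<in> set W" for r w
    using that z1[OF that(1)] WZT D_T(3)[of r w] R1(3) R1(5) W(3) by blast
  have RW2: "E r w \<longleftrightarrow> r = last R2 \<and> w = z2" if "r \<in> set R2" "w \<in> set W" for r w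
    using that z2[OF that(1)] WZT D_T(3)[of r w] R2(3) R2(5) W(4) by blast
  let ?P = "R1 @ W @ rev R2"
  have disW: "set W \<inter> D = {}" using WZT ZT_D by blast
  have WR2: "E w r \<longleftrightarrow> w = last W \<and> r = last R2" if "w \<in> set W" "r \<in> set R2" for w r
    using RW2[OF that(2,1)] E_commute[of w r] W(4) by blast
  have ip2: "ipath (W @ rev R2)"
    using W(1,2) R2(1-3) WR2 disW by (subst ipath_append) (auto simp: hd_rev)
  have ipP: "ipath ?P"
  proof (subst ipath_append)
    have "hd (W @ rev R2) = z1" using W by simp
    moreover have "z1 \<notin> set R2" using R2(3) ZT_D R1(5) by blast
    ultimately show "ipath R1 \<and> ipath (W @ rev R2) \<and> set R1 \<inter> set (W @ rev R2) = {} \<and>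
      (\<forall>x\<in>set R1. \<forall>y\<in>set (W @ rev R2). E x y \<longleftrightarrow> x = last R1 \<and> y = hd (W @ rev R2))"
      using R1 ip2 ap12 RW disW by auto
  qed (use R1 W in auto)
  have hP: "hd ?P = hd R1" "last ?P = hd R2" using R1 R2 by (auto simp: last_rev)
  have hin: "hd R1 \<in> set R1" "hd R2 \<in> set R2" "hd R3 \<in> set R3" "last R3 \<in> set R3" using R1 R2 R3 by auto
  have JP: "jump C ?P (f v1) (f v2)"
    unfolding jump_def hP
  proof (intro conjI ballI)
    have "set W \<inter> C = {}" using WZT ZT_nC by blast
    then show "set ?P \<inter> C = {}" using R1(4) R2(4) by auto
    fix p u assume p: "p \<in> set ?P" and u: "u \<in> C"
    consider "p \<in> set R1" | "p \<in> set W" | "p \<in> set R2" using p by auto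
    then show "E p u \<longleftrightarrow> p = hd R1 \<and> u = f v1 \<or> p = hd R2 \<and> u = f v2"
    proof cases
      case 1
      then have "p \<noteq> hd R2" using hin ap12(1) by blast
      with att1[OF 1 u] show ?thesis by blast
    next
      case 2
      then have "p \<noteq> hd R1" "p \<noteq> hd R2" using hin disW R1(3) R2(3) by blast+
      with ZT_C[OF _ u, of p] 2 WZT show ?thesis by blast
    next
      case 3
      then have "p \<noteq> hd R1" using hin ap12(1) by blast
      with att2[OF 3 u] show ?thesis by blast
    qed
  qed (use R1 ipP in auto)
  let ?S = "insert (last R3) (insert z3 (insert z1 (insert z2 TT)))"
  have cS: "conn ?S"
  proof (rule conn_insert[of _ z3])
    show "conn (insert z3 (insert z1 (insert z2 TT)))"
      by (intro insert_Z T_conn) (use R1(5) R2(5) R3(5) in auto)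
    show "E z3 (last R3)" using z3[OF hin(4) R3(5)] E_sym by blast
  qed simp
  obtain t where t: "t \<in> TT" "E t z1" using Z_T[OF R1(5)] by blast
  \<comment> \<open>The third leg is continued until it first becomes adjacent to the connection
    \<open>W\<close> of the other two.\<close>
  define Tg where "Tg u \<longleftrightarrow> (\<exists>w\<in>set W. E u w)" for u
  have tg: "Tg t" unfolding Tg_def using t W(1,3) hd_in_set[of W] by auto
  have j: "joined ?S (last R3) t" using cS t by (auto simp: conn_def)
  obtain K where K: "K \<noteq> []" "hd K = last R3" "Tg (last K)" "set K \<subseteq> ?S" "ipath K"
    and nTg: "\<forall>u\<in>set K. u \<noteq> last K \<longrightarrow> \<not> Tg u"
    by (rule shortest_ipath[OF j, of Tg, OF tg]) (rule that)
  have lW: "last R3 \<notin> set W" using hin(4) R3(3) disW by blast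
  have dK: "distinct K" using ipath_distinct[OF K(5)] .
  have KW: "set K \<inter> set W = {}"
  proof -
    have "K ! k \<notin> set W" if k: "k < length K" for k
    proof (cases k)
      case 0
      then show ?thesis using K(1,2) lW by (simp add: hd_conv_nth)
    next
      case (Suc i)
      have "K ! i \<in> set K" "K ! i \<noteq> last K"
        using k Suc K(1) dK by (simp_all add: last_conv_nth nth_eq_iff_index_eq)
      then have "\<not> Tg (K ! i)" using nTg by blast
      moreover have "E (K ! i) (K ! k)" using ipath_nth[OF K(5), of i k] k Suc by auto
      ultimately show ?thesis unfolding Tg_def by blast
    qed
    then show ?thesis by (metis disjoint_iff in_set_conv_nth)
  qed
  have zW: "z1 \<in> set W" "z2 \<in> set W" using W by (metis hd_in_set, metis last_in_set)
  have Kel: "k = last R3 \<or> k \<in> Z \<union> TT \<and> k \<noteq> z1 \<and> k \<noteq> z2" if "k \<in> set K" for k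
    using that K(4) KW zW R3(5) by blast
  let ?R = "butlast R3 @ K"
  have R3eq: "R3 = butlast R3 @ [last R3]" using R3(1) by simp
  have l3: "last R3 \<notin> set (butlast R3)" using ipath_distinct[OF R3(2)] R3eq by (metis distinct_append disjoint_iff list.set_intros(1))
  have b3: "set (butlast R3) \<subseteq> set R3" by (auto dest: in_set_butlastD)
  have KD: "k \<notin> D" if "k \<in> set K" "k \<noteq> last R3" for k using Kel[OF that(1)] that(2) ZT_D by blast
  have b3ZT: "\<not> E r y" if "r \<in> set (butlast R3)" "y \<in> Z \<union> TT" for r y
    using that z3[of r y] l3 b3 D_T(3)[of r y] R3(3) by blast
  have ipR: "ipath ?R"
  proof (cases "butlast R3 = []")
    case False
    show ?thesis
    proof (subst ipath_append[OF False K(1)], intro conjI ballI)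
      have ip: "ipath (butlast R3 @ [last R3])" using R3(2) R3eq by simp
      show "ipath (butlast R3)" using ipath_prefix[OF ip] .
      show "set (butlast R3) \<inter> set K = {}" using l3 KD b3 R3(3) by blast
      fix r k assume r: "r \<in> set (butlast R3)" and k: "k \<in> set K"
      show "E r k \<longleftrightarrow> r = last (butlast R3) \<and> k = hd K"
      proof (cases "k = last R3")
        case True
        have "E r (last R3) \<longleftrightarrow> r = last (butlast R3)"
          using ip r False by (subst (asm) ipath_append) auto
        then show ?thesis using True K(2) by auto
      next
        case False
        then show ?thesis using b3ZT[OF r] Kel[OF k] K(2) by blast
      qed
    qed (rule K(5))
  qed (use K(5) in simp)
  have lastR: "last ?R = last K" "?R \<noteq> []" using K(1) by auto
  have hdR: "hd ?R = hd R3"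
  proof (cases "butlast R3 = []")
    case True
    then have "R3 = [last R3]" using R3eq by simp
    then show ?thesis using True K(2) by (metis append_Nil list.sel(1))
  next
    case False
    then show ?thesis by (subst (2) R3eq) simp
  qed
  have Rel: "r \<in> set R3 \<or> r \<in> Z \<union> TT \<and> r \<noteq> z1 \<and> r \<noteq> z2" if "r \<in> set ?R" for r
    using that b3 Kel hin(4) by auto
  have RC: "set ?R \<inter> C = {}" using Rel R3(4) ZT_nC by blast
  have attR: "E r u \<longleftrightarrow> r = hd ?R \<and> u = f v3" if r: "r \<in> set ?R" and u: "u \<in> C" for r u
  proof (cases "r \<in> set R3")
    case True
    then show ?thesis using att3[OF True u] hdR by simp
  next
    case False
    then have "r \<in> Z \<union> TT" "r \<noteq> hd R3" using Rel[OF r] hin by auto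
    then show ?thesis using ZT_C[OF _ u] hdR by simp
  qed
  have R12: "\<not> E r x" "r \<noteq> x" if r: "r \<in> set ?R" and x: "x \<in> set R1 \<union> set R2" for r x
  proof -
    have "\<not> E r x \<and> r \<noteq> x"
    proof (cases "r \<in> set R3")
      case True
      then show ?thesis using ap13 ap23 x E_sym by blast
    next
      case False
      then have r': "r \<in> Z \<union> TT" "r \<noteq> z1" "r \<noteq> z2" using Rel[OF r] by auto
      have xD: "x \<in> D" using x R1(3) R2(3) by blast
      have "\<not> E x r" using r' x z1[of x r] z2[of x r] D_T(3)[OF xD, of r] by blast
      then show ?thesis using E_sym ZT_D[OF r'(1)] xD by blast
    qed
    then show "\<not> E r x" "r \<noteq> x" by auto
  qed
  have RW': "set ?R \<inter> set W = {}" using KW b3 R3(3) disW by auto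
  have nR: "\<not> E r x" if "r \<in> set ?R" "r \<noteq> last ?R" "x \<in> set ?P" for r x
  proof (cases "x \<in> set W")
    case True
    show ?thesis
    proof (cases "r \<in> set K")
      case True
      then show ?thesis using nTg that(2) \<open>x \<in> set W\<close> lastR unfolding Tg_def by auto
    next
      case False
      then have "r \<in> set (butlast R3)" using that(1) by auto
      then show ?thesis using b3ZT[of r x] True WZT by blast
    qed
  next
    case False
    then show ?thesis using R12(1)[OF that(1)] that(3) by auto
  qed
  have RP: "set ?R \<inter> set ?P = {}" using RW' R12(2) by auto
  obtain p where p: "p \<in> set W" "E (last K) p" using K(3) unfolding Tg_def by blast
  \<comment> \<open>\<open>W\<close> has at most five vertices, so \<open>last K\<close> has a
    single neighbour in it. Therefore the tripod has a well-defined centre.\<close>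
  have pu: "w = p" if w: "w \<in> set W" "E (last K) w" for w
  proof (rule small_conn)
    show "conn (set W)" using conn_path[OF ipath_successively[OF W(2)]] .
    have "card (set W) \<le> card ({z1, z2} \<union> TT)" using W(5) T_card by (intro card_mono) auto
    also have "\<dots> = card (insert z1 (insert z2 TT))" by (simp add: insert_commute)
    also have "\<dots> \<le> Suc (Suc 3)" by (intro card_insert_Suc) (use T_card in simp_all)
    finally show "card (set W) \<le> 2 * l - 2" using l5 by linarith
    show "last K \<notin> set W" using KW last_in_set[OF K(1)] by blast
  qed (use w p in auto)
  obtain W1 W2 where Wp: "W = W1 @ p # W2" using p(1) by (auto simp: in_set_conv_decomp)
  let ?P1 = "R1 @ W1" and ?P2 = "W2 @ rev R2"
  have Peq: "?P = ?P1 @ p # ?P2" using Wp by simp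
  have revP: "rev ?P = rev ?P2 @ p # rev ?P1" using Wp by simp
  have dP: "distinct (?P1 @ p # ?P2)" using ipath_distinct[OF ipP] Peq by simp
  have only: "x = p" if "x \<in> set ?P" "E (last ?R) x" for x
    using that pu[of x] R12(1)[of "last ?R" x] lastR K(1) by auto
  have n1: "\<forall>x\<in>set ?P1. \<not> E (last ?R) x" using only dP Wp by auto
  have n2: "\<forall>x\<in>set (rev ?P2). \<not> E (last ?R) x" using only dP Wp by auto
  have pl: "E (last ?R) p" using p lastR by simp
  have J1: "jump C (?R @ p # rev ?P1) (f v3) (f v1)"
    by (rule branch[of C ?P1 p ?P2 "f v1" "f v2" ?R])
      (use JP Peq pl n1 R2(1) lastR(2) ipR RC RP attR nR in auto)
  have J2: "jump C (?R @ p # rev (rev ?P2)) (f v3) (f v2)"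
    by (rule branch[of C "rev ?P2" p "rev ?P1" "f v2" "f v1" ?R])
      (use jump_rev[OF JP] revP Wp pl n2 R1(1) lastR(2) ipR RC RP attR nR in auto)
  have per: "f (v1 + g) = f v1" using hole_period[OF f] .
  have e0: "even (int (length ?P) + 1 + (v2 - v1))" using jump_even[OF JP gaps(1,2)] .
  have e1: "even (int (length (?R @ p # rev ?P1)) + 1 + (v1 + g - v3))"
    using jump_even[of "?R @ p # rev ?P1" v3 "v1 + g"] J1 per gaps by simp
  have e2: "even (int (length (?R @ p # rev (rev ?P2))) + 1 + (v3 - v2))"
    using jump_even[OF jump_rev[OF J2] gaps(3,4)] unfolding length_rev[of "?R @ p # rev (rev ?P2)"] .
  have len: "int (length ?P) = int (length ?P1) + 1 + int (length ?P2)"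
    "int (length (?R @ p # rev ?P1)) = int (length ?R) + 1 + int (length ?P1)"
    "int (length (?R @ p # rev (rev ?P2))) = int (length ?R) + 1 + int (length ?P2)"
    using Wp by simp_all
  show False using e0 e1 e2 g(2) unfolding len by presburger
qed

end

lemma (in even_free_part) absurd: False
proof -
  obtain xs where xs: "icyc xs" "set xs \<subseteq> D'" and min: "\<forall>ys. cyc ys \<and> set ys \<subseteq> D' \<longrightarrow> length xs \<le> length ys"
    by (rule shortest_hole) (rule that)
  have "set xs \<subseteq> D" using xs(2) by (auto simp: D'_def)
  then have odd: "odd (length xs)" using D_odd xs by blast
  have len: "2 * l \<le> length xs" using icyc_ge[OF xs(1)] .
  then have "4 \<le> length xs" using l5 by linarith
  then obtain f where f: "hole_fn (int (length xs)) f" "range f = set xs" using icyc_hole_fn[OF xs(1)] by blast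
  have "length xs \<noteq> 2 * l" using odd by auto
  then have "shortest_odd_hole E V l t1 t2 t3 D (int (length xs)) f"
    using f xs(2) min odd len by unfold_locales auto
  then show False by (rule shortest_odd_hole.absurd)
qed

subsection \<open>Minimal fragments\<close>

locale counterexample = long_even_hole_free +
  assumes no_cut_vertex: "w \<in> V \<Longrightarrow> X \<subseteq> V - {w} \<Longrightarrow> X \<noteq> {} \<Longrightarrow>
      (\<And>x y. x \<in> X \<Longrightarrow> E x y \<Longrightarrow> y \<in> X \<or> y = w) \<Longrightarrow> X = V - {w}"
    and hole_exists: "\<exists>xs. icyc xs \<and> length xs = 2 * l"
begin

text \<open>Connectedness of the graph: a proper closed set would be everything but one vertex,
  which would then be isolated.\<close>

lemma closed_all:
  assumes X: "X \<subseteq> V" "X \<noteq> {}" and cl: "\<And>x y. x \<in> X \<Longrightarrow> E x y \<Longrightarrow> y \<in> X"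
  shows "X = V"
proof (rule ccontr)
  assume "X \<noteq> V"
  then obtain w where w: "w \<in> V" "w \<notin> X" using X by blast
  have "X = V - {w}" by (rule no_cut_vertex[OF w(1)]) (use X w cl in auto)
  moreover obtain c where "E w c" "c \<noteq> w" using deg3[OF w(1), of w w] by blast
  ultimately show False using cl[of c w] w E_V E_sym by blast
qed

text \<open>A nonempty proper union of components, not necessarily a single one. Components are
  among the competitors, so minimising the cardinality is enough.\<close>

definition fragment :: "'a \<Rightarrow> 'a \<Rightarrow> 'a \<Rightarrow> 'a set \<Rightarrow> bool" where
  "fragment a b c D \<longleftrightarrow> E a b \<and> E b c \<and> a \<noteq> c \<and> D \<noteq> {} \<and> D \<subseteq> V - N {a, b, c} \<and> D \<noteq> V - N {a, b, c}
     \<and> (\<forall>u\<in>D. \<forall>w. E u w \<longrightarrow> w \<in> D \<or> w \<in> N {a, b, c})"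

lemma component_fragment:
  assumes "E a b" "E b c" "a \<noteq> c" "y \<in> V - N {a, b, c}" "u \<in> V - N {a, b, c}" "u \<notin> component (V - N {a, b, c}) y"
  shows "fragment a b c (component (V - N {a, b, c}) y)"
proof -
  let ?X = "component (V - N {a, b, c}) y"
  have "y \<in> ?X" using assms(4) by (simp add: component_def joined_refl)
  moreover have "w \<in> ?X \<or> w \<in> N {a, b, c}" if "x \<in> ?X" "E x w" for x w
    using component_closed[OF that(1) _ that(2)] E_V[OF E_sym[OF that(2)]] by blast
  ultimately show ?thesis using assms component_sub unfolding fragment_def by blast
qed

lemma conn_or_fragment:
  assumes "E a b" "E b c" "a \<noteq> c"
  shows "conn (V - N {a, b, c}) \<or> (\<exists>D. fragment a b c D)"
proof (rule ccontr)
  assume n: "\<not> ?thesis"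
  then obtain x y where xy: "x \<in> V - N {a, b, c}" "y \<in> V - N {a, b, c}" "\<not> joined (V - N {a, b, c}) x y"
    by (auto simp: conn_def)
  then have "fragment a b c (component (V - N {a, b, c}) x)"
    using component_fragment[OF assms xy(1,2)] by (simp add: component_def)
  with n show False by blast
qed

text \<open>
  A component \<open>X\<close> of the complement of \<open>N {a, b, c}\<close> that misses \<open>t2\<close> lies outside \<open>D\<close>, by
  minimality of \<open>D\<close>. It is attached to common neighbours of \<open>{a, b, c}\<close> and \<open>{t1, t2, t3}\<close>;
  by the girth there is at most one of them, and it is a cut vertex.
\<close>
lemma small_fragment_conn:
  assumes D: "fragment t1 t2 t3 D"
    and min: "\<And>a b c X. fragment a b c X \<Longrightarrow> card D \<le> card X"
    and abc: "a \<in> D" "b \<in> D" "c \<in> D" "E a b" "E b c" "a \<noteq> c"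
  shows "conn (V - N {a, b, c})"
proof (rule ccontr)
  assume nc: "\<not> ?thesis"
  let ?T = "{t1, t2, t3}" and ?A = "{a, b, c}"
  have T: "E t1 t2" "E t2 t3" and DV: "D \<subseteq> V - N ?T"
    and Dcl: "\<And>u w. u \<in> D \<Longrightarrow> E u w \<Longrightarrow> w \<in> D \<or> w \<in> N ?T"
    using D unfolding fragment_def by blast+
  have TA: "t \<notin> N ?A" if t: "t \<in> ?T" for t
  proof -
    have "x \<noteq> t" "\<not> E t x" if "x \<in> ?A" for x
      using DV abc(1-3) t that E_sym[of t x] unfolding N_def by blast+
    then show ?thesis unfolding N_def by blast
  qed
  have TV: "?T \<subseteq> V" using T E_V E_sym by blast
  let ?S = "V - N ?A"
  obtain y where y: "y \<in> ?S" "\<not> joined ?S t2 y"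
  proof -
    obtain x y where "x \<in> ?S" "y \<in> ?S" "\<not> joined ?S x y" using nc by (auto simp: conn_def)
    then show ?thesis using that joined_trans joined_sym by meson
  qed
  define X where "X = component ?S y"
  have t2: "t2 \<in> ?S" "t2 \<notin> X" using TA[of t2] TV y(2) joined_sym by (auto simp: X_def component_def)
  have frX: "fragment a b c X"
    unfolding X_def by (rule component_fragment[OF abc(4-6) y(1) t2(1)]) (use t2 in \<open>simp add: X_def\<close>)
  have XS: "X \<subseteq> ?S" using component_sub by (simp add: X_def)
  have Xcl: "w \<in> X" if "u \<in> X" "w \<in> ?S" "E u w" for u w using component_closed that by (simp add: X_def)
  have XT: "t \<notin> X" if t: "t \<in> ?T" for t
    using t t2 Xcl[of t t2] T E_sym by blast
  have XNT: "X \<inter> N ?T = {}"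
  proof (rule ccontr)
    assume "X \<inter> N ?T \<noteq> {}"
    then obtain u t where u: "u \<in> X" "t \<in> ?T" "u = t \<or> E u t" by (auto simp: N_def)
    then have "t \<in> X" using Xcl[of u t] TA[of t] TV by blast
    with XT u show False by blast
  qed
  have XD: "X \<inter> D = {}"
  proof (rule ccontr)
    assume "X \<inter> D \<noteq> {}"
    then obtain d where d: "d \<in> X" "d \<in> D" by blast
    have "u \<in> D" if "u \<in> X" for u
    proof -
      have "joined X d u"
        using component_joined[of d ?S y] component_joined[of u ?S y] d that joined_sym joined_trans unfolding X_def by blast
      then show ?thesis by (rule joined_closed[OF _ d(2)]) (use Dcl XNT in blast)
    qed
    \<comment> \<open>Since \<open>a\<close> lies in \<open>D\<close>, this makes the inclusion
      strict, against the minimal choice of \<open>D\<close>.\<close>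
    moreover have "a \<notin> X" using XS by (auto simp: N_def)
    ultimately have "X \<subset> D" using abc(1) by blast
    moreover have "finite D" using DV fin by (auto intro: finite_subset)
    ultimately have "card X < card D" by (rule psubset_card_mono[rotated])
    with min[OF frX] show False by simp
  qed
  have out: "w \<in> N ?T \<and> w \<notin> ?T \<and> w \<notin> D \<and> (\<exists>x\<in>?A. E w x)" if u: "u \<in> X" "E u w" "w \<notin> X" for u w
  proof -
    have wV: "w \<in> V" using E_V E_sym u by blast
    then have wA: "w \<in> N ?A" using Xcl u by blast
    have wD: "w \<notin> D" using Dcl[of w u] E_sym u XD XNT by blast
    then obtain x where x: "x \<in> ?A" "E w x" using wA abc(1-3) by (auto simp: N_def)
    then have "w \<in> N ?T" using Dcl[of x w] wD E_sym abc(1-3) by blast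
    moreover have "w \<notin> ?T" using TA wA by blast
    ultimately show ?thesis using wD x by blast
  qed
  have one: "w = w'" if w: "w \<in> N ?T" "w \<notin> ?T" "w \<notin> D" "x \<in> ?A" "E w x"
    and w': "w' \<in> N ?T" "w' \<notin> ?T" "w' \<notin> D" "x' \<in> ?A" "E w' x'" for w w' x x'
  proof (rule ccontr)
    assume neq: "w \<noteq> w'"
    obtain t t' where t: "t \<in> ?T" "E w t" "t' \<in> ?T" "E w' t'" using w w' by (auto simp: N_def)
    \<comment> \<open>A second such vertex \<open>w'\<close> joins the two three-vertex paths to a
      connected set of at most seven vertices, in which \<open>w\<close> can have just one
      neighbour.\<close>
    have "t = x"
    proof (rule small_conn)
      have "conn (insert w' ?T)"
        by (rule conn_insert[OF triple_conn[OF T] t(3)]) (use t(4) E_sym in blast)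
      then show "conn (insert w' ?T \<union> ?A)"
        using triple_conn[OF abc(4,5)] w' by (intro conn_Un[of _ _ w' x']) auto
      have "insert w' ?T \<union> ?A = insert w' (insert t1 (insert t2 (insert t3 (insert a (insert b (insert c {}))))))"
        by blast
      also have "card \<dots> \<le> Suc (Suc (Suc (Suc (Suc (Suc (Suc 0))))))"
        by (intro card_insert_Suc) simp_all
      finally show "card (insert w' ?T \<union> ?A) \<le> 2 * l - 2" using l5 by linarith
      show "w \<notin> insert w' ?T \<union> ?A" using neq w abc(1-3) by blast
    qed (use t w in auto)
    then show False using TA[OF t(1)] w(4) by (auto simp: N_def)
  qed
  show False
  proof (cases "\<exists>u w. u \<in> X \<and> E u w \<and> w \<notin> X")
    case False
    have "X = V" by (rule closed_all) (use XS frX False in \<open>auto simp: fragment_def\<close>)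
    then show False using t2 by blast
  next
    case True
    then obtain u w where uw: "u \<in> X" "E u w" "w \<notin> X" by blast
    obtain x where x: "w \<in> N ?T" "w \<notin> ?T" "w \<notin> D" "x \<in> ?A" "E w x" using out[OF uw] by blast
    have "X = V - {w}"
    proof (rule no_cut_vertex)
      show "w \<in> V" using E_V E_sym uw by blast
      show "X \<subseteq> V - {w}" using XS uw by blast
      show "X \<noteq> {}" using uw by blast
      show "y \<in> X \<or> y = w" if "z \<in> X" "E z y" for z y
        using out[OF that] one[OF x] by blast
    qed
    then show False using t2 x(2) by blast
  qed
qed

lemma absurd: False
proof -
  \<comment> \<open>\<open>S\<close> will be all of \<open>V\<close> if there is no fragment, and
    the minimal fragment otherwise.\<close>
  have even_case: False
    if xs: "icyc xs" "length xs = 2 * l" "set xs \<subseteq> S" "S \<subseteq> V"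
      and star: "\<And>a b c. a \<in> S \<Longrightarrow> b \<in> S \<Longrightarrow> c \<in> S \<Longrightarrow> E a b \<Longrightarrow> E b c \<Longrightarrow> a \<noteq> c \<Longrightarrow> conn (V - N {a, b, c})" for xs S
  proof -
    have "4 \<le> length xs" using xs(2) l5 by simp
    then obtain f where f: "hole_fn (int (length xs)) f" "range f = set xs" using icyc_hole_fn[OF xs(1)] by blast
    have f2: "hole_fn (2 * int l) f" using f(1) xs(2) by simp
    have "conn (V - N (T3 f v))" for v
      unfolding T3_def
      using hole_adj_Suc[OF f2, of "v - 1"] hole_adj_Suc[OF f2, of v] hole_eq[OF f2, of "v - 1" "v + 1"] l5 f(2) xs(3)
      by (intro star) auto
    then have "even_cycle_case E V l f"
      using f2 f(2) xs(3,4) by unfold_locales auto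
    then show False by (rule even_cycle_case.absurd)
  qed
  show False
  proof (cases "\<exists>a b c D. fragment a b c D")
    case False
    obtain xs where xs: "icyc xs" "length xs = 2 * l" using hole_exists by blast
    have "cyc xs" using icyc_cyc[OF xs(1)] .
    have "set xs \<subseteq> V"
    proof
      fix x assume "x \<in> set xs"
      then obtain as bs where d: "xs = as @ x # bs" by (auto simp: in_set_conv_decomp)
      have "E x (hd bs)" if "bs \<noteq> []"
        using \<open>cyc xs\<close> d that by (auto simp: cyc_def successively_append_iff successively_Cons)
      moreover have "E x (hd xs)" if "bs = []" using \<open>cyc xs\<close> d that by (simp add: cyc_def)
      ultimately show "x \<in> V" using E_V by blast
    qed
    then show False
      by (rule even_case[OF xs]) (use conn_or_fragment False in blast)+
  next
    case True
    define M where "M = (LEAST k. \<exists>a b c D. fragment a b c D \<and> card D = k)"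
    have "\<exists>a b c D. fragment a b c D \<and> card D = M"
      unfolding M_def by (rule LeastI_ex) (use True in blast)
    then obtain t1 t2 t3 D where D: "fragment t1 t2 t3 D" "card D = M" by blast
    have min: "card D \<le> card X" if "fragment a b c X" for a b c X
      unfolding D(2) M_def by (rule Least_le) (use that in blast)
    have star: "conn (V - N {a, b, c})"
      if "a \<in> D" "b \<in> D" "c \<in> D" "E a b" "E b c" "a \<noteq> c" for a b c
      using small_fragment_conn[OF D(1) min that] .
    have DV: "D \<subseteq> V" using D(1) by (auto simp: fragment_def)
    show False
    proof (cases "\<exists>xs. icyc xs \<and> set xs \<subseteq> D \<and> even (length xs)")
      case True
      then obtain xs where "icyc xs" "set xs \<subseteq> D" "even (length xs)" by blast
      then show False using even_case[OF _ even_icyc _ DV star] by blast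
    next
      case False
      have "even_free_part E V l t1 t2 t3 D"
        using D(1) star False by unfold_locales (auto simp: fragment_def)
      then show False by (rule even_free_part.absurd)
    qed
  qed
qed

end

subsection \<open>Vertex lists and arc walks\<close>

context graph
begin

lemma simple_graph: "simple_graph (dominates G)"
proof
  show "v \<rightarrow>\<^bsub>G\<^esub> u" if "u \<rightarrow>\<^bsub>G\<^esub> v" for u v
    using arcs_ends_symmetric[OF sym_arcs that] .
  show "\<not> u \<rightarrow>\<^bsub>G\<^esub> u" for u
    using no_loops by (auto simp: arcs_ends_conv)
qed

sublocale simple_graph "dominates G" by (rule simple_graph)

text \<open>There are no parallel arcs, so the choice is unique whenever the two vertices are
  adjacent.\<close>

definition arc_of :: "'a \<Rightarrow> 'a \<Rightarrow> 'b" where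
  "arc_of u v = (SOME e. e \<in> arcs G \<and> tail G e = u \<and> head G e = v)"

fun walk_arcs :: "'a list \<Rightarrow> 'b list" where
  "walk_arcs (x # y # xs) = arc_of x y # walk_arcs (y # xs)"
| "walk_arcs xs = []"

lemma arc_of:
  assumes "u \<rightarrow>\<^bsub>G\<^esub> v"
  shows "arc_of u v \<in> arcs G" "tail G (arc_of u v) = u" "head G (arc_of u v) = v"
proof -
  have "\<exists>e. e \<in> arcs G \<and> tail G e = u \<and> head G e = v"
    using assms by (auto simp: arcs_ends_conv)
  from someI_ex[OF this]
  show "arc_of u v \<in> arcs G" "tail G (arc_of u v) = u" "head G (arc_of u v) = v"
    by (auto simp: arc_of_def)
qed

lemma dominates_verts: "u \<rightarrow>\<^bsub>G\<^esub> v \<Longrightarrow> u \<in> verts G \<and> v \<in> verts G"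
  by (auto simp: arcs_ends_conv)

lemma walk_arcs:
  assumes "successively (dominates G) xs" "2 \<le> length xs"
  shows "awalk (hd xs) (walk_arcs xs) (last xs)" "awalk_verts (hd xs) (walk_arcs xs) = xs"
    "length (walk_arcs xs) = length xs - 1"
    "arc_to_ends G ` set (walk_arcs xs) = set (zip xs (tl xs))"
proof -
  have "awalk (hd xs) (walk_arcs xs) (last xs) \<and> awalk_verts (hd xs) (walk_arcs xs) = xs
    \<and> length (walk_arcs xs) = length xs - 1 \<and> arc_to_ends G ` set (walk_arcs xs) = set (zip xs (tl xs))"
    using assms
  proof (induction xs rule: walk_arcs.induct)
    case (1 x y xs)
    then have e: "x \<rightarrow>\<^bsub>G\<^esub> y" by simp
    show ?case
    proof (cases "xs = []")
      case True
      then show ?thesis using arc_of[OF e] dominates_verts[OF e]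
        by (auto simp: awalk_Cons_iff awalk_Nil_iff arc_to_ends_def)
    next
      case False
      then have "2 \<le> length (y # xs)" by (cases xs) auto
      with 1 have "awalk y (walk_arcs (y # xs)) (last (y # xs)) \<and> awalk_verts y (walk_arcs (y # xs)) = y # xs
        \<and> length (walk_arcs (y # xs)) = length xs \<and> arc_to_ends G ` set (walk_arcs (y # xs)) = set (zip (y # xs) xs)"
        by simp
      then show ?thesis using arc_of[OF e] False
        by (auto simp: awalk_Cons_iff arc_to_ends_def)
    qed
  qed simp_all
  then show "awalk (hd xs) (walk_arcs xs) (last xs)" "awalk_verts (hd xs) (walk_arcs xs) = xs"
    "length (walk_arcs xs) = length xs - 1"
    "arc_to_ends G ` set (walk_arcs xs) = set (zip xs (tl xs))" by blast+
qed

definition cycle_arcs :: "'a list \<Rightarrow> 'b list" where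
  "cycle_arcs xs = walk_arcs (xs @ [hd xs])"

lemma cycle_arcs:
  assumes "cyc xs"
  shows "graph_cycle G (cycle_arcs xs)" "length (cycle_arcs xs) = length xs"
    "cycle_verts G (cycle_arcs xs) = set xs"
    "arc_to_ends G ` set (cycle_arcs xs) = set (zip (xs @ [hd xs]) (tl xs @ [hd xs]))"
proof -
  let ?ys = "xs @ [hd xs]"
  have xs: "xs \<noteq> []" "distinct xs" "3 \<le> length xs" using assms by (auto simp: cyc_def)
  have s: "successively (dominates G) ?ys" using assms xs by (auto simp: cyc_def successively_append_iff)
  have ys: "2 \<le> length ?ys" "hd ?ys = hd xs" "last ?ys = hd xs" "tl ?ys = tl xs @ [hd xs]" using xs by auto
  note w = walk_arcs[OF s ys(1), unfolded ys(2-4), folded cycle_arcs_def]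
  show len: "length (cycle_arcs xs) = length xs" using w(3) by simp
  have "distinct (tl xs @ [hd xs])" using xs by (cases xs) auto
  moreover have "cycle_arcs xs \<noteq> []" using len xs by auto
  ultimately show "graph_cycle G (cycle_arcs xs)"
    unfolding graph_cycle_def cycle_def using w(1,2) ys(4) len xs by auto
  have "map (tail G) (cycle_arcs xs) = xs"
    using w(2) \<open>cycle_arcs xs \<noteq> []\<close> by (simp add: awalk_verts_conv)
  then show "cycle_verts G (cycle_arcs xs) = set xs" unfolding cycle_verts_def by (metis set_map)
  show "arc_to_ends G ` set (cycle_arcs xs) = set (zip ?ys (tl xs @ [hd xs]))" by (rule w(4))
qed

lemma awalk_successively: "awalk u p v \<Longrightarrow> successively (dominates G) (awalk_verts u p)"
proof (induction p arbitrary: u)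
  case (Cons e p)
  then have e: "e \<in> arcs G" "u = tail G e" and p: "awalk (head G e) p v" by (auto simp: awalk_Cons_iff)
  have "hd (awalk_verts (head G e) p) = head G e" using p by (cases p) (auto simp: awalk_Cons_iff)
  moreover have "tail G e \<rightarrow>\<^bsub>G\<^esub> head G e" using e by (auto simp: arcs_ends_conv)
  ultimately show ?case using Cons.IH[OF p] by (simp add: successively_Cons)
qed simp

lemma cycle_cyc:
  assumes "graph_cycle G p"
  obtains xs where "cyc xs" "length xs = length p"
proof -
  obtain u where u: "awalk u p u" "distinct (tl (awalk_verts u p))" "3 \<le> length p"
    using assms by (auto simp: graph_cycle_def cycle_def)
  \<comment> \<open>The vertex list of a closed walk contains its base point at both ends; one copy
    is dropped.\<close>
  define xs where "xs = butlast (awalk_verts u p)"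
  have l: "hd (awalk_verts u p) = u" "last (awalk_verts u p) = u"
    using u(1) by (auto simp: awalk_def awhd_if_cas awlast_if_cas)
  have len: "length (awalk_verts u p) = Suc (length p)" by (rule length_awalk_verts)
  have eq: "awalk_verts u p = xs @ [u]" using l(2) by (metis append_butlast_last_id awalk_verts_non_Nil xs_def)
  have lx: "length xs = length p" using len by (simp add: xs_def)
  then have x0: "xs \<noteq> []" using u(3) by auto
  then have hx: "hd xs = u" using l(1) eq by simp
  have "distinct (tl xs @ [u])" using u(2) eq x0 by simp
  then have "distinct xs" using x0 hx by (cases xs) auto
  moreover have "successively (dominates G) (xs @ [u])" using awalk_successively[OF u(1)] eq by simp
  ultimately have "cyc xs" using u(3) lx x0 hx by (auto simp: cyc_def successively_append_iff)
  then show ?thesis using that lx by blast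
qed

text \<open>The arcs of the cycle join each vertex to its cyclic successor. Inducedness says that,
  up to direction, these are all arcs between its vertices.\<close>

lemma icyc_hole:
  assumes xs: "icyc xs" "4 \<le> length xs"
  shows "hole G (cycle_arcs xs)"
proof -
  have c: "cyc xs" using icyc_cyc[OF xs(1)] .
  let ?Z = "set (zip (xs @ [hd xs]) (tl xs @ [hd xs]))"
  have x0: "xs \<noteq> []" using xs by auto
  have Z: "(u, v) \<in> ?Z \<longleftrightarrow> (\<exists>i<length xs. u = xs ! i \<and> v = (xs @ [hd xs]) ! Suc i)" for u v
  proof -
    have t: "(tl xs @ [hd xs]) ! i = (xs @ [hd xs]) ! Suc i" for i using x0 by (cases xs) auto
    have b: "(xs @ [hd xs]) ! i = xs ! i" if "i < length xs" for i using that by (simp add: nth_append)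
    have "?Z = {((xs @ [hd xs]) ! i, (tl xs @ [hd xs]) ! i) |i. i < length xs}"
      using x0 by (simp add: set_zip)
    then have "(u, v) \<in> ?Z \<longleftrightarrow> (\<exists>i<length xs. u = (xs @ [hd xs]) ! i \<and> v = (xs @ [hd xs]) ! Suc i)"
      unfolding t by blast
    then show ?thesis using b by metis
  qed
  have nx: "(xs @ [hd xs]) ! Suc i = (if Suc i < length xs then xs ! Suc i else xs ! 0)" if "i < length xs" for i
    using that x0 by (auto simp: nth_append hd_conv_nth)
  have adj: "u \<rightarrow>\<^bsub>G\<^esub> v \<and> u \<in> set xs \<and> v \<in> set xs \<longleftrightarrow> (u, v) \<in> ?Z \<or> (v, u) \<in> ?Z" (is "?L \<longleftrightarrow> ?R") for u v
  proof
    assume L: ?L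
    then obtain i j where ij: "i < length xs" "j < length xs" "u = xs ! i" "v = xs ! j" by (auto simp: in_set_conv_nth)
    with L icyc_nth[OF xs(1) ij(1,2)]
    have "j = Suc i \<or> i = Suc j \<or> i = 0 \<and> j = length xs - 1 \<or> j = 0 \<and> i = length xs - 1" by simp
    moreover have "(xs ! k, xs ! Suc k) \<in> ?Z" if "Suc k < length xs" for k
      unfolding Z using that nx[of k] by (metis Suc_lessD)
    moreover have "(xs ! (length xs - 1), xs ! 0) \<in> ?Z"
      unfolding Z using nx[of "length xs - 1"] x0 by (intro exI[of _ "length xs - 1"]) simp
    ultimately show ?R using ij by metis
  next
    have "u \<rightarrow>\<^bsub>G\<^esub> v \<and> u \<in> set xs \<and> v \<in> set xs" if uv: "(u, v) \<in> ?Z" for u v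
    proof -
      obtain i where i: "i < length xs" "u = xs ! i" "v = (if Suc i < length xs then xs ! Suc i else xs ! 0)"
        using uv nx unfolding Z by auto
      show ?thesis
      proof (cases "Suc i < length xs")
        case True
        then show ?thesis using i icyc_nth[OF xs(1) i(1) True] by auto
      next
        case False
        then have "i = length xs - 1" "0 < length xs" using i(1) by auto
        then show ?thesis using i False icyc_nth[OF xs(1) i(1), of 0] by auto
      qed
    qed
    then show "?R \<Longrightarrow> ?L" using E_sym by blast
  qed
  have "arcs_ends (G \<restriction> set xs) = {(u, v). u \<rightarrow>\<^bsub>G\<^esub> v \<and> u \<in> set xs \<and> v \<in> set xs}"
    by (auto simp: arcs_ends_conv)
  also have "\<dots> = ?Z \<union> ?Z\<inverse>" using adj by auto
  finally show ?thesis
    using cycle_arcs[OF c] xs(2) by (simp add: hole_def cycle_ends_def)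
qed

section \<open>Girth, cut vertices and degrees of the digraph\<close>

lemma girth_cyc:
  assumes "cyc xs" shows "girth G \<le> enat (length xs)"
  unfolding girth_def using cycle_arcs(1,2)[OF assms] by (metis INF_lower mem_Collect_eq)

lemma girth_attained:
  assumes "girth G = enat k"
  obtains xs where "cyc xs" "length xs = k"
proof -
  let ?A = "(\<lambda>p. enat (length p)) ` {p. graph_cycle G p}"
  have "?A \<noteq> {}"
  proof
    assume "?A = {}"
    then have "girth G = \<infinity>" unfolding girth_def by (simp add: Inf_enat_def)
    with assms show False by simp
  qed
  then have "Inf ?A \<in> ?A" unfolding Inf_enat_def by (auto intro: LeastI)
  then obtain p where "graph_cycle G p" "length p = k" using assms by (auto simp: girth_def)
  then show ?thesis using cycle_cyc that by metis
qed

text \<open>After the deletion of \<open>w\<close> all other vertices are reachable from a vertex of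
  \<open>X\<close>, and a path that avoids \<open>w\<close> never leaves \<open>X\<close>.\<close>

lemma no_K1_cut_closed:
  assumes nc: "\<not> K1_cut G {w}" and w: "w \<in> verts G"
    and X: "X \<subseteq> verts G - {w}" "X \<noteq> {}"
    and cl: "\<And>x y. x \<in> X \<Longrightarrow> x \<rightarrow>\<^bsub>G\<^esub> y \<Longrightarrow> y \<in> X \<or> y = w"
  shows "X = verts G - {w}"
proof -
  let ?H = "G \<restriction> (verts G - {w})"
  have ind: "induced_subgraph ?H G" by (rule induced_induce) auto
  have sH: "symmetric ?H" using induced_graph_imp_symmetric[OF sym_arcs ind] .
  have "\<not> disconnected ?H" using nc w by (auto simp: K1_cut_def)
  then have "connected ?H" using X by (auto simp: disconnected_def)
  then have reach: "u \<rightarrow>\<^sup>*\<^bsub>?H\<^esub> v" if "u \<in> verts G - {w}" "v \<in> verts G - {w}" for u v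
    using that wf_digraph.reachable_mk_symmetric_eq[OF wellformed_induce_subgraph sH]
    by (auto simp: connected_def strongly_connected_def)
  obtain x where x: "x \<in> X" using X by blast
  have "v \<in> X" if "v \<in> verts G - {w}" for v
  proof -
    have "x \<rightarrow>\<^sup>*\<^bsub>?H\<^esub> v" using reach x X that by blast
    then show ?thesis unfolding reachable_def
    proof (induction rule: rtrancl_on_induct)
      case base
      show ?case by (rule x)
    next
      case (step a b)
      then have "a \<rightarrow>\<^bsub>G\<^esub> b" "b \<noteq> w" by (auto simp: arcs_ends_conv)
      then show ?case using cl step by blast
    qed
  qed
  then show ?thesis using X by blast
qed

text \<open>Without parallel arcs the out-degree counts neighbours. Two distinct ones would be all,
  and the degree would be 2.\<close>

lemma few_neighbours_out_degree:
  assumes "\<And>c. v \<rightarrow>\<^bsub>G\<^esub> c \<Longrightarrow> c = a \<or> c = b" "out_degree G v \<noteq> 2"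
  shows "\<exists>a. \<forall>c. v \<rightarrow>\<^bsub>G\<^esub> c \<longrightarrow> c = a"
proof (rule ccontr)
  assume n: "\<not> ?thesis"
  have inj: "inj_on (head G) (out_arcs G v)"
    using no_multi_arcs by (auto simp: inj_on_def arc_to_ends_def out_arcs_def)
  have img: "head G ` out_arcs G v = {c. v \<rightarrow>\<^bsub>G\<^esub> c}"
    by (auto simp: out_arcs_def arcs_ends_conv)
  have "{c. v \<rightarrow>\<^bsub>G\<^esub> c} = {a, b} \<and> a \<noteq> b" using n assms(1) by blast
  then have "card (head G ` out_arcs G v) = 2" using img by auto
  then show False using card_image[OF inj] assms(2) by (simp add: out_degree_def)
qed

end

theorem theorem1p4:
  fixes G :: "('a, 'b) pre_digraph" and l :: nat
  assumes "5 \<le> l"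
    and "graph G"
    and "girth G = enat (2 * l)"
    and "\<not> (\<exists>p. hole G p \<and> even (length p) \<and> 2 * l + 2 \<le> length p)"
  shows "(\<exists>v \<in> verts G. out_degree G v = 2) \<or> (\<exists>X. K1_cut G X) \<or> (\<exists>X. K2_cut G X)"
proof (rule ccontr)
  assume "\<not> ?thesis"
  then have deg: "\<And>v. v \<in> verts G \<Longrightarrow> out_degree G v \<noteq> 2" and nc: "\<And>X. \<not> K1_cut G X" by blast+
  interpret graph G by (rule assms(2))
  obtain xs where xs: "cyc xs" "length xs = 2 * l" using girth_attained[OF assms(3)] .
  have min: "2 * l \<le> length ys" if "cyc ys" for ys using girth_cyc[OF that] assms(3) by simp
  have even: "length ys = 2 * l" if ys: "icyc ys" "even (length ys)" for ys
  proof -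
    have len: "2 * l \<le> length ys" using min icyc_cyc ys by blast
    have "hole G (cycle_arcs ys)" using icyc_hole[OF ys(1)] len assms(1) by simp
    then have "\<not> 2 * l + 2 \<le> length ys" using assms(4) cycle_arcs(2)[OF icyc_cyc[OF ys(1)]] ys(2) by metis
    with len ys(2) show ?thesis by presburger
  qed
  have big: "3 \<le> card (verts G)"
  proof -
    have "set (cycle_arcs xs) \<subseteq> arcs G"
      using cycle_arcs(1)[OF xs(1)] by (auto simp: graph_cycle_def cycle_def awalk_def)
    then have "set xs \<subseteq> verts G"
      unfolding cycle_arcs(3)[OF xs(1), symmetric] cycle_verts_def by auto
    then have "card (set xs) \<le> card (verts G)" by (intro card_mono) auto
    moreover have "card (set xs) = 2 * l" using xs by (simp add: cyc_def distinct_card)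
    ultimately show ?thesis using assms(1) by simp
  qed
  note closed = no_K1_cut_closed[OF nc]
  have deg3: "\<exists>c. v \<rightarrow>\<^bsub>G\<^esub> c \<and> c \<noteq> a \<and> c \<noteq> b" if v: "v \<in> verts G" for v a b
  proof (rule ccontr)
    assume "\<not> ?thesis"
    then obtain w where w: "\<And>c. v \<rightarrow>\<^bsub>G\<^esub> c \<Longrightarrow> c = w"
      using few_neighbours_out_degree[of v a b] deg[OF v] by blast
    have "verts G - {v} \<noteq> {}" using big card_mono[of "{v}" "verts G"] by auto
    \<comment> \<open>A vertex \<open>v\<close> of degree at most 1 is cut off by deleting its
      neighbour. If it has none, any other vertex serves as \<open>u\<close>.\<close>
    then obtain u where u: "u \<in> verts G" "u \<noteq> v" "w \<in> verts G \<and> w \<noteq> v \<longrightarrow> u = w" by blast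
    have "{v} = verts G - {u}"
      by (rule closed) (use u v w dominates_verts E_irrefl in blast)+
    then have "verts G \<subseteq> {u, v}" by blast
    then have "card (verts G) \<le> card {u, v}" by (intro card_mono) auto
    with big show False by (simp add: card_insert_if split: if_splits)
  qed
  have "counterexample (dominates G) (verts G) l"
  proof unfold_locales
    show "\<exists>xs. icyc xs \<and> length xs = 2 * l" using shortest_cycle[OF xs(1)] xs min by auto
  qed (use assms(1) dominates_verts min even deg3 closed in auto)
  then show False by (rule counterexample.absurd)
qed

end
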